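(* There exist a Pythagorean pair $(b,a)$ and a function $f\in\mathcal{H}(b)$ such that $\phi:=b/a\in\bigcap_{0<p<2}H^p$, yet the series $\sum_{n\ge0}\overline{\hat{\phi}(n)}\hat{f}(n)$ diverges.
   Context: $\mathbb{D}$ is the open unit disk, $\mathbb{T}$ the unit circle, and $H^p$ ($0<p\le\infty$) the Hardy spaces on $\mathbb{D}$. A Pythagorean pair is a pair $(b,a)$ of functions in $H^\infty$ such that $|b|^2+|a|^2=1$ a.e. on $\mathbb{T}$, $a$ is outer and $a(0)>0$. For $b\in H^\infty$ with $\|b\|_{H^\infty}\le1$, the de Branges--Rovnyak space $\mathcal{H}(b)$ is the Hilbert space of functions on $\mathbb{D}$ with reproducing kernel $(z,w)\mapsto (1-\overline{b(w)}b(z))/(1-\overline{w}z)$; it is contractively contained in $H^2$. For $f$ holomorphic on $\mathbb{D}$, $\hat{f}(n)$ denotes the $n$-th Taylor coefficient of $f$ at $0$. *)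

theory Defs
  imports "HOL-Complex_Analysis.Complex_Analysis"
begin

abbreviation unit_disc :: "complex set" where
  "unit_disc \<equiv> ball 0 1"

text \<open>
  A function on the disc is represented by a total function on the complex numbers; in the
  definitions of the Hardy spaces, radial limits and outer functions the values off the disc
  play no role. The circle is parametrised by \<open>cis t\<close>, \<open>0 \<le> t \<le> 2 * pi\<close>.
\<close>

definition hardy_space :: "real \<Rightarrow> (complex \<Rightarrow> complex) set" where
  "hardy_space p = {f. f holomorphic_on unit_disc \<and>
     (\<exists>M. \<forall>r\<in>{0..<1}.
        1 / (2 * pi) * (LBINT t:{0..2 * pi}. norm (f (complex_of_real r * cis t)) powr p) \<le> M)}"

definition hardy_infinity :: "(complex \<Rightarrow> complex) set" where
  "hardy_infinity = {f. f holomorphic_on unit_disc \<and> bounded (f ` unit_disc)}"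

definition has_radial_limit :: "(complex \<Rightarrow> complex) \<Rightarrow> real \<Rightarrow> complex \<Rightarrow> bool" where
  "has_radial_limit f t l \<longleftrightarrow> ((\<lambda>r. f (complex_of_real r * cis t)) \<longlongrightarrow> l) (at_left 1)"

text \<open>
  \<open>u\<close> is the logarithm of the prescribed positive boundary modulus.
\<close>

definition outer_function :: "(complex \<Rightarrow> complex) \<Rightarrow> bool" where
  "outer_function f \<longleftrightarrow>
     (\<exists>c u. norm c = 1 \<and> set_integrable lborel {0..2 * pi} (u :: real \<Rightarrow> real) \<and>
       (\<forall>z\<in>unit_disc. f z = c * exp (1 / (2 * complex_of_real pi) *
          (LBINT t:{0..2 * pi}. (cis t + z) / (cis t - z) * complex_of_real (u t)))))"

text \<open>
  By Fatou's theorem the radial limits of functions in \<open>hardy_infinity\<close> exist almost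
  everywhere, so asking for their existence below is no additional restriction.
\<close>

definition pythagorean_pair :: "(complex \<Rightarrow> complex) \<Rightarrow> (complex \<Rightarrow> complex) \<Rightarrow> bool" where
  "pythagorean_pair b a \<longleftrightarrow>
     b \<in> hardy_infinity \<and> a \<in> hardy_infinity \<and>
     (AE t in lborel. t \<in> {0..2 * pi} \<longrightarrow>
        (\<exists>\<beta> \<alpha>. has_radial_limit b t \<beta> \<and> has_radial_limit a t \<alpha> \<and>
               (norm \<beta>)\<^sup>2 + (norm \<alpha>)\<^sup>2 = 1)) \<and>
     outer_function a \<and> a 0 \<in> \<real> \<and> Re (a 0) > 0"

text \<open>
  A complex Hilbert space of functions on \<open>X\<close>. Its elements are extended by zero off \<open>X\<close>,
  so that equality of total functions is equality on \<open>X\<close>. The inner product is linear in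
  the first argument; its values outside \<open>H\<close> are irrelevant.
\<close>

locale function_hilbert_space =
  fixes X :: "complex set"
    and H :: "(complex \<Rightarrow> complex) set"
    and ip :: "(complex \<Rightarrow> complex) \<Rightarrow> (complex \<Rightarrow> complex) \<Rightarrow> complex"
  assumes zero_off: "f \<in> H \<Longrightarrow> z \<notin> X \<Longrightarrow> f z = 0"
    and zero_mem: "(\<lambda>z. 0) \<in> H"
    and add_mem: "f \<in> H \<Longrightarrow> g \<in> H \<Longrightarrow> (\<lambda>z. f z + g z) \<in> H"
    and scale_mem: "f \<in> H \<Longrightarrow> (\<lambda>z. c * f z) \<in> H"
    and ip_add: "f \<in> H \<Longrightarrow> g \<in> H \<Longrightarrow> h \<in> H \<Longrightarrow> ip (\<lambda>z. f z + g z) h = ip f h + ip g h"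
    and ip_scale: "f \<in> H \<Longrightarrow> h \<in> H \<Longrightarrow> ip (\<lambda>z. c * f z) h = c * ip f h"
    and ip_commute: "f \<in> H \<Longrightarrow> g \<in> H \<Longrightarrow> ip g f = cnj (ip f g)"
    and ip_nonneg: "f \<in> H \<Longrightarrow> 0 \<le> Re (ip f f)"
    and ip_definite: "f \<in> H \<Longrightarrow> ip f f = 0 \<Longrightarrow> f = (\<lambda>z. 0)"
    and complete:
      "(\<And>n. F n \<in> H) \<Longrightarrow>
       (\<And>\<epsilon>. \<epsilon> > 0 \<Longrightarrow> \<exists>N. \<forall>m\<ge>N. \<forall>n\<ge>N.
          sqrt (Re (ip (\<lambda>z. F m z - F n z) (\<lambda>z. F m z - F n z))) < \<epsilon>) \<Longrightarrow>
       \<exists>f\<in>H. (\<lambda>n::nat. sqrt (Re (ip (\<lambda>z. F n z - f z) (\<lambda>z. F n z - f z)))) \<longlonglongrightarrow> 0"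

locale reproducing_kernel_hilbert_space = function_hilbert_space +
  fixes K :: "complex \<Rightarrow> complex \<Rightarrow> complex"
  assumes kernel_mem: "w \<in> X \<Longrightarrow> (\<lambda>z. if z \<in> X then K z w else 0) \<in> H"
    and reproducing: "f \<in> H \<Longrightarrow> w \<in> X \<Longrightarrow> ip f (\<lambda>z. if z \<in> X then K z w else 0) = f w"

definition dbr_kernel :: "(complex \<Rightarrow> complex) \<Rightarrow> complex \<Rightarrow> complex \<Rightarrow> complex" where
  "dbr_kernel b z w = (1 - cnj (b w) * b z) / (1 - cnj w * z)"

text \<open>
  A reproducing kernel Hilbert space is determined by its kernel, so at most one pair
  \<open>(H, ip)\<close> (up to the values of \<open>ip\<close> outside \<open>H\<close>) occurs here; it exists when \<open>b\<close> lies in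
  the closed unit ball of \<open>hardy_infinity\<close>.
\<close>

definition de_Branges_Rovnyak :: "(complex \<Rightarrow> complex) \<Rightarrow> (complex \<Rightarrow> complex) set" where
  "de_Branges_Rovnyak b =
     {f. \<exists>H ip. reproducing_kernel_hilbert_space unit_disc H ip (dbr_kernel b) \<and> f \<in> H}"

definition taylor_coeff :: "(complex \<Rightarrow> complex) \<Rightarrow> nat \<Rightarrow> complex" where
  "taylor_coeff f n = fps_nth (fps_expansion f 0) n"

end

theory Submission
  imports Defs
begin

text \<open>
  Write \<open>\<phi> = b / a\<close> with \<open>a\<close> outer and \<open>\<bar>a\<bar>\<^sup>2 = 1 / (1 + \<bar>\<phi>\<bar>\<^sup>2)\<close> on the circle. The space
  \<open>\<H>(b)\<close> contains \<open>f = T\<^sub>a\<^sup>* h\<close> for every \<open>h\<close> in \<open>H\<^sup>2\<close>, and for such \<open>f\<close> the partial sums of the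
  series are the scalar products of \<open>h\<close> with \<open>a \<phi>\<^sub>N\<close>, where \<open>\<phi>\<^sub>N\<close> is the \<open>N\<close>-th Taylor polynomial
  of \<open>\<phi>\<close>. By uniform boundedness it is enough that the weighted norms
  \<open>\<integral> \<bar>\<phi>\<^sub>N\<bar>\<^sup>2 / (1 + \<bar>\<phi>\<bar>\<^sup>2)\<close> be unbounded in \<open>N\<close>.

  Such a \<open>\<phi>\<close> is a sum of blocks \<open>c \<omega>\<^sup>n (1 + z\<^sup>n\<^sup>+\<^sup>1)\<^sup>r\<close> with \<open>\<omega> = z (1 + z) / 2\<close>, whose frequencies do
  not overlap. The factor \<open>c \<omega>\<^sup>n\<close> is a peak of height \<open>c\<close> and width \<open>n\<^sup>-\<^sup>1\<^sup>/\<^sup>2\<close> at \<open>1\<close>. Cutting the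
  block at frequency \<open>2 n\<close> leaves exactly \<open>c \<omega>\<^sup>n\<close>, while the whole block is at most \<open>1\<close> on the part
  of the peak where \<open>\<bar>1 + z\<^sup>n\<^sup>+\<^sup>1\<bar> \<le> c\<^sup>-\<^sup>1\<^sup>/\<^sup>r\<close>, a fraction of about \<open>c\<^sup>-\<^sup>1\<^sup>/\<^sup>r\<close> of it. There the
  weighted norm of the cut is about \<open>c\<^sup>2\<^sup>-\<^sup>1\<^sup>/\<^sup>r n\<^sup>-\<^sup>1\<^sup>/\<^sup>2\<close>, whereas the \<open>p\<close>-th power of the \<open>L\<^sup>p\<close> norm of the
  block is about \<open>c\<^sup>p n\<^sup>-\<^sup>1\<^sup>/\<^sup>2\<close>. With \<open>c = L\<^sup>r\<close> and \<open>n = L\<^sup>4\<^sup>r\<^sup>-\<^sup>4\<close> the former is \<open>L\<close>, and the latter is small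
  as soon as \<open>p < 2 - 2 / r\<close>; so let \<open>r\<close> tend to infinity along the blocks.
\<close>

section \<open>Square-summable sequences\<close>

text \<open>The ratio |\<phi>|^2 / (1 + |\<phi>|^2) is below 1, so large weighted norms need points
  where a Taylor polynomial is large although \<phi> is much smaller. The factor (1 + z^(n+1))^r
  provides them: its constant term is 1, yet it vanishes to order r at n + 1 points of the circle. A
  fixed r reaches only exponents p < 2 - 2 / r, hence the growing exponents. The other obstacle is
  the boundary. All blocks peak at the same point 1, so \<phi> is locally Lipschitz on the closed
  disc without 1, and the radial limits of a and b come from direct estimates of Schwarz integrals.
  H^2 is represented by its sequences of Taylor coefficients, and inner products are limits of means
  over circles inside the disc. In this form |a|^2 + |b|^2 = 1 becomes the operator identity T_a*
  T_a + T_b* T_b = I. It yields an explicit model of the de Branges--Rovnyak space by pairs of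
  sequences, in which T_a* h visibly lies.\<close>

typedef ell2 = "{x :: nat \<Rightarrow> complex. summable (\<lambda>n. (norm (x n))\<^sup>2)}"
  morphisms coeff_seq Abs_ell2
  by (rule exI[of _ "\<lambda>_. 0"]) simp

setup_lifting type_definition_ell2

lemma summable_coeff_seq: "summable (\<lambda>n. (norm (coeff_seq x n))\<^sup>2)"
  using coeff_seq[of x] by simp

lemma coeff_seq_Abs: "summable (\<lambda>n. (norm (x n))\<^sup>2) \<Longrightarrow> coeff_seq (Abs_ell2 x) = x"
  by (simp add: Abs_ell2_inverse)

lemma ell2_eqI: "(\<And>n. coeff_seq x n = coeff_seq y n) \<Longrightarrow> x = y"
  by (metis coeff_seq_inject ext)

lemma norm_add_power2_le:
  fixes u v :: "'a::real_normed_vector"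
  shows "(norm (u + v))\<^sup>2 \<le> 2 * (norm u)\<^sup>2 + 2 * (norm v)\<^sup>2"
proof -
  have "(norm (u + v))\<^sup>2 \<le> (norm u + norm v)\<^sup>2"
    by (intro power_mono norm_triangle_ineq) auto
  also have "\<dots> \<le> 2 * (norm u)\<^sup>2 + 2 * (norm v)\<^sup>2"
    using zero_le_power2[of "norm u - norm v"] by (simp add: power2_eq_square algebra_simps)
  finally show ?thesis .
qed

lemma summable_norm_power2_add:
  fixes x y :: "nat \<Rightarrow> complex"
  assumes "summable (\<lambda>n. (norm (x n))\<^sup>2)" "summable (\<lambda>n. (norm (y n))\<^sup>2)"
  shows "summable (\<lambda>n. (norm (x n + y n))\<^sup>2)"
proof (rule summable_comparison_test)
  show "\<exists>N. \<forall>n\<ge>N. norm ((norm (x n + y n))\<^sup>2) \<le> 2 * (norm (x n))\<^sup>2 + 2 * (norm (y n))\<^sup>2"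
    by (auto intro: norm_add_power2_le)
  show "summable (\<lambda>n. 2 * (norm (x n))\<^sup>2 + 2 * (norm (y n))\<^sup>2)"
    using assms by (intro summable_add summable_mult)
qed

instantiation ell2 :: real_vector
begin
lift_definition zero_ell2 :: ell2 is "\<lambda>_. 0" by simp
lift_definition plus_ell2 :: "ell2 \<Rightarrow> ell2 \<Rightarrow> ell2" is "\<lambda>x y n. x n + y n"
  by (rule summable_norm_power2_add)
lift_definition uminus_ell2 :: "ell2 \<Rightarrow> ell2" is "\<lambda>x n. - x n" by simp
lift_definition minus_ell2 :: "ell2 \<Rightarrow> ell2 \<Rightarrow> ell2" is "\<lambda>x y n. x n - y n"
  using summable_norm_power2_add[of _ "\<lambda>n. - _ n"] by auto
lift_definition scaleR_ell2 :: "real \<Rightarrow> ell2 \<Rightarrow> ell2" is "\<lambda>c x n. c *\<^sub>R x n"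
  by (simp add: power_mult_distrib summable_mult)
instance
  by standard (transfer; auto simp: algebra_simps)+
end

lift_definition scaleC :: "complex \<Rightarrow> ell2 \<Rightarrow> ell2" is "\<lambda>c x n. c * x n"
  by (simp add: norm_mult power_mult_distrib summable_mult)

lemma coeff_seq_simps [simp]:
  "coeff_seq 0 n = 0"
  "coeff_seq (x + y) n = coeff_seq x n + coeff_seq y n"
  "coeff_seq (x - y) n = coeff_seq x n - coeff_seq y n"
  "coeff_seq (- x) n = - coeff_seq x n"
  "coeff_seq (r *\<^sub>R x) n = r *\<^sub>R coeff_seq x n"
  "coeff_seq (scaleC c x) n = c * coeff_seq x n"
  by (transfer; simp)+

lemma coeff_seq_sum: "coeff_seq (\<Sum>i\<in>I. f i) n = (\<Sum>i\<in>I. coeff_seq (f i) n)"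
  by (induction I rule: infinite_finite_induct) auto

text \<open>Linear in the first argument, as \<open>function_hilbert_space\<close> demands. Its real
  part becomes the \<open>inner\<close> of the class \<open>real_inner\<close>, so both give the
  same norm: adjoints and kernels use the complex form, the uniform boundedness argument the real
  one.\<close>

definition cip :: "ell2 \<Rightarrow> ell2 \<Rightarrow> complex" where
  "cip x y = (\<Sum>n. coeff_seq x n * cnj (coeff_seq y n))"

lemma summable_cip_norm: "summable (\<lambda>n. norm (coeff_seq x n * cnj (coeff_seq y n)))"
proof (rule summable_comparison_test)
  show "\<exists>N. \<forall>n\<ge>N. norm (norm (coeff_seq x n * cnj (coeff_seq y n)))
      \<le> (norm (coeff_seq x n))\<^sup>2 + (norm (coeff_seq y n))\<^sup>2"
  proof (intro exI allI impI)
    fix n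
    have "2 * (norm (coeff_seq x n) * norm (coeff_seq y n)) \<le> (norm (coeff_seq x n))\<^sup>2 + (norm (coeff_seq y n))\<^sup>2"
      using zero_le_power2[of "norm (coeff_seq x n) - norm (coeff_seq y n)"]
      by (simp add: power2_eq_square algebra_simps)
    moreover have "0 \<le> norm (coeff_seq x n) * norm (coeff_seq y n)" by simp
    ultimately have "norm (coeff_seq x n) * norm (coeff_seq y n) \<le> (norm (coeff_seq x n))\<^sup>2 + (norm (coeff_seq y n))\<^sup>2"
      by linarith
    then show "norm (norm (coeff_seq x n * cnj (coeff_seq y n)))
      \<le> (norm (coeff_seq x n))\<^sup>2 + (norm (coeff_seq y n))\<^sup>2"
      by (simp add: norm_mult)
  qed
qed (intro summable_add summable_coeff_seq)

lemma summable_cip: "summable (\<lambda>n. coeff_seq x n * cnj (coeff_seq y n))"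
  using summable_cip_norm by (rule summable_norm_cancel)

lemma cip_sums: "(\<lambda>n. coeff_seq x n * cnj (coeff_seq y n)) sums cip x y"
  unfolding cip_def by (rule summable_sums[OF summable_cip])

lemma cip_add_left: "cip (x + y) z = cip x z + cip y z"
  unfolding cip_def by (simp add: algebra_simps suminf_add summable_cip)

lemma cip_scaleC_left: "cip (scaleC c x) z = c * cip x z"
  unfolding cip_def by (simp add: mult.assoc suminf_mult summable_cip)

lemma cip_commute: "cip y x = cnj (cip x y)"
proof -
  have "(\<lambda>n. cnj (coeff_seq x n * cnj (coeff_seq y n))) sums cnj (cip x y)"
    by (rule sums_cnj[THEN iffD2, OF cip_sums])
  then show ?thesis
    using cip_sums[of y x] by (simp add: mult.commute sums_unique2)
qed

lemma cip_add_right: "cip z (x + y) = cip z x + cip z y"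
  by (metis cip_add_left cip_commute complex_cnj_add)

lemma cip_scaleC_right: "cip z (scaleC c x) = cnj c * cip z x"
  by (metis cip_commute cip_scaleC_left complex_cnj_mult)

lemma scaleR_eq_scaleC: "r *\<^sub>R x = scaleC (complex_of_real r) x"
  by (rule ell2_eqI) (simp add: scaleR_conv_of_real)

lemma uminus_eq_scaleC: "- x = scaleC (-1) x"
  by (rule ell2_eqI) simp

lemma cip_minus_left: "cip (- x) z = - cip x z"
  by (simp add: uminus_eq_scaleC cip_scaleC_left)

lemma cip_minus_right: "cip z (- x) = - cip z x"
  by (simp add: uminus_eq_scaleC cip_scaleC_right)

lemma cip_diff_left: "cip (x - y) z = cip x z - cip y z"
  using cip_add_left[of x "- y" z] by (simp add: cip_minus_left)

lemma cip_diff_right: "cip z (x - y) = cip z x - cip z y"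
  using cip_add_right[of z x "- y"] by (simp add: cip_minus_right)

lemma cip_zero [simp]: "cip 0 x = 0" "cip x 0 = 0"
  by (simp_all add: cip_def)

lemma cip_self: "cip x x = complex_of_real (\<Sum>n. (norm (coeff_seq x n))\<^sup>2)"
proof -
  have "(\<lambda>n. complex_of_real ((norm (coeff_seq x n))\<^sup>2)) sums complex_of_real (\<Sum>n. (norm (coeff_seq x n))\<^sup>2)"
    by (rule sums_of_real[OF summable_sums[OF summable_coeff_seq]])
  then show ?thesis
    using cip_sums[of x x] by (simp only: complex_norm_square) (rule sums_unique2)
qed

instantiation ell2 :: real_inner
begin
definition inner_ell2 :: "ell2 \<Rightarrow> ell2 \<Rightarrow> real" where "inner_ell2 x y = Re (cip x y)"
definition norm_ell2 :: "ell2 \<Rightarrow> real" where "norm_ell2 x = sqrt (inner x x)"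
definition dist_ell2 :: "ell2 \<Rightarrow> ell2 \<Rightarrow> real" where "dist_ell2 x y = norm (x - y)"
definition sgn_ell2 :: "ell2 \<Rightarrow> ell2" where "sgn_ell2 x = x /\<^sub>R norm x"
definition uniformity_ell2 :: "(ell2 \<times> ell2) filter" where
  "uniformity_ell2 = (INF e\<in>{0 <..}. principal {(x, y). dist x y < e})"
definition open_ell2 :: "ell2 set \<Rightarrow> bool" where
  "open_ell2 U = (\<forall>x\<in>U. eventually (\<lambda>(x', y). x' = x \<longrightarrow> y \<in> U) uniformity)"
instance
proof
  fix x y z :: ell2 and r :: real
  show "inner x y = inner y x"
    unfolding inner_ell2_def by (subst cip_commute) simp
  show "inner (x + y) z = inner x z + inner y z"
    by (simp add: inner_ell2_def cip_add_left)
  show "inner (r *\<^sub>R x) y = r * inner x y"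
    by (simp add: inner_ell2_def scaleR_eq_scaleC cip_scaleC_left)
  show "0 \<le> inner x x"
    by (simp add: inner_ell2_def cip_self suminf_nonneg summable_coeff_seq)
  show "inner x x = 0 \<longleftrightarrow> x = 0"
  proof
    assume "inner x x = 0"
    then have "\<And>n. (norm (coeff_seq x n))\<^sup>2 = 0"
      using suminf_eq_zero_iff[OF summable_coeff_seq[of x]] by (simp add: inner_ell2_def cip_self)
    then show "x = 0" by (intro ell2_eqI) simp
  qed (simp add: inner_ell2_def)
qed (simp_all add: norm_ell2_def dist_ell2_def sgn_ell2_def uniformity_ell2_def open_ell2_def)
end

lemma norm_ell2_sq: "(norm x)\<^sup>2 = (\<Sum>n. (norm (coeff_seq x n))\<^sup>2)"
  using power2_norm_eq_inner[of x] by (simp add: inner_ell2_def cip_self)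

lemma cip_self_norm: "cip x x = complex_of_real ((norm x)\<^sup>2)"
  by (simp add: cip_self norm_ell2_sq)

lemma norm_ell2_leI:
  assumes "\<And>N. (\<Sum>n<N. (norm (coeff_seq x n))\<^sup>2) \<le> C\<^sup>2" "0 \<le> C"
  shows "norm x \<le> C"
proof -
  have "(norm x)\<^sup>2 \<le> C\<^sup>2"
    unfolding norm_ell2_sq by (rule suminf_le_const[OF summable_coeff_seq assms(1)])
  then show ?thesis using assms(2) power2_le_imp_le by blast
qed

lemma sum_coeff_seq_le: "(\<Sum>n<N. (norm (coeff_seq x n))\<^sup>2) \<le> (norm x)\<^sup>2"
  unfolding norm_ell2_sq by (rule sum_le_suminf[OF summable_coeff_seq]) auto

lemma norm_coeff_seq_le: "norm (coeff_seq x n) \<le> norm x"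
proof -
  have "(norm (coeff_seq x n))\<^sup>2 \<le> (\<Sum>k<Suc n. (norm (coeff_seq x k))\<^sup>2)"
    by (rule member_le_sum) auto
  also have "\<dots> \<le> (norm x)\<^sup>2" by (rule sum_coeff_seq_le)
  finally show ?thesis by (rule power2_le_imp_le) simp
qed

lemma norm_scaleC: "norm (scaleC c x) = norm c * norm x"
proof -
  have "(norm (scaleC c x))\<^sup>2 = (norm c * norm x)\<^sup>2"
    by (simp add: norm_ell2_sq norm_mult power_mult_distrib suminf_mult summable_coeff_seq)
  then show ?thesis by simp
qed

text \<open>A unimodular factor on \<open>x\<close> turns the pairing into its modulus, and the real
  Cauchy-Schwarz inequality applies.\<close>

lemma norm_cip_le: "norm (cip x y) \<le> norm x * norm y"
proof (cases "cip x y = 0")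
  case False
  define u where "u = cnj (cip x y) / norm (cip x y)"
  have "complex_of_real (norm (cip x y)) = u * cip x y"
    using False complex_norm_square[of "cip x y"]
    by (simp add: u_def field_simps power2_eq_square)
  then have "norm (cip x y) = inner (scaleC u x) y"
    by (metis Re_complex_of_real cip_scaleC_left inner_ell2_def)
  also have "\<dots> \<le> norm (scaleC u x) * norm y"
    by (rule norm_cauchy_schwarz)
  also have "\<dots> = norm x * norm y"
    using False by (simp add: norm_scaleC u_def norm_divide)
  finally show ?thesis .
qed simp

lemma bounded_linear_cip_left: "bounded_linear (\<lambda>x. cip x y)"
  by (rule bounded_linear_intro[where K = "norm y"])
    (auto simp: cip_add_left scaleR_eq_scaleC cip_scaleC_left norm_cip_le scaleR_conv_of_real)

lemma bounded_linear_cip_right: "bounded_linear (\<lambda>x. cip y x)"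
  by (rule bounded_linear_intro[where K = "norm y"])
    (auto simp: cip_add_right scaleR_eq_scaleC cip_scaleC_right mult.commute[of _ "norm y"] norm_cip_le scaleR_conv_of_real)

instance ell2 :: complete_space
proof
  fix X :: "nat \<Rightarrow> ell2"
  assume X: "Cauchy X"
  have "Cauchy (\<lambda>i. coeff_seq (X i) n)" for n
  proof (rule metric_CauchyI)
    fix e :: real assume "0 < e"
    then obtain M where "\<forall>i\<ge>M. \<forall>j\<ge>M. dist (X i) (X j) < e"
      using X metric_CauchyD by blast
    moreover have "dist (coeff_seq (X i) n) (coeff_seq (X j) n) \<le> dist (X i) (X j)" for i j
      using norm_coeff_seq_le[of "X i - X j" n] by (simp add: dist_norm)
    ultimately show "\<exists>M. \<forall>i\<ge>M. \<forall>j\<ge>M. dist (coeff_seq (X i) n) (coeff_seq (X j) n) < e"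
      using le_less_trans by blast
  qed
  then have "\<forall>n. \<exists>l. (\<lambda>i. coeff_seq (X i) n) \<longlonglongrightarrow> l"
    by (simp add: Cauchy_convergent_iff convergent_def)
  then obtain l where l: "\<And>n. (\<lambda>i. coeff_seq (X i) n) \<longlonglongrightarrow> l n"
    by metis
  \<comment> \<open>Finite partial sums allow the limit in j before \<open>l\<close> is known to be
    square summable; the same bound later gives both membership and convergence.\<close>
  have tail: "(\<Sum>n<N. (norm (coeff_seq (X i) n - l n))\<^sup>2) \<le> e\<^sup>2"
    if "\<forall>i\<ge>M. \<forall>j\<ge>M. dist (X i) (X j) < e" "i \<ge> M" for e M i N
  proof (rule tendsto_upperbound)
    show "(\<lambda>j. \<Sum>n<N. (norm (coeff_seq (X i) n - coeff_seq (X j) n))\<^sup>2)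
        \<longlonglongrightarrow> (\<Sum>n<N. (norm (coeff_seq (X i) n - l n))\<^sup>2)"
      by (intro tendsto_intros l)
    show "\<forall>\<^sub>F j in sequentially. (\<Sum>n<N. (norm (coeff_seq (X i) n - coeff_seq (X j) n))\<^sup>2) \<le> e\<^sup>2"
    proof (rule eventually_sequentiallyI[of M])
      fix j assume "M \<le> j"
      have "(\<Sum>n<N. (norm (coeff_seq (X i) n - coeff_seq (X j) n))\<^sup>2) \<le> (norm (X i - X j))\<^sup>2"
        using sum_coeff_seq_le[of "X i - X j" N] by simp
      also have "\<dots> \<le> e\<^sup>2"
        using that \<open>M \<le> j\<close> by (intro power_mono) (auto simp: dist_norm less_imp_le)
      finally show "(\<Sum>n<N. (norm (coeff_seq (X i) n - coeff_seq (X j) n))\<^sup>2) \<le> e\<^sup>2" .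
    qed
  qed simp
  have bnd: "summable (\<lambda>n. (norm (coeff_seq (X i) n - l n))\<^sup>2)" if "\<forall>i\<ge>M. \<forall>j\<ge>M. dist (X i) (X j) < e" "i \<ge> M" for e M i
    by (rule bounded_imp_summable[where B = "e\<^sup>2"])
       (use tail[OF that, of "Suc _"] in \<open>auto simp: lessThan_Suc_atMost\<close>)
  obtain M0 where M0: "\<forall>i\<ge>M0. \<forall>j\<ge>M0. dist (X i) (X j) < 1"
    using X metric_CauchyD zero_less_one by blast
  have "summable (\<lambda>n. (norm (coeff_seq (X M0) n + - (coeff_seq (X M0) n - l n)))\<^sup>2)"
    by (rule summable_norm_power2_add[OF summable_coeff_seq])
       (use bnd[OF M0, of M0] in \<open>simp add: norm_minus_commute\<close>)
  then have suml: "summable (\<lambda>n. (norm (l n))\<^sup>2)" by simp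
  have "X \<longlonglongrightarrow> Abs_ell2 l"
  proof (rule metric_LIMSEQ_I)
    fix e :: real assume "0 < e"
    then obtain M where M: "\<forall>i\<ge>M. \<forall>j\<ge>M. dist (X i) (X j) < e/2"
      using X metric_CauchyD half_gt_zero by blast
    have "dist (X i) (Abs_ell2 l) < e" if "i \<ge> M" for i
    proof -
      have "norm (X i - Abs_ell2 l) \<le> e / 2"
        by (rule norm_ell2_leI) (use tail[OF M that] \<open>0 < e\<close> in \<open>simp_all add: coeff_seq_Abs[OF suml]\<close>)
      then show ?thesis using \<open>0 < e\<close> by (simp add: dist_norm)
    qed
    then show "\<exists>no. \<forall>n\<ge>no. dist (X n) (Abs_ell2 l) < e" by blast
  qed
  then show "convergent X" by (auto simp: convergent_def)
qed

instance ell2 :: banach ..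

definition unit_seq :: "nat \<Rightarrow> ell2" where
  "unit_seq k = Abs_ell2 (\<lambda>n. if n = k then 1 else 0)"

lemma coeff_unit_seq [simp]: "coeff_seq (unit_seq k) n = (if n = k then 1 else 0)"
proof -
  have "summable (\<lambda>n. (norm (if n = k then 1 else 0 :: complex))\<^sup>2)"
    by (rule summable_finite[of "{k}"]) auto
  then show ?thesis unfolding unit_seq_def by (subst coeff_seq_Abs) auto
qed

lemma cip_unit_seq: "cip x (unit_seq k) = coeff_seq x k"
proof -
  have "(\<lambda>n. coeff_seq x n * cnj (coeff_seq (unit_seq k) n)) = (\<lambda>n. if n = k then coeff_seq x n else 0)"
    by auto
  then show ?thesis
    using cip_sums[of x "unit_seq k"] sums_single[of k "coeff_seq x"] by (simp add: sums_unique2)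
qed

lemma unit_seq_expansion: "(\<lambda>n. scaleC (coeff_seq x n) (unit_seq n)) sums x"
proof -
  have *: "coeff_seq (\<Sum>k<N. scaleC (coeff_seq x k) (unit_seq k)) n = (if n < N then coeff_seq x n else 0)" for N n
    by (simp add: coeff_seq_sum if_distrib cong: if_cong)
  have "(\<lambda>N. (norm ((\<Sum>k<N. scaleC (coeff_seq x k) (unit_seq k)) - x))\<^sup>2) \<longlonglongrightarrow> 0"
  proof -
    have "(norm ((\<Sum>k<N. scaleC (coeff_seq x k) (unit_seq k)) - x))\<^sup>2
        = (\<Sum>n. (norm (coeff_seq x (n + N)))\<^sup>2)" for N
    proof -
      have "(norm ((\<Sum>k<N. scaleC (coeff_seq x k) (unit_seq k)) - x))\<^sup>2
         = (\<Sum>n. if n < N then 0 else (norm (coeff_seq x n))\<^sup>2)"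
        unfolding norm_ell2_sq by (intro suminf_cong) (simp add: *)
      also have "\<dots> = (\<Sum>n. if n + N < N then 0 else (norm (coeff_seq x (n + N)))\<^sup>2)
            + (\<Sum>n<N. if n < N then 0 else (norm (coeff_seq x n))\<^sup>2)"
        by (rule suminf_split_initial_segment)
          (rule summable_comparison_test[OF _ summable_coeff_seq[of x]], auto)
      finally show ?thesis by simp
    qed
    moreover have "(\<lambda>N. \<Sum>n. (norm (coeff_seq x (n + N)))\<^sup>2) \<longlonglongrightarrow> 0"
      by (rule suminf_exist_split2[OF summable_coeff_seq])
    ultimately show ?thesis by simp
  qed
  then have "(\<lambda>N. norm ((\<Sum>k<N. scaleC (coeff_seq x k) (unit_seq k)) - x)) \<longlonglongrightarrow> 0"
    using tendsto_real_sqrt[of _ 0] by fastforce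
  then show ?thesis
    unfolding sums_def by (metis LIM_zero_cancel tendsto_norm_zero_cancel)
qed

section \<open>Fourier coefficients and the Schwarz integral on the circle\<close>

text \<open>A finite measure, so that constants can serve as dominating functions. Its mass is 2 pi,
  whence the divisions by \<open>2 * pi\<close>; both endpoints lie over the point 1.\<close>

definition circ :: "real measure" where "circ = restrict_space lborel {0..2 * pi}"

lemma space_circ [simp]: "space circ = {0..2 * pi}"
  by (simp add: circ_def space_restrict_space)

lemma borel_measurable_circ: "f \<in> borel_measurable borel \<Longrightarrow> f \<in> borel_measurable circ"
  unfolding circ_def by (rule measurable_restrict_space1) simp

lemma measure_circ: "measure circ {0..2 * pi} = 2 * pi"
  by (simp add: circ_def measure_restrict_space)

lemma finite_measure_circ: "finite_measure circ"
  by (rule finite_measureI) (simp add: circ_def space_restrict_space emeasure_restrict_space)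

interpretation circ: finite_measure circ
  by (rule finite_measure_circ)

lemma set_integral_circ:
  fixes g :: "real \<Rightarrow> 'a::{banach, second_countable_topology}"
  shows "(LBINT t:{0..2 * pi}. g t) = integral\<^sup>L circ g"
  unfolding circ_def set_lebesgue_integral_def by (rule integral_restrict_space[symmetric]) simp

lemma set_integrable_circ:
  fixes g :: "real \<Rightarrow> 'a::{banach, second_countable_topology}"
  shows "set_integrable lborel {0..2 * pi} g \<longleftrightarrow> integrable circ g"
  unfolding circ_def set_integrable_def by (rule integrable_restrict_space[symmetric]) simp

lemma AE_circ: "(AE t in circ. P t) \<longleftrightarrow> (AE t in lborel. t \<in> {0..2 * pi} \<longrightarrow> P t)"
  unfolding circ_def by (rule AE_restrict_space_iff) simp

lemma measurable_cis [measurable]: "cis \<in> borel_measurable borel"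
  by (intro borel_measurable_continuous_onI continuous_intros)

lemma integral_circ_const: "integral\<^sup>L circ (\<lambda>_. c :: complex) = 2 * pi * c"
  by (simp add: measure_circ scaleR_conv_of_real)

lemma integral_circ_cis:
  "(LINT t|circ. cis (of_int k * t)) = (if k = 0 then 2 * complex_of_real pi else 0)"
proof (cases "k = 0")
  case True
  then show ?thesis using integral_circ_const[of 1] by simp
next
  case False
  have per: "cis (of_int k * (2 * pi)) = 1"
    using cis_multiple_2pi[of "of_int k"] by (simp add: mult_ac)
  have "(LINT t|circ. cis (of_int k * t))
     = (LBINT t:{0..2 * pi}. cis (of_int k * t))"
    by (rule set_integral_circ[symmetric])
  also have "\<dots> = cis (of_int k * (2 * pi)) / (\<i> * of_int k) - cis (of_int k * 0) / (\<i> * of_int k)"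
  proof -
    have "((\<lambda>t. cis (of_int k * t) / (\<i> * of_int k)) has_vector_derivative cis (of_int k * t)) (at t within {0..2*pi})" for t
    proof -
      have "((\<lambda>z. exp (\<i> * of_int k * z) / (\<i> * of_int k)) has_field_derivative exp (\<i> * of_int k * complex_of_real t)) (at (of_real t))"
        using False by (auto intro!: derivative_eq_intros)
      then have "((\<lambda>x. exp (\<i> * of_int k * complex_of_real x) / (\<i> * of_int k)) has_vector_derivative exp (\<i> * of_int k * complex_of_real t)) (at t within {0..2*pi})"
        by (rule has_vector_derivative_real_field)
      then show ?thesis by (simp add: cis_conv_exp mult_ac)
    qed
    then show ?thesis
      unfolding set_lebesgue_integral_def
      by (intro integral_FTC_Icc[where F = "\<lambda>t. cis (of_int k * t) / (\<i> * of_int k)"])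
         (auto intro!: continuous_intros)
  qed
  also have "\<dots> = 0" by (simp add: per)
  finally show ?thesis using False by simp
qed

text \<open>The n-th term has modulus \<open>norm (c n) * norm (w t)\<close>, so the integrated
  moduli are summable. The frequencies \<kappa> are integers because Taylor series need
  \<open>n\<close> and the Schwarz kernel needs \<open>- n\<close>.\<close>

lemma sums_integral_circ_cis:
  fixes c :: "nat \<Rightarrow> complex" and w :: "real \<Rightarrow> complex" and \<kappa> :: "nat \<Rightarrow> int"
  assumes c: "summable (\<lambda>n. norm (c n))" and w: "integrable circ w"
  shows "(\<lambda>n. c n * (LINT t|circ. w t * cis (of_int (\<kappa> n) * t))) sums
      (LINT t|circ. w t * (\<Sum>n. c n * cis (of_int (\<kappa> n) * t)))"
    and "integrable circ (\<lambda>t. w t * (\<Sum>n. c n * cis (of_int (\<kappa> n) * t)))"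
proof -
  have int: "integrable circ (\<lambda>t. w t * cis (of_int (\<kappa> n) * t))" for n
  proof (rule Bochner_Integration.integrable_bound[OF w])
    show "(\<lambda>t. w t * cis (of_int (\<kappa> n) * t)) \<in> borel_measurable circ"
      by (intro borel_measurable_times borel_measurable_integrable[OF w] borel_measurable_circ
          borel_measurable_continuous_onI continuous_intros)
  qed (simp add: norm_mult)
  have int': "integrable circ (\<lambda>t. w t * (c n * cis (of_int (\<kappa> n) * t)))" for n
    using integrable_mult_right[OF int, of "c n" n] by (simp only: mult.left_commute)
  have nrm: "norm (w t * (c n * cis (of_int (\<kappa> n) * t))) = norm (c n) * norm (w t)" for n t
    by (simp add: norm_mult)
  have ae: "AE t in circ. summable (\<lambda>n. norm (w t * (c n * cis (of_int (\<kappa> n) * t))))"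
    unfolding nrm by (intro AE_I2 summable_mult2 c)
  have sm: "summable (\<lambda>n. (LINT t|circ. norm (w t * (c n * cis (of_int (\<kappa> n) * t)))))"
    unfolding nrm by (simp add: summable_mult2 c)
  have eq: "(\<Sum>n. w t * (c n * cis (of_int (\<kappa> n) * t))) = w t * (\<Sum>n. c n * cis (of_int (\<kappa> n) * t))" for t
    by (rule suminf_mult, rule summable_norm_cancel) (use c in \<open>simp add: norm_mult\<close>)
  have "(\<lambda>n. (LINT t|circ. w t * (c n * cis (of_int (\<kappa> n) * t)))) sums
      integral\<^sup>L circ (\<lambda>t. \<Sum>n. w t * (c n * cis (of_int (\<kappa> n) * t)))"
    by (rule sums_integral[OF int' ae sm])
  moreover have "(LINT t|circ. w t * (c n * cis (of_int (\<kappa> n) * t)))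
     = c n * (LINT t|circ. w t * cis (of_int (\<kappa> n) * t))" for n
    by (subst integral_mult_right_zero[symmetric]) (simp only: mult.left_commute)
  ultimately show "(\<lambda>n. c n * (LINT t|circ. w t * cis (of_int (\<kappa> n) * t))) sums
      (LINT t|circ. w t * (\<Sum>n. c n * cis (of_int (\<kappa> n) * t)))"
    by (simp add: eq)
  show "integrable circ (\<lambda>t. w t * (\<Sum>n. c n * cis (of_int (\<kappa> n) * t)))"
    using integrable_suminf[OF int' ae sm] by (simp add: eq)
qed

section \<open>Taylor coefficients and Parseval's identity on circles inside the disc\<close>

lemma taylor_sums:
  assumes "f holomorphic_on unit_disc" "norm z < 1"
  shows "(\<lambda>n. taylor_coeff f n * z ^ n) sums f z"
  using holomorphic_power_series[OF assms(1), of z] assms(2)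
  by (simp add: taylor_coeff_def fps_expansion_def)

lemma taylor_summable_norm:
  assumes "f holomorphic_on unit_disc" "norm z < 1"
  shows "summable (\<lambda>n. norm (taylor_coeff f n * z ^ n))"
proof -
  define r where "r = (norm z + 1) / 2"
  have "summable (\<lambda>n. taylor_coeff f n * (complex_of_real r) ^ n)"
    using taylor_sums[OF assms(1), of "complex_of_real r"] assms(2)
    by (intro sums_summable) (auto simp: r_def)
  then show ?thesis
    by (rule powser_insidea) (use assms(2) in \<open>auto simp: r_def\<close>)
qed

lemma taylor_sums_cis:
  assumes "f holomorphic_on unit_disc" "0 \<le> r" "r < 1"
  shows "f (complex_of_real r * cis t) = (\<Sum>n. (taylor_coeff f n * complex_of_real r ^ n) * cis (of_int (int n) * t))"
    and "summable (\<lambda>n. norm (taylor_coeff f n * complex_of_real r ^ n))"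
proof -
  show "summable (\<lambda>n. norm (taylor_coeff f n * complex_of_real r ^ n))"
    using taylor_summable_norm[OF assms(1), of "complex_of_real r"] assms by simp
  have "(\<lambda>n. taylor_coeff f n * (complex_of_real r * cis t) ^ n) sums f (complex_of_real r * cis t)"
    using assms by (intro taylor_sums) (auto simp: norm_mult)
  moreover have "taylor_coeff f n * (complex_of_real r * cis t) ^ n
      = (taylor_coeff f n * complex_of_real r ^ n) * cis (of_int (int n) * t)" for n
    by (simp add: power_mult_distrib Complex.DeMoivre)
  ultimately have "(\<lambda>n. (taylor_coeff f n * complex_of_real r ^ n) * cis (of_int (int n) * t)) sums f (complex_of_real r * cis t)"
    by (simp only:)
  then show "f (complex_of_real r * cis t) = (\<Sum>n. (taylor_coeff f n * complex_of_real r ^ n) * cis (of_int (int n) * t))"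
    by (rule sums_unique)
qed

lemma continuous_on_circle_radius:
  assumes "f holomorphic_on unit_disc" "0 \<le> r" "r < 1"
  shows "continuous_on UNIV (\<lambda>t. f (complex_of_real r * cis t))"
  by (rule continuous_on_compose2[OF holomorphic_on_imp_continuous_on[OF assms(1)]])
     (use assms in \<open>auto intro!: continuous_intros simp: norm_mult\<close>)

lemma integrable_continuous_circ:
  fixes g :: "real \<Rightarrow> 'a::{banach, second_countable_topology}"
  assumes "continuous_on UNIV g"
  shows "integrable circ g"
proof -
  have "compact (g ` {0..2 * pi})"
    using assms by (intro compact_continuous_image) (auto intro: continuous_on_subset)
  then have "bounded (g ` {0..2 * pi})" by (rule compact_imp_bounded)
  then obtain B where B: "\<forall>x\<in>g ` {0..2 * pi}. norm x \<le> B"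
    unfolding bounded_iff ..
  show ?thesis
  proof (rule circ.integrable_const_bound)
    show "AE t in circ. norm (g t) \<le> B" by (rule AE_I2) (use B in simp)
    show "g \<in> borel_measurable circ"
      by (intro borel_measurable_circ borel_measurable_continuous_onI assms)
  qed
qed

lemma power_series_fourier:
  assumes f: "f holomorphic_on unit_disc" and r: "0 \<le> r" "r < 1"
  shows "(LINT t|circ. f (complex_of_real r * cis t) * cis (- (of_nat m * t)))
     = 2 * pi * (taylor_coeff f m * complex_of_real r ^ m)"
proof -
  define c where "c = (\<lambda>n. taylor_coeff f n * complex_of_real r ^ n)"
  have c: "summable (\<lambda>n. norm (c n))"
    unfolding c_def by (rule taylor_sums_cis[OF assms])
  have w: "integrable circ (\<lambda>t. cis (- (of_nat m * t)))"
    by (intro integrable_continuous_circ continuous_intros)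
  have "(\<lambda>n. c n * (LINT t|circ. cis (- (of_nat m * t)) * cis (of_int (int n) * t))) sums
      (LINT t|circ. cis (- (of_nat m * t)) * (\<Sum>n. c n * cis (of_int (int n) * t)))"
    by (rule sums_integral_circ_cis[OF c w])
  moreover have "cis (- (of_nat m * t)) * cis (of_int (int n) * t) = cis (of_int (int n - int m) * t)" for n t
    by (simp add: cis_mult algebra_simps)
  moreover have "(\<lambda>n. c n * (if int n - int m = 0 then 2 * complex_of_real pi else 0)) sums (2 * pi * c m)"
    using sums_single[of m "\<lambda>n. c n * (2 * complex_of_real pi)"]
    by (simp add: if_distrib mult_ac cong: if_cong)
  ultimately have "(LINT t|circ. cis (- (of_nat m * t)) * (\<Sum>n. c n * cis (of_int (int n) * t))) = 2 * pi * c m"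
    by (simp only: integral_circ_cis sums_unique2)
  moreover have "f (complex_of_real r * cis t) * cis (- (of_nat m * t))
      = cis (- (of_nat m * t)) * (\<Sum>n. c n * cis (of_int (int n) * t))" for t
    unfolding taylor_sums_cis(1)[OF assms] c_def by (rule mult.commute)
  ultimately show ?thesis
    by (simp only: c_def)
qed

text \<open>A single computation of a series thus yields both holomorphy and the coefficients;
  Schwarz integrals, \<open>ev\<close>, shifts and polynomials are all treated this way.\<close>

lemma taylor_coeff_unique:
  assumes "\<And>z. norm z < 1 \<Longrightarrow> (\<lambda>n. c n * z ^ n) sums f z"
  shows "taylor_coeff f = c" "f holomorphic_on unit_disc"
proof -
  show hol: "f holomorphic_on unit_disc"
    by (rule power_series_holomorphic[where a = c]) (use assms in auto)
  have "f has_fps_expansion Abs_fps c"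
  proof -
    have conv: "fps_conv_radius (Abs_fps c) \<ge> 1"
      unfolding fps_conv_radius_def
    proof (rule conv_radius_geI_ex')
      fix r :: real assume "0 < r" "ereal r < 1"
      then show "summable (\<lambda>n. fps_nth (Abs_fps c) n * of_real r ^ n)"
        using assms[of "of_real r"] by (auto intro: sums_summable)
    qed
    moreover have "eventually (\<lambda>z. z \<in> unit_disc) (nhds (0::complex))"
      by (intro eventually_nhds_in_open) auto
    then have "eventually (\<lambda>z. eval_fps (Abs_fps c) z = f z) (nhds 0)"
      by eventually_elim (use assms in \<open>simp add: eval_fps_def sums_iff\<close>)
    ultimately show ?thesis
      unfolding has_fps_expansion_def by (auto intro: less_le_trans[of _ 1])
  qed
  then have "fps_expansion f 0 = Abs_fps c"
    by (rule fps_expansion_eqI)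
  then show "taylor_coeff f = c"
    by (auto simp: taylor_coeff_def)
qed

lemma taylor_coeff_cong:
  assumes "f holomorphic_on unit_disc" "\<And>z. norm z < 1 \<Longrightarrow> f z = g z"
  shows "taylor_coeff g = taylor_coeff f"
  using taylor_coeff_unique(1)[of "taylor_coeff f" g] taylor_sums[OF assms(1)] assms(2) by simp

text \<open>Only the series of \<open>f\<close> is integrated term by term. The conjugate of
  \<open>g\<close> is the weight, and its Fourier coefficients come from
  \<open>power_series_fourier\<close>.\<close>

lemma parseval_radius:
  assumes f: "f holomorphic_on unit_disc" and g: "g holomorphic_on unit_disc" and r: "0 \<le> r" "r < 1"
  shows "(\<lambda>n. taylor_coeff f n * cnj (taylor_coeff g n) * complex_of_real (r ^ (2 * n))) sums
     ((LINT t|circ. f (complex_of_real r * cis t) * cnj (g (complex_of_real r * cis t))) / (2 * pi))"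
proof -
  define w where "w = (\<lambda>t. cnj (g (complex_of_real r * cis t)))"
  have w: "integrable circ w"
    unfolding w_def by (intro integrable_continuous_circ continuous_on_cnj continuous_on_circle_radius g r)
  have four: "(LINT t|circ. w t * cis (of_int (int n) * t)) = 2 * pi * cnj (taylor_coeff g n * complex_of_real r ^ n)" for n
  proof -
    have "(LINT t|circ. w t * cis (of_int (int n) * t))
        = (LINT t|circ. cnj (g (complex_of_real r * cis t) * cis (- (of_nat n * t))))"
      by (simp add: w_def cis_cnj)
    also have "\<dots> = cnj (2 * pi * (taylor_coeff g n * complex_of_real r ^ n))"
      by (simp only: Bochner_Integration.integral_cnj power_series_fourier[OF g r])
    finally show ?thesis by simp
  qed
  have "(\<lambda>n. (taylor_coeff f n * complex_of_real r ^ n) * (2 * pi * cnj (taylor_coeff g n * complex_of_real r ^ n))) sums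
     (LINT t|circ. w t * f (complex_of_real r * cis t))"
    using sums_integral_circ_cis(1)[OF taylor_sums_cis(2)[OF f r] w, of int]
    by (simp only: four taylor_sums_cis(1)[OF f r])
  then have "(\<lambda>n. (taylor_coeff f n * complex_of_real r ^ n) * (2 * pi * cnj (taylor_coeff g n * complex_of_real r ^ n)) / (2 * pi)) sums
     ((LINT t|circ. w t * f (complex_of_real r * cis t)) / (2 * pi))"
    by (rule sums_divide)
  moreover have "(taylor_coeff f n * complex_of_real r ^ n) * (2 * pi * cnj (taylor_coeff g n * complex_of_real r ^ n)) / (2 * pi)
     = taylor_coeff f n * cnj (taylor_coeff g n) * complex_of_real (r ^ (2 * n))" for n
    by (simp add: power_mult power2_eq_square power_mult_distrib)
  moreover have "w t * f (complex_of_real r * cis t) = f (complex_of_real r * cis t) * cnj (g (complex_of_real r * cis t))" for t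
    by (simp add: w_def)
  ultimately show ?thesis by (simp only:)
qed

section \<open>The Schwarz integral and the Poisson kernel\<close>

definition schwarz :: "(real \<Rightarrow> real) \<Rightarrow> complex \<Rightarrow> complex" where
  "schwarz u z = 1 / (2 * complex_of_real pi) *
     (LINT t|circ. (cis t + z) / (cis t - z) * complex_of_real (u t))"

text \<open>With q = z / cis t the kernel is (1 + q) / (1 - q) = 2 / (1 - q) - 1, a geometric series
  whose constant term is 1 instead of 2.\<close>

lemma schwarz_kernel_sums:
  assumes "norm z < 1"
  shows "(\<lambda>n. ((if n = 0 then 1 else 2) * z ^ n) * cis (of_int (- int n) * t)) sums ((cis t + z) / (cis t - z))"
proof -
  define q where "q = z * cis (- t)"
  have q: "norm q < 1" using assms by (simp add: q_def norm_mult)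
  then have "q \<noteq> 1" by auto
  have "(\<lambda>n. 2 * q ^ n - (if n = 0 then 1 else 0)) sums (2 * (1 / (1 - q)) - 1)"
    by (intro sums_diff sums_mult geometric_sums[OF q]) (use sums_single[of 0 "\<lambda>_. 1::complex"] in simp)
  moreover have "2 * (1 / (1 - q)) - 1 = (cis t + z) / (cis t - z)"
  proof -
    have "cis t - z = cis t * (1 - q)" "cis t + z = cis t * (1 + q)"
      by (simp_all add: q_def algebra_simps cis_mult)
    then have "(cis t + z) / (cis t - z) = (1 + q) / (1 - q)" by simp
    then show ?thesis using \<open>q \<noteq> 1\<close> by (simp add: field_simps)
  qed
  moreover have "2 * q ^ n - (if n = 0 then 1 else 0) = ((if n = 0 then 1 else 2) * z ^ n) * cis (of_int (- int n) * t)" for n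
    by (simp add: q_def power_mult_distrib Complex.DeMoivre)
  ultimately show ?thesis by simp
qed

lemma schwarz_summable:
  "norm z < 1 \<Longrightarrow> summable (\<lambda>n. norm ((if n = 0 then 1 else 2) * z ^ n :: complex))"
  by (rule summable_comparison_test[where g = "\<lambda>n. 2 * norm z ^ n"])
     (auto simp: norm_mult norm_power intro!: summable_mult summable_geometric)

lemma schwarz_series:
  assumes u: "integrable circ u" and z: "norm z < 1"
  shows "(\<lambda>n. (1 / (2 * complex_of_real pi) * (if n = 0 then 1 else 2) *
       (LINT t|circ. complex_of_real (u t) * cis (of_int (- int n) * t))) * z ^ n) sums schwarz u z"
    and "integrable circ (\<lambda>t. (cis t + z) / (cis t - z) * complex_of_real (u t))"
proof -
  have u': "integrable circ (\<lambda>t. complex_of_real (u t))" using u by simp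
  have eq: "(\<Sum>n. ((if n = 0 then 1 else 2) * z ^ n) * cis (of_int (- int n) * t)) = (cis t + z) / (cis t - z)" for t
    using schwarz_kernel_sums[OF z] by (rule sums_unique[symmetric])
  note * = sums_integral_circ_cis[OF schwarz_summable[OF z] u', of "\<lambda>n. - int n", unfolded eq]
  show "integrable circ (\<lambda>t. (cis t + z) / (cis t - z) * complex_of_real (u t))"
    using *(2) by (simp add: mult.commute)
  show "(\<lambda>n. (1 / (2 * complex_of_real pi) * (if n = 0 then 1 else 2) *
       (LINT t|circ. complex_of_real (u t) * cis (of_int (- int n) * t))) * z ^ n) sums schwarz u z"
  proof -
    have "schwarz u z = 1 / (2 * complex_of_real pi) *
        (LINT t|circ. complex_of_real (u t) * ((cis t + z) / (cis t - z)))"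
      unfolding schwarz_def by (simp only: mult.commute)
    then show ?thesis
      using sums_mult[OF *(1), of "1 / (2 * complex_of_real pi)"]
      by (simp only: mult.assoc mult.commute mult.left_commute)
  qed
qed

lemma holomorphic_schwarz: "integrable circ u \<Longrightarrow> schwarz u holomorphic_on unit_disc"
  by (rule taylor_coeff_unique(2)[OF schwarz_series(1)])

lemma schwarz_zero: "schwarz u 0 = complex_of_real (integral\<^sup>L circ u / (2 * pi))"
  by (simp add: schwarz_def)

lemma schwarz_const: 
  assumes z: "norm z < 1" shows "schwarz (\<lambda>_. c) z = complex_of_real c"
proof -
  have 1: "integrable circ (\<lambda>_. c)" by simp
  have "(LINT t|circ. complex_of_real c * cis (of_int (- int n) * t)) = (if n = 0 then 2 * pi * c else 0)" for n
    using integral_circ_cis[of "- int n"] by simp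
  then have "(\<lambda>n. if n = 0 then complex_of_real c else 0) sums schwarz (\<lambda>_. c) z"
    using schwarz_series(1)[OF 1 z]
    by (elim sums_cong[THEN iffD1, rotated]) auto
  then show ?thesis using sums_single[of 0 "\<lambda>_. complex_of_real c"] by (simp add: sums_unique2)
qed

lemma schwarz_diff:
  assumes "integrable circ u" "integrable circ v" "norm z < 1"
  shows "schwarz (\<lambda>t. u t - v t) z = schwarz u z - schwarz v z"
  unfolding schwarz_def of_real_diff right_diff_distrib
  by (subst Bochner_Integration.integral_diff[OF schwarz_series(2)[OF assms(1,3)] schwarz_series(2)[OF assms(2,3)]])
     (rule right_diff_distrib)

lemma poisson_kernel:
  assumes "norm z < 1"
  shows "Re ((cis t + z) / (cis t - z)) = (1 - (norm z)\<^sup>2) / (norm (cis t - z))\<^sup>2"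
proof -
  have "(norm (cis t))\<^sup>2 = 1" by simp
  then have "Re ((cis t + z) * cnj (cis t - z)) = 1 - (norm z)\<^sup>2"
    unfolding cmod_power2 by (simp add: algebra_simps power2_eq_square)
  moreover have "(cis t + z) / (cis t - z) = (cis t + z) * cnj (cis t - z) / complex_of_real ((norm (cis t - z))\<^sup>2)"
    by (rule complex_div_cnj)
  ultimately show ?thesis
    by (simp only: Re_divide_of_real)
qed

lemma poisson_integrable:
  assumes u: "integrable circ u" and z: "norm z < 1"
  shows "integrable circ (\<lambda>t. (1 - (norm z)\<^sup>2) / (norm (cis t - z))\<^sup>2 * u t)"
    and "Re (schwarz u z) = (LINT t|circ. (1 - (norm z)\<^sup>2) / (norm (cis t - z))\<^sup>2 * u t) / (2 * pi)"
proof -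
  note i = schwarz_series(2)[OF u z]
  have eq: "Re ((cis t + z) / (cis t - z) * complex_of_real (u t)) = (1 - (norm z)\<^sup>2) / (norm (cis t - z))\<^sup>2 * u t" for t
  proof -
    have "Re (w * complex_of_real c) = Re w * c" for w c by simp
    then show ?thesis by (simp only: poisson_kernel[OF z])
  qed
  show "integrable circ (\<lambda>t. (1 - (norm z)\<^sup>2) / (norm (cis t - z))\<^sup>2 * u t)"
    using integrable_Re[OF i] by (simp only: eq)
  have "(LINT t|circ. (1 - (norm z)\<^sup>2) / (norm (cis t - z))\<^sup>2 * u t)
     = Re ((LINT t|circ. (cis t + z) / (cis t - z) * complex_of_real (u t)))"
    by (subst integral_Re[OF i, symmetric]) (simp only: eq)
  then show "Re (schwarz u z) = (LINT t|circ. (1 - (norm z)\<^sup>2) / (norm (cis t - z))\<^sup>2 * u t) / (2 * pi)"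
    by (simp add: schwarz_def)
qed

text \<open>Positivity of the Poisson kernel. Comparison with constants turns bounds on
  \<open>u\<close> into bounds on the modulus of \<open>exp (schwarz u z)\<close>.\<close>

lemma Re_schwarz_mono:
  assumes "integrable circ u" "integrable circ v" "norm z < 1" "\<And>t. u t \<le> v t"
  shows "Re (schwarz u z) \<le> Re (schwarz v z)"
  unfolding poisson_integrable(2)[OF assms(1,3)] poisson_integrable(2)[OF assms(2,3)]
proof (intro divide_right_mono integral_mono poisson_integrable assms mult_left_mono)
  show "0 \<le> (1 - (norm z)\<^sup>2) / (norm (cis t - z))\<^sup>2" for t
    using assms(3) by (simp add: power_le_one)
qed auto

section \<open>Multiplication operators and the de Branges--Rovnyak space\<close>

definition ev :: "ell2 \<Rightarrow> complex \<Rightarrow> complex" where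
  "ev x z = (\<Sum>n. coeff_seq x n * z ^ n)"

lemma ev_sums:
  assumes "norm z < 1"
  shows "(\<lambda>n. coeff_seq x n * z ^ n) sums ev x z"
  unfolding ev_def
proof (rule summable_sums, rule summable_comparison_test)
  show "\<exists>N. \<forall>n\<ge>N. norm (coeff_seq x n * z ^ n) \<le> norm x * norm z ^ n"
    by (auto simp: norm_mult norm_power intro!: mult_right_mono norm_coeff_seq_le)
  show "summable (\<lambda>n. norm x * norm z ^ n)"
    using assms by (intro summable_mult summable_geometric) simp
qed

lemma holomorphic_ev: "ev x holomorphic_on unit_disc"
  by (rule taylor_coeff_unique(2)[OF ev_sums])

lemma taylor_coeff_ev: "taylor_coeff (ev x) = coeff_seq x"
  by (rule taylor_coeff_unique(1)[OF ev_sums])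

lemma ev_inject:
  assumes "\<And>z. norm z < 1 \<Longrightarrow> ev x z = ev y z"
  shows "x = y"
  using taylor_coeff_cong[OF holomorphic_ev, of x "ev y"] assms
  by (intro ell2_eqI) (simp add: taylor_coeff_ev)

definition szego :: "complex \<Rightarrow> ell2" where
  "szego w = Abs_ell2 (\<lambda>n. cnj w ^ n)"

lemma coeff_szego: 
  assumes "norm w < 1" shows "coeff_seq (szego w) n = cnj w ^ n"
proof -
  have "summable (\<lambda>n. ((norm w)\<^sup>2) ^ n)"
    using assms by (intro summable_geometric) (simp add: power_less_one_iff)
  then have "summable (\<lambda>n. (norm (cnj w ^ n))\<^sup>2)"
    by (simp add: norm_power power2_eq_square power_mult_distrib)
  then show ?thesis unfolding szego_def by (subst coeff_seq_Abs) auto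
qed

lemma cip_szego: "norm w < 1 \<Longrightarrow> cip x (szego w) = ev x w"
  unfolding cip_def ev_def by (simp add: coeff_szego)

lemma ev_simps:
  assumes "norm z < 1"
  shows "ev (x + y) z = ev x z + ev y z" "ev (x - y) z = ev x z - ev y z"
    "ev (scaleC c x) z = c * ev x z" "ev 0 z = 0"
  using assms by (simp_all add: cip_szego[symmetric] cip_add_left cip_diff_left cip_scaleC_left)

lemma ev_unit_seq: "ev (unit_seq k) z = z ^ k"
proof -
  have "(\<lambda>n. coeff_seq (unit_seq k) n * z ^ n) = (\<lambda>n. if n = k then z ^ n else 0)" by auto
  then show ?thesis
    using sums_single[of k "\<lambda>n. z ^ n"] unfolding ev_def by (simp add: sums_iff)
qed

lemma ev_szego: "norm w < 1 \<Longrightarrow> norm z < 1 \<Longrightarrow> ev (szego w) z = 1 / (1 - cnj w * z)"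
proof -
  assume w: "norm w < 1" and z: "norm z < 1"
  have "norm (cnj w * z) < 1 * 1"
    unfolding norm_mult using w z by (intro mult_strict_mono') auto
  then have "(\<lambda>n. (cnj w * z) ^ n) sums (1 / (1 - cnj w * z))"
    by (intro geometric_sums) simp
  then show ?thesis
    unfolding ev_def by (simp add: coeff_szego[OF w] power_mult_distrib sums_iff)
qed

lemma parseval_radius_le:
  assumes f: "f holomorphic_on unit_disc" and r: "0 \<le> r" "r < 1"
    and le: "\<And>z. norm z < 1 \<Longrightarrow> norm (f z) \<le> norm (ev x z)"
  shows "(\<Sum>n<N. (norm (taylor_coeff f n))\<^sup>2 * r ^ (2 * n)) \<le> (norm x)\<^sup>2"
proof -
  have *: "(\<lambda>n. (norm (taylor_coeff g n))\<^sup>2 * r ^ (2 * n)) sums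
      ((LINT t|circ. (norm (g (complex_of_real r * cis t)))\<^sup>2) / (2 * pi))"
    if g: "g holomorphic_on unit_disc" for g
  proof -
    have "(\<lambda>n. taylor_coeff g n * cnj (taylor_coeff g n) * complex_of_real (r ^ (2 * n))) sums
     ((LINT t|circ. g (complex_of_real r * cis t) * cnj (g (complex_of_real r * cis t))) / (2 * pi))"
      by (rule parseval_radius[OF g g r])
    then have "(\<lambda>n. complex_of_real ((norm (taylor_coeff g n))\<^sup>2 * r ^ (2 * n))) sums
      complex_of_real ((LINT t|circ. (norm (g (complex_of_real r * cis t)))\<^sup>2) / (2 * pi))"
      by (simp only: complex_norm_square[symmetric] of_real_mult[symmetric] of_real_divide[symmetric]
          integral_complex_of_real)
    then show ?thesis by (simp only: sums_of_real_iff)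
  qed
  note sf = *[OF f] and sx = *[OF holomorphic_ev[of x], unfolded taylor_coeff_ev]
  have "(\<Sum>n<N. (norm (taylor_coeff f n))\<^sup>2 * r ^ (2 * n))
      \<le> (\<Sum>n. (norm (taylor_coeff f n))\<^sup>2 * r ^ (2 * n))"
    using r by (intro sum_le_suminf sums_summable[OF sf]) auto
  also have "\<dots> = (LINT t|circ. (norm (f (complex_of_real r * cis t)))\<^sup>2) / (2 * pi)"
    using sf by (simp add: sums_iff)
  also have "\<dots> \<le> (LINT t|circ. (norm (ev x (complex_of_real r * cis t)))\<^sup>2) / (2 * pi)"
    using r by (intro divide_right_mono integral_mono integrable_continuous_circ continuous_intros
        continuous_on_circle_radius f holomorphic_ev power_mono le) (auto simp: norm_mult)
  also have "\<dots> = (\<Sum>n. (norm (coeff_seq x n))\<^sup>2 * r ^ (2 * n))"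
    using sx by (simp add: sums_iff)
  also have "\<dots> \<le> (\<Sum>n. (norm (coeff_seq x n))\<^sup>2)"
    using r by (intro suminf_le sums_summable[OF sx] summable_coeff_seq) (auto simp: mult_left_le power_le_one)
  finally show ?thesis by (simp add: norm_ell2_sq)
qed

text \<open>Parseval compares the means over a circle of radius r < 1; then r tends to 1 in each
  finite partial sum. Pointwise domination inside the disc thus passes to the H^2 norm.\<close>

lemma hardy_dominated:
  assumes f: "f holomorphic_on unit_disc"
    and le: "\<And>z. norm z < 1 \<Longrightarrow> norm (f z) \<le> norm (ev x z)"
  shows "(\<Sum>n<N. (norm (taylor_coeff f n))\<^sup>2) \<le> (norm x)\<^sup>2"
    and "summable (\<lambda>n. (norm (taylor_coeff f n))\<^sup>2)"
proof -
  have sum_le: "(\<Sum>n<N. (norm (taylor_coeff f n))\<^sup>2) \<le> (norm x)\<^sup>2" for N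
  proof (rule tendsto_upperbound)
    show "((\<lambda>r. \<Sum>n<N. (norm (taylor_coeff f n))\<^sup>2 * r ^ (2 * n)) \<longlongrightarrow> (\<Sum>n<N. (norm (taylor_coeff f n))\<^sup>2)) (at_left 1)"
      by (rule tendsto_eq_intros refl | simp)+
    show "\<forall>\<^sub>F r in at_left 1. (\<Sum>n<N. (norm (taylor_coeff f n))\<^sup>2 * r ^ (2 * n)) \<le> (norm x)\<^sup>2"
      using eventually_at_left_real[OF zero_less_one]
      by eventually_elim (rule parseval_radius_le[OF f _ _ le], auto)
  qed simp
  show "(\<Sum>n<N. (norm (taylor_coeff f n))\<^sup>2) \<le> (norm x)\<^sup>2" by (rule sum_le)
  show "summable (\<lambda>n. (norm (taylor_coeff f n))\<^sup>2)"
    using sum_le[of "Suc _"] by (intro bounded_imp_summable[where B = "(norm x)\<^sup>2"]) (auto simp: lessThan_Suc_atMost)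
qed

section \<open>Multiplication operators and their adjoints\<close>

definition contractive :: "(complex \<Rightarrow> complex) \<Rightarrow> bool" where
  "contractive m \<longleftrightarrow> m holomorphic_on unit_disc \<and> (\<forall>z\<in>unit_disc. norm (m z) \<le> 1)"

text \<open>The analytic Toeplitz operator with symbol \<open>m\<close>, acting on coefficients. For
  contractive \<open>m\<close> the product has square summable coefficients, which gives
  \<open>Abs_ell2\<close> its meaning.\<close>

definition mult_op :: "(complex \<Rightarrow> complex) \<Rightarrow> ell2 \<Rightarrow> ell2" where
  "mult_op m x = Abs_ell2 (taylor_coeff (\<lambda>z. m z * ev x z))"

lemma mult_op_aux:
  assumes "contractive m"
  shows "(\<lambda>z. m z * ev x z) holomorphic_on unit_disc"
    and "norm z < 1 \<Longrightarrow> norm (m z * ev x z) \<le> norm (ev x z)"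
  using assms by (auto simp: contractive_def norm_mult mult_left_le_one_le
      intro!: holomorphic_on_mult holomorphic_ev)

lemma coeff_mult_op:
  assumes "contractive m"
  shows "coeff_seq (mult_op m x) = taylor_coeff (\<lambda>z. m z * ev x z)"
  unfolding mult_op_def using assms
  by (intro coeff_seq_Abs hardy_dominated(2)[where x = x] mult_op_aux) auto

lemma ev_mult_op:
  assumes "contractive m" "norm z < 1"
  shows "ev (mult_op m x) z = m z * ev x z"
  using taylor_sums[OF mult_op_aux(1)[OF assms(1)] assms(2), of x]
  by (simp add: ev_def coeff_mult_op[OF assms(1)] sums_iff)

lemma norm_mult_op:
  assumes "contractive m"
  shows "norm (mult_op m x) \<le> norm x"
  by (rule norm_ell2_leI)
     (use assms in \<open>auto simp: coeff_mult_op intro!: hardy_dominated(1) mult_op_aux\<close>)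

lemma mult_op_linear:
  assumes "contractive m"
  shows "mult_op m (x + y) = mult_op m x + mult_op m y"
    "mult_op m (x - y) = mult_op m x - mult_op m y"
    "mult_op m (scaleC c x) = scaleC c (mult_op m x)"
  by (rule ev_inject; simp add: ev_mult_op[OF assms] ev_simps algebra_simps)+

lemma bounded_linear_mult_op:
  assumes "contractive m"
  shows "bounded_linear (mult_op m)"
  by (rule bounded_linear_intro[where K = 1])
     (use assms in \<open>auto simp: mult_op_linear scaleR_eq_scaleC norm_mult_op\<close>)

lemma mult_op_commute:
  assumes "contractive m" "contractive k"
  shows "mult_op m (mult_op k x) = mult_op k (mult_op m x)"
  by (rule ev_inject) (simp add: ev_mult_op assms)

lemma cip_mult_op_sums:
  assumes "contractive m"
  shows "(\<lambda>n. coeff_seq x n * cip (mult_op m (unit_seq n)) z) sums cip (mult_op m x) z"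
    and "(\<lambda>n. cnj (coeff_seq x n) * cip z (mult_op m (unit_seq n))) sums cip z (mult_op m x)"
proof -
  have *: "(\<lambda>n. mult_op m (scaleC (coeff_seq x n) (unit_seq n))) sums mult_op m x"
    by (rule bounded_linear.sums[OF bounded_linear_mult_op[OF assms] unit_seq_expansion])
  show "(\<lambda>n. coeff_seq x n * cip (mult_op m (unit_seq n)) z) sums cip (mult_op m x) z"
    using bounded_linear.sums[OF bounded_linear_cip_left *, of z]
    by (simp add: mult_op_linear[OF assms] cip_scaleC_left)
  show "(\<lambda>n. cnj (coeff_seq x n) * cip z (mult_op m (unit_seq n))) sums cip z (mult_op m x)"
    using bounded_linear.sums[OF bounded_linear_cip_right *, of z]
    by (simp add: mult_op_linear[OF assms] cip_scaleC_right)
qed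

definition adj_op :: "(complex \<Rightarrow> complex) \<Rightarrow> ell2 \<Rightarrow> ell2" where
  "adj_op m g = Abs_ell2 (\<lambda>n. cip g (mult_op m (unit_seq n)))"

text \<open>Square summability follows by duality. If \<open>p\<close> is a truncation of the
  coefficient sequence itself, pairing \<open>g\<close> with the image of \<open>p\<close> gives
  ||p||^2 \<le> ||g|| ||p||, hence ||p|| \<le> ||g|| for every truncation.\<close>

lemma coeff_adj_op:
  assumes m: "contractive m"
  shows "coeff_seq (adj_op m g) n = cip g (mult_op m (unit_seq n))"
proof -
  define f where "f = (\<lambda>n. cip g (mult_op m (unit_seq n)))"
  have sum_le: "(\<Sum>n<N. (norm (f n))\<^sup>2) \<le> (norm g)\<^sup>2" for N
  proof -
    define p where "p = (\<Sum>n<N. scaleC (f n) (unit_seq n))"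
    define S where "S = (\<Sum>n<N. (norm (f n))\<^sup>2)"
    have p: "coeff_seq p n = (if n < N then f n else 0)" for n
      by (simp add: p_def coeff_seq_sum if_distrib cong: if_cong)
    have "(\<lambda>n. cnj (coeff_seq p n) * f n) sums cip g (mult_op m p)"
      unfolding f_def by (rule cip_mult_op_sums(2)[OF m])
    moreover have "(\<lambda>n. cnj (coeff_seq p n) * f n) sums (\<Sum>n<N. cnj (coeff_seq p n) * f n)"
      by (rule sums_finite) (auto simp: p)
    ultimately have "cip g (mult_op m p) = (\<Sum>n<N. cnj (coeff_seq p n) * f n)"
      by (rule sums_unique2)
    also have "\<dots> = complex_of_real S"
      unfolding S_def of_real_sum by (rule sum.cong) (simp_all add: p complex_norm_square mult.commute del: of_real_power)
    finally have "S \<le> norm (cip g (mult_op m p))" by simp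
    also have "\<dots> \<le> norm g * norm (mult_op m p)" by (rule norm_cip_le)
    also have "\<dots> \<le> norm g * norm p" by (intro mult_left_mono norm_mult_op m) simp
    finally have le: "S \<le> norm g * norm p" .
    have "(norm p)\<^sup>2 = S"
    proof -
      have "(\<lambda>n. (norm (coeff_seq p n))\<^sup>2) sums (\<Sum>n<N. (norm (coeff_seq p n))\<^sup>2)"
        by (rule sums_finite) (auto simp: p)
      then show ?thesis by (simp add: norm_ell2_sq sums_iff S_def p)
    qed
    then have "norm p * norm p \<le> norm g * norm p" using le by (simp add: power2_eq_square)
    then have "norm p \<le> norm g"
      by (metis mult_right_le_imp_le norm_ge_zero order_le_less)
    then have "(norm p)\<^sup>2 \<le> (norm g)\<^sup>2" by (intro power_mono) auto
    then show ?thesis using \<open>(norm p)\<^sup>2 = S\<close> by (simp add: S_def)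
  qed
  have "summable (\<lambda>n. (norm (f n))\<^sup>2)"
    using sum_le[of "Suc _"]
    by (intro bounded_imp_summable[where B = "(norm g)\<^sup>2"]) (auto simp: lessThan_Suc_atMost)
  then show ?thesis unfolding adj_op_def f_def by (subst coeff_seq_Abs) auto
qed

lemma cip_adj_op:
  assumes m: "contractive m"
  shows "cip (adj_op m g) x = cip g (mult_op m x)"
  using cip_mult_op_sums(2)[OF m, of x g]
  by (simp add: cip_def coeff_adj_op[OF m] sums_iff mult.commute)

text \<open>A fixed sequence of radii, since dominated convergence is applied along
  sequences.\<close>

definition rad :: "nat \<Rightarrow> real" where "rad k = 1 - 1 / real (k + 1)"

lemma rad: "0 \<le> rad k" "rad k < 1" "filterlim rad (at_left 1) sequentially"
proof -
  show "0 \<le> rad k" "rad k < 1" for k by (auto simp: rad_def)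
  have "rad \<longlonglongrightarrow> 1 - 0"
    unfolding rad_def by (intro tendsto_intros) real_asymp
  then show "filterlim rad (at_left 1) sequentially"
    by (intro tendsto_imp_filterlim_at_left) (auto simp: rad_def)
qed

lemma rad_tendsto: "rad \<longlonglongrightarrow> 1"
  using rad(3) filterlim_at by blast

text \<open>Abel's method: Parseval at radius \<open>rad k\<close> multiplies the n-th term of
  \<open>cip x y\<close> by \<open>rad k ^ (2 * n)\<close>, and the terms of \<open>cip x y\<close>
  themselves are a summable majorant. Through this limit the boundary behaviour of functions
  determines their inner products.\<close>

lemma radial_cip:
  "(\<lambda>k. (LINT t|circ. ev x (rad k * cis t) * cnj (ev y (rad k * cis t))) / (2 * pi)) \<longlonglongrightarrow> cip x y"
proof -
  have eq: "(LINT t|circ. ev x (rad k * cis t) * cnj (ev y (rad k * cis t))) / (2 * pi)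
     = (\<Sum>n. coeff_seq x n * cnj (coeff_seq y n) * complex_of_real (rad k ^ (2 * n)))" for k
    using parseval_radius[OF holomorphic_ev[of x] holomorphic_ev[of y] rad(1,2)[of k]]
    by (simp add: taylor_coeff_ev sums_iff)
  have "(\<lambda>k. \<Sum>n. coeff_seq x n * cnj (coeff_seq y n) * complex_of_real (rad k ^ (2 * n)))
      \<longlonglongrightarrow> (\<Sum>n. coeff_seq x n * cnj (coeff_seq y n) * complex_of_real (1 ^ (2 * n)))"
  proof (rule tannerys_theorem[THEN conjunct2, THEN conjunct2])
    show "summable (\<lambda>n. norm (coeff_seq x n * cnj (coeff_seq y n)))" by (rule summable_cip_norm)
    show "(\<lambda>k. coeff_seq x n * cnj (coeff_seq y n) * complex_of_real (rad k ^ (2 * n)))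
       \<longlonglongrightarrow> coeff_seq x n * cnj (coeff_seq y n) * complex_of_real (1 ^ (2 * n))" for n
      by (intro tendsto_intros rad_tendsto)
    show "\<forall>\<^sub>F (n, k) in at_top \<times>\<^sub>F sequentially.
        norm (coeff_seq x n * cnj (coeff_seq y n) * complex_of_real (rad k ^ (2 * n)))
        \<le> norm (coeff_seq x n * cnj (coeff_seq y n))"
    proof -
      have "norm (c * complex_of_real (rad k ^ (2 * n))) \<le> norm c" for c k n
        unfolding norm_mult using rad(1,2)[of k]
        by (intro mult_left_le) (auto simp: norm_power intro!: power_le_one)
      then show ?thesis by (intro always_eventually) auto
    qed
  qed auto
  then show ?thesis unfolding eq cip_def by simp
qed

lemma has_radial_limit_rad:
  "has_radial_limit f t l \<Longrightarrow> (\<lambda>k. f (rad k * cis t)) \<longlonglongrightarrow> l"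
  unfolding has_radial_limit_def by (rule filterlim_compose[OF _ rad(3)])

lemma has_radial_limit_mult:
  "has_radial_limit f t l \<Longrightarrow> has_radial_limit g t k \<Longrightarrow> has_radial_limit (\<lambda>z. f z * g z) t (l * k)"
  unfolding has_radial_limit_def by (rule tendsto_mult)

text \<open>\<open>cyclic\<close> is outerness of \<open>a\<close> in operator form: the range of
  multiplication by \<open>a\<close> is dense. In the model below it makes the second component of a
  pair unique.\<close>

locale pyth_pair =
  fixes a b :: "complex \<Rightarrow> complex"
  assumes contr_a: "contractive a" and contr_b: "contractive b"
    and boundary: "AE t in circ. \<exists>\<beta> \<alpha>. has_radial_limit b t \<beta> \<and> has_radial_limit a t \<alpha> \<and> (norm \<beta>)\<^sup>2 + (norm \<alpha>)\<^sup>2 = 1"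
    and cyclic: "\<And>g. (\<And>x. cip g (mult_op a x) = 0) \<Longrightarrow> g = 0"
begin

text \<open>On the circle of radius \<open>rad k\<close> the sum of the two pairings is a mean of
  (|a|^2 + |b|^2) z^m cnj(z)^n. This is bounded by 2 and tends almost everywhere to
  \<open>cis ((m - n) * t)\<close>.\<close>

lemma isometry_unit_seq:
  "cip (mult_op a (unit_seq m)) (mult_op a (unit_seq n)) + cip (mult_op b (unit_seq m)) (mult_op b (unit_seq n))
     = (if m = n then 1 else 0)"
proof -
  define F where "F = (\<lambda>k t. (\<lambda>z. (a z * z ^ m) * cnj (a z * z ^ n) + (b z * z ^ m) * cnj (b z * z ^ n)) (rad k * cis t))"
  have in_disc: "norm (rad k * cis t) < 1" for k t
    using rad(1,2)[of k] by (simp add: norm_mult)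
  have cont: "continuous_on UNIV (\<lambda>t. c (rad k * cis t))" if "contractive c" for c k
    using that rad(1,2) by (intro continuous_on_circle_radius) (auto simp: contractive_def)
  have intF: "integrable circ (\<lambda>t. (c (rad k * cis t) * (rad k * cis t) ^ m) * cnj (c (rad k * cis t) * (rad k * cis t) ^ n))"
    if "contractive c" for c k
    by (intro integrable_continuous_circ continuous_intros cont that)
  have "(\<lambda>k. integral\<^sup>L circ (F k) / (2 * pi)) \<longlonglongrightarrow>
     cip (mult_op a (unit_seq m)) (mult_op a (unit_seq n)) + cip (mult_op b (unit_seq m)) (mult_op b (unit_seq n))"
  proof -
    have "integral\<^sup>L circ (F k) / (2 * pi) =
       (LINT t|circ. ev (mult_op a (unit_seq m)) (rad k * cis t) * cnj (ev (mult_op a (unit_seq n)) (rad k * cis t))) / (2 * pi)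
     + (LINT t|circ. ev (mult_op b (unit_seq m)) (rad k * cis t) * cnj (ev (mult_op b (unit_seq n)) (rad k * cis t))) / (2 * pi)" for k
      unfolding F_def
      by (simp only: ev_mult_op contr_a contr_b in_disc ev_unit_seq add_divide_distrib
          Bochner_Integration.integral_add[OF intF intF])
    then show ?thesis
      by (simp only:) (intro tendsto_add radial_cip)
  qed
  moreover have "(\<lambda>k. integral\<^sup>L circ (F k) / (2 * pi)) \<longlonglongrightarrow>
      (LINT t|circ. cis (of_int (int m - int n) * t)) / (2 * pi)"
  proof (intro tendsto_divide tendsto_const)
    show "(\<lambda>k. integral\<^sup>L circ (F k)) \<longlonglongrightarrow> (LINT t|circ. cis (of_int (int m - int n) * t))"
    proof (rule integral_dominated_convergence[where w = "\<lambda>_. 2"])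
      show "(\<lambda>t. cis (of_int (int m - int n) * t)) \<in> borel_measurable circ"
        by (intro borel_measurable_circ borel_measurable_continuous_onI continuous_intros)
      show "F k \<in> borel_measurable circ" for k
        unfolding F_def by (intro borel_measurable_circ borel_measurable_continuous_onI continuous_intros cont contr_a contr_b)
      show "integrable circ (\<lambda>_. 2 :: real)" by simp
      show "AE t in circ. norm (F k t) \<le> 2" for k
      proof (rule AE_I2)
        fix t
        have *: "norm ((c z * z ^ m) * cnj (c z * z ^ n)) \<le> 1" if "contractive c" "norm z < 1" for c z
        proof -
          have "norm (c z * z ^ j) \<le> 1 * 1" for j
            unfolding norm_mult norm_power using that
            by (intro mult_mono power_le_one) (auto simp: contractive_def)
          then show ?thesis
            unfolding norm_mult complex_mod_cnj by (metis mult_le_one norm_ge_zero mult_1 norm_mult)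
        qed
        show "norm (F k t) \<le> 2"
          unfolding F_def
          using norm_triangle_le[OF add_mono[OF *[OF contr_a in_disc] *[OF contr_b in_disc]]] by simp
      qed
      show "AE t in circ. (\<lambda>k. F k t) \<longlonglongrightarrow> cis (of_int (int m - int n) * t)"
        using boundary
      proof eventually_elim
        fix t
        assume "\<exists>\<beta> \<alpha>. has_radial_limit b t \<beta> \<and> has_radial_limit a t \<alpha> \<and> (norm \<beta>)\<^sup>2 + (norm \<alpha>)\<^sup>2 = 1"
        then obtain \<beta> \<alpha> where l: "has_radial_limit b t \<beta>" "has_radial_limit a t \<alpha>" "(norm \<beta>)\<^sup>2 + (norm \<alpha>)\<^sup>2 = 1"
          by blast
        have z: "(\<lambda>k. rad k * cis t) \<longlonglongrightarrow> cis t"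
          using tendsto_mult[OF tendsto_of_real[OF rad_tendsto] tendsto_const[of "cis t"]] by simp
        have "(\<lambda>k. F k t) \<longlonglongrightarrow> (\<alpha> * cis t ^ m) * cnj (\<alpha> * cis t ^ n) + (\<beta> * cis t ^ m) * cnj (\<beta> * cis t ^ n)"
          unfolding F_def by (intro tendsto_intros z has_radial_limit_rad l)
        also have "(\<alpha> * cis t ^ m) * cnj (\<alpha> * cis t ^ n) + (\<beta> * cis t ^ m) * cnj (\<beta> * cis t ^ n)
            = (\<alpha> * cnj \<alpha> + \<beta> * cnj \<beta>) * (cis t ^ m * cnj (cis t) ^ n)"
          by (simp add: algebra_simps)
        also have "\<alpha> * cnj \<alpha> + \<beta> * cnj \<beta> = 1"
          using l(3) by (simp only: complex_norm_square[symmetric] of_real_add[symmetric]) (simp add: add.commute)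
        also have "cis t ^ m * cnj (cis t) ^ n = cis (of_int (int m - int n) * t)"
          by (simp add: Complex.DeMoivre cis_mult cis_cnj algebra_simps)
        finally show "(\<lambda>k. F k t) \<longlonglongrightarrow> cis (of_int (int m - int n) * t)" by simp
      qed
    qed
  qed auto
  moreover have "(LINT t|circ. cis (of_int (int m - int n) * t)) / (2 * pi) = (if m = n then 1 else 0)"
    by (simp only: integral_circ_cis) auto
  ultimately show ?thesis
    by (metis LIMSEQ_unique)
qed

text \<open>The identity T_a* T_a + T_b* T_b = I, extended from the basis vectors one argument at a
  time.\<close>

lemma isometry: "cip (mult_op a x) (mult_op a y) + cip (mult_op b x) (mult_op b y) = cip x y"
proof -
  have step: "cip (mult_op a x) (mult_op a (unit_seq n)) + cip (mult_op b x) (mult_op b (unit_seq n)) = coeff_seq x n" for n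
  proof -
    have "(\<lambda>m. coeff_seq x m * (cip (mult_op a (unit_seq m)) (mult_op a (unit_seq n)) + cip (mult_op b (unit_seq m)) (mult_op b (unit_seq n))))
       sums (cip (mult_op a x) (mult_op a (unit_seq n)) + cip (mult_op b x) (mult_op b (unit_seq n)))"
      unfolding distrib_left by (intro sums_add cip_mult_op_sums contr_a contr_b)
    moreover have "(\<lambda>m. coeff_seq x m * (if m = n then 1 else 0)) sums coeff_seq x n"
      using sums_single[of n "coeff_seq x"] by (simp add: if_distrib cong: if_cong)
    ultimately show ?thesis unfolding isometry_unit_seq by (rule sums_unique2)
  qed
  have "(\<lambda>n. cnj (coeff_seq y n) * (cip (mult_op a x) (mult_op a (unit_seq n)) + cip (mult_op b x) (mult_op b (unit_seq n))))
       sums (cip (mult_op a x) (mult_op a y) + cip (mult_op b x) (mult_op b y))"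
    unfolding distrib_left by (intro sums_add cip_mult_op_sums contr_a contr_b)
  moreover have "(\<lambda>n. cnj (coeff_seq y n) * coeff_seq x n) sums cip x y"
    using cip_sums[of x y] by (simp add: mult.commute)
  ultimately show ?thesis unfolding step by (rule sums_unique2)
qed

text \<open>
  The pairs \<open>(f, g)\<close> with \<open>T\<^sub>b\<^sup>* f = T\<^sub>a\<^sup>* g\<close>. They form a closed subspace, in which \<open>f\<close> determines \<open>g\<close>, and
  its image under the first projection is the de Branges--Rovnyak space with the norm of the pair.
\<close>

definition G :: "(ell2 \<times> ell2) set" where
  "G = {p. \<forall>x. cip (fst p) (mult_op b x) = cip (snd p) (mult_op a x)}"

definition fn :: "ell2 \<times> ell2 \<Rightarrow> complex \<Rightarrow> complex" where
  "fn p = (\<lambda>z. if z \<in> unit_disc then ev (fst p) z else 0)"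

definition pre :: "(complex \<Rightarrow> complex) \<Rightarrow> ell2 \<times> ell2" where
  "pre = inv_into G fn"

definition ip :: "(complex \<Rightarrow> complex) \<Rightarrow> (complex \<Rightarrow> complex) \<Rightarrow> complex" where
  "ip f g = cip (fst (pre f)) (fst (pre g)) + cip (snd (pre f)) (snd (pre g))"

lemma inj_fn: "inj_on fn G"
proof (rule inj_onI)
  fix p q assume p: "p \<in> G" and q: "q \<in> G" and eq: "fn p = fn q"
  have "fst p = fst q"
  proof (rule ev_inject)
    fix z :: complex assume "norm z < 1"
    then show "ev (fst p) z = ev (fst q) z"
      using fun_cong[OF eq, of z] by (simp add: fn_def)
  qed
  moreover have "snd p - snd q = 0"
    by (rule cyclic) (use p q calculation in \<open>auto simp: G_def cip_diff_left\<close>)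
  ultimately show "p = q" by (simp add: prod_eq_iff)
qed

lemma pre_fn: "p \<in> G \<Longrightarrow> pre (fn p) = p"
  unfolding pre_def by (rule inv_into_f_f[OF inj_fn])

lemma ip_fn: "p \<in> G \<Longrightarrow> q \<in> G \<Longrightarrow> ip (fn p) (fn q) = cip (fst p) (fst q) + cip (snd p) (snd q)"
  by (simp add: ip_def pre_fn)

lemma G_closed_ops:
  "0 \<in> G" "p \<in> G \<Longrightarrow> q \<in> G \<Longrightarrow> p + q \<in> G" "p \<in> G \<Longrightarrow> q \<in> G \<Longrightarrow> p - q \<in> G"
  "p \<in> G \<Longrightarrow> (scaleC c (fst p), scaleC c (snd p)) \<in> G"
  by (auto simp: G_def cip_add_left cip_diff_left cip_scaleC_left)

lemma fn_ops:
  "fn 0 = (\<lambda>z. 0)" "(\<lambda>z. fn p z + fn q z) = fn (p + q)" "(\<lambda>z. fn p z - fn q z) = fn (p - q)"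
  "(\<lambda>z. c * fn p z) = fn (scaleC c (fst p), scaleC c (snd p))"
  by (auto simp: fn_def ev_simps)

lemma norm_fn: "p \<in> G \<Longrightarrow> sqrt (Re (ip (fn p) (fn p))) = norm p"
  by (simp add: ip_fn cip_self_norm norm_prod_def flip: of_real_add)

lemma closed_G:
  assumes "\<And>n. p n \<in> G" "p \<longlonglongrightarrow> l"
  shows "l \<in> G"
  unfolding G_def
proof (intro CollectI allI)
  fix x
  have "(\<lambda>n. cip (fst (p n)) (mult_op b x)) \<longlonglongrightarrow> cip (fst l) (mult_op b x)"
    "(\<lambda>n. cip (snd (p n)) (mult_op a x)) \<longlonglongrightarrow> cip (snd l) (mult_op a x)"
    using assms(2) by (auto intro!: bounded_linear.tendsto[OF bounded_linear_cip_left] tendsto_fst tendsto_snd)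
  moreover have "cip (fst (p n)) (mult_op b x) = cip (snd (p n)) (mult_op a x)" for n
    using assms(1)[of n] by (simp add: G_def)
  ultimately show "cip (fst l) (mult_op b x) = cip (snd l) (mult_op a x)"
    using LIMSEQ_unique by auto
qed

definition kern :: "complex \<Rightarrow> ell2 \<times> ell2" where
  "kern w = (szego w - scaleC (cnj (b w)) (mult_op b (szego w)), scaleC (cnj (b w)) (mult_op a (szego w)))"

lemma kern_mem: "norm w < 1 \<Longrightarrow> kern w \<in> G"
proof -
  assume w: "norm w < 1"
  have "cip (szego w) (mult_op b x) = cnj (b w) * cip (szego w) x" for x
    by (subst (1 2) cip_commute) (simp add: cip_szego w ev_mult_op contr_b)
  then have "cip (szego w) (mult_op b x) - cnj (b w) * cip (mult_op b (szego w)) (mult_op b x)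
      = cnj (b w) * cip (mult_op a (szego w)) (mult_op a x)" for x
    by (simp only: isometry[of "szego w" x, symmetric]) (simp add: distrib_left)
  then show ?thesis
    by (simp add: G_def kern_def cip_diff_left cip_scaleC_left)
qed

text \<open>The two terms carrying the factor \<open>b w\<close> cancel: they are the defining
  relation of \<open>G\<close>, tested on \<open>szego w\<close>.\<close>

lemma kern_reproducing:
  assumes w: "norm w < 1" and p: "p \<in> G"
  shows "cip (fst p) (fst (kern w)) + cip (snd p) (snd (kern w)) = ev (fst p) w"
  using p by (simp add: G_def kern_def cip_diff_right cip_scaleC_right cip_szego w)

lemma fn_kern:
  assumes "norm w < 1"
  shows "fn (kern w) = (\<lambda>z. if z \<in> unit_disc then dbr_kernel b z w else 0)"
proof
  fix z
  show "fn (kern w) z = (if z \<in> unit_disc then dbr_kernel b z w else 0)"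
    using assms by (simp add: fn_def kern_def ev_simps ev_mult_op contr_b ev_szego dbr_kernel_def diff_divide_distrib)
qed

text \<open>The map \<open>fn\<close> is a linear bijection from a closed subspace of a Hilbert
  space product onto its image, and \<open>ip\<close> is the transported inner product; completeness
  is therefore inherited from \<open>G\<close>.\<close>

lemma rkhs: "reproducing_kernel_hilbert_space unit_disc (fn ` G) ip (dbr_kernel b)"
proof unfold_locales
  show "f z = 0" if "f \<in> fn ` G" "z \<notin> unit_disc" for f z
    using that by (auto simp: fn_def)
  show "(\<lambda>z. 0) \<in> fn ` G"
    using G_closed_ops(1) fn_ops(1) by (metis imageI)
  show "(\<lambda>z. f z + g z) \<in> fn ` G" if "f \<in> fn ` G" "g \<in> fn ` G" for f g
  proof -
    from that obtain p q where "p \<in> G" "q \<in> G" "f = fn p" "g = fn q" by blast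
    then show ?thesis using G_closed_ops(2) by (simp only: fn_ops imageI)
  qed
  show "(\<lambda>z. c * f z) \<in> fn ` G" if "f \<in> fn ` G" for f c
  proof -
    from that obtain p where "p \<in> G" "f = fn p" by blast
    then show ?thesis using G_closed_ops(4) by (simp only: fn_ops imageI)
  qed
  show "ip (\<lambda>z. f z + g z) h = ip f h + ip g h" if "f \<in> fn ` G" "g \<in> fn ` G" "h \<in> fn ` G" for f g h
  proof -
    from that obtain p q r where "p \<in> G" "q \<in> G" "r \<in> G" "f = fn p" "g = fn q" "h = fn r" by blast
    then show ?thesis using G_closed_ops(2)[of p q] by (simp only: fn_ops ip_fn) (simp add: cip_add_left)
  qed
  show "ip (\<lambda>z. c * f z) h = c * ip f h" if "f \<in> fn ` G" "h \<in> fn ` G" for f h c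
  proof -
    from that obtain p r where "p \<in> G" "r \<in> G" "f = fn p" "h = fn r" by blast
    then show ?thesis using G_closed_ops(4)[of p c]
      by (simp only: fn_ops ip_fn) (simp add: cip_scaleC_left distrib_left)
  qed
  show "ip g f = cnj (ip f g)" if "f \<in> fn ` G" "g \<in> fn ` G" for f g
  proof -
    from that obtain p q where "p \<in> G" "q \<in> G" "f = fn p" "g = fn q" by blast
    then show ?thesis
      by (simp only: ip_fn complex_cnj_add cip_commute[symmetric])
  qed
  show "0 \<le> Re (ip f f)" if "f \<in> fn ` G" for f
  proof -
    from that obtain p where "p \<in> G" "f = fn p" by blast
    then show ?thesis by (simp add: ip_fn cip_self_norm)
  qed
  show "f = (\<lambda>z. 0)" if "f \<in> fn ` G" "ip f f = 0" for f
  proof -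
    from that obtain p where p: "p \<in> G" "f = fn p" by auto
    then have "norm p = 0" using norm_fn[OF p(1)] that(2) by simp
    then show ?thesis using p fn_ops(1) by simp
  qed
  show "\<exists>f\<in>fn ` G. (\<lambda>n. sqrt (Re (ip (\<lambda>z. F n z - f z) (\<lambda>z. F n z - f z)))) \<longlonglongrightarrow> 0"
    if F: "\<And>n. F n \<in> fn ` G" and C: "\<And>\<epsilon>. \<epsilon> > 0 \<Longrightarrow> \<exists>N. \<forall>m\<ge>N. \<forall>n\<ge>N.
          sqrt (Re (ip (\<lambda>z. F m z - F n z) (\<lambda>z. F m z - F n z))) < \<epsilon>" for F :: "nat \<Rightarrow> complex \<Rightarrow> complex"
  proof -
    have "\<forall>n. \<exists>q. q \<in> G \<and> F n = fn q"
      using F by blast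
    then obtain p where p: "\<And>n. p n \<in> G" "\<And>n. F n = fn (p n)"
      unfolding choice_iff by blast
    have *: "sqrt (Re (ip (\<lambda>z. fn q z - fn r z) (\<lambda>z. fn q z - fn r z))) = norm (q - r)"
      if "q \<in> G" "r \<in> G" for q r
      unfolding fn_ops using that by (intro norm_fn G_closed_ops)
    have "sqrt (Re (ip (\<lambda>z. F m z - F n z) (\<lambda>z. F m z - F n z))) = dist (p m) (p n)" for m n
      unfolding p(2) dist_norm by (rule *[OF p(1) p(1)])
    then have "Cauchy p"
      using C by (intro metric_CauchyI) (simp only:)
    then obtain l where l: "p \<longlonglongrightarrow> l"
      using Cauchy_convergent convergent_def by blast
    then have "l \<in> G" using closed_G p(1) by blast
    moreover have "(\<lambda>n. norm (p n - l)) \<longlonglongrightarrow> 0"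
      using l by (simp add: LIM_zero tendsto_norm_zero)
    ultimately show ?thesis
      unfolding p(2) by (intro bexI[of _ "fn l"] imageI) (simp_all only: *[OF p(1)])
  qed
  show "(\<lambda>z. if z \<in> unit_disc then dbr_kernel b z w else 0) \<in> fn ` G" if "w \<in> unit_disc" for w
  proof -
    have w: "norm w < 1" using that by simp
    show ?thesis unfolding fn_kern[OF w, symmetric] by (rule imageI[OF kern_mem[OF w]])
  qed
  show "ip f (\<lambda>z. if z \<in> unit_disc then dbr_kernel b z w else 0) = f w" if "f \<in> fn ` G" "w \<in> unit_disc" for f w
  proof -
    from that obtain p where p: "p \<in> G" "f = fn p" by blast
    have w: "norm w < 1" using that by simp
    have "ip (fn p) (fn (kern w)) = fn p w"
      using w by (simp add: ip_fn p kern_mem kern_reproducing) (simp add: fn_def)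
    then show ?thesis by (simp only: p fn_kern[OF w])
  qed
qed

text \<open>The partner of T_a* h is T_b* h. The two multiplications commute, hence so do their
  adjoints, and this is the relation defining \<open>G\<close>.\<close>

lemma adj_mem: "(\<lambda>z. if z \<in> unit_disc then ev (adj_op a h) z else 0) \<in> de_Branges_Rovnyak b"
proof -
  have "(adj_op a h, adj_op b h) \<in> G"
    by (simp add: G_def cip_adj_op contr_a contr_b mult_op_commute[OF contr_a contr_b])
  then have "fn (adj_op a h, adj_op b h) \<in> fn ` G" by (rule imageI)
  then have "fn (adj_op a h, adj_op b h) \<in> de_Branges_Rovnyak b"
    unfolding de_Branges_Rovnyak_def using rkhs by blast
  then show ?thesis by (simp only: fn_def fst_conv)
qed

end

section \<open>Divergent pairings and outer functions\<close>

text \<open>Step k has length 3^(-k) along the line of \<open>x k\<close>. The sign is chosen so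
  that the new term reinforces the pairing of the current point with \<open>x k\<close> and never
  cancels it.\<close>

primrec glide :: "(nat \<Rightarrow> 'a::real_inner) \<Rightarrow> nat \<Rightarrow> 'a" where
  "glide x 0 = 0"
| "glide x (Suc k) = glide x k + ((if inner (glide x k) (x k) \<ge> 0 then 1 else - 1) * (1 / 3) ^ k / norm (x k)) *\<^sub>R x k"

text \<open>Step k secures a pairing of at least 3^(-k) ||x k||. All later steps together have
  length at most 3^(-k) / 2 and can destroy half of it; with ||x k|| \<ge> 4^k there remains (4/3)^k
  / 2.\<close>

lemma uniform_boundedness_glide:
  fixes x :: "nat \<Rightarrow> 'a::{real_inner, banach}"
  assumes x: "\<And>k. 4 ^ k \<le> norm (x k)"
  shows "\<exists>h. \<forall>k. (4 / 3) ^ k / 2 \<le> \<bar>inner h (x k)\<bar>"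
proof -
  have pos: "0 < norm (x k)" for k
    using x[of k] by (rule less_le_trans[rotated]) simp
  define d where "d = (\<lambda>k. glide x (Suc k) - glide x k)"
  have d: "norm (d k) = (1 / 3) ^ k" for k
    using pos[of k] by (simp add: d_def abs_mult power_abs)
  have sd: "summable d"
    by (rule summable_norm_cancel) (simp add: d summable_geometric)
  define h where "h = suminf d"
  have glide: "glide x k = (\<Sum>j<k. d j)" for k
    unfolding d_def by (subst sum_lessThan_telescope) simp
  have "(4 / 3) ^ k / 2 \<le> \<bar>inner h (x k)\<bar>" for k
  proof -
    have "h - glide x (Suc k) = (\<Sum>n. d (n + Suc k))"
      unfolding h_def glide by (rule suminf_minus_initial_segment[OF sd, symmetric])
    also have "norm \<dots> \<le> (\<Sum>n. norm (d (n + Suc k)))"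
      by (rule summable_norm) (simp add: d power_add summable_mult2 summable_geometric)
    also have "\<dots> = (\<Sum>n. (1 / 3) ^ n * (1 / 3) ^ Suc k)"
      by (simp only: d power_add)
    also have "\<dots> = (\<Sum>n. (1 / 3 :: real) ^ n) * (1 / 3) ^ Suc k"
      by (rule suminf_mult2[symmetric]) (simp add: summable_geometric)
    also have "\<dots> = (1 / 3) ^ k / 2"
      by (subst suminf_geometric) auto
    finally have "norm (h - glide x (Suc k)) \<le> (1 / 3) ^ k / 2" .
    then have 1: "\<bar>inner (h - glide x (Suc k)) (x k)\<bar> \<le> (1 / 3) ^ k / 2 * norm (x k)"
      by (intro order_trans[OF Cauchy_Schwarz_ineq2] mult_right_mono) auto
    have "inner (glide x (Suc k)) (x k) = inner (glide x k) (x k)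
        + (if inner (glide x k) (x k) \<ge> 0 then 1 else - 1) * ((1 / 3) ^ k * norm (x k))"
      using pos[of k] by (simp add: inner_add_left dot_square_norm power2_eq_square)
    moreover have "0 \<le> (1 / 3) ^ k * norm (x k)" by simp
    ultimately have "\<bar>inner (glide x (Suc k)) (x k)\<bar> \<ge> (1 / 3) ^ k * norm (x k)"
      by (auto split: if_splits)
    then have "\<bar>inner h (x k)\<bar> \<ge> (1 / 3) ^ k / 2 * norm (x k)"
      using 1 unfolding inner_diff_left by linarith
    moreover have "(1 / 3) ^ k / 2 * norm (x k) \<ge> (1 / 3) ^ k / 2 * 4 ^ k"
      by (intro mult_left_mono x) simp
    moreover have "(1 / 3) ^ k / 2 * 4 ^ k = (4 / 3 :: real) ^ k / 2"
      by (simp add: power_divide)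
    ultimately show ?thesis by linarith
  qed
  then show ?thesis by blast
qed

lemma (in pyth_pair) divergent_pairing:
  assumes Q: "\<And>k n. coeff_seq (Q k) n = (if n \<le> N k then c n else 0)"
    and big: "\<And>k. 4 ^ k \<le> norm (mult_op a (Q k))"
  shows "\<exists>f. f \<in> de_Branges_Rovnyak b \<and> \<not> summable (\<lambda>n. cnj (c n) * taylor_coeff f n)"
proof -
  obtain h where h: "\<And>k. (4 / 3) ^ k / 2 \<le> \<bar>inner h (mult_op a (Q k))\<bar>"
    using uniform_boundedness_glide[OF big] by blast
  define f where "f = (\<lambda>z. if z \<in> unit_disc then ev (adj_op a h) z else 0)"
  have coeff: "taylor_coeff f n = cip h (mult_op a (unit_seq n))" for n
  proof -
    have "taylor_coeff f = taylor_coeff (ev (adj_op a h))"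
      by (rule taylor_coeff_cong[OF holomorphic_ev]) (simp add: f_def)
    then show ?thesis by (simp add: taylor_coeff_ev coeff_adj_op contr_a)
  qed
  have "\<not> summable (\<lambda>n. cnj (c n) * taylor_coeff f n)"
  proof
    assume "summable (\<lambda>n. cnj (c n) * taylor_coeff f n)"
    then have "Bseq (\<lambda>n. \<Sum>k\<le>n. cnj (c k) * taylor_coeff f k)"
      by (intro convergent_imp_Bseq) (simp add: summable_iff_convergent')
    then obtain K where K: "\<And>n. norm (\<Sum>k\<le>n. cnj (c k) * taylor_coeff f k) \<le> K"
      unfolding Bseq_def by blast
    have "(4 / 3) ^ k \<le> 2 * K" for k
    proof -
      \<comment> \<open>The conjugates on the coefficients come from antilinearity of
        \<open>cip\<close> in its second argument. As \<open>Q k\<close> is a truncation of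
        \<open>c\<close>, the series stops at \<open>N k\<close>.\<close>
      have "(\<lambda>n. cnj (coeff_seq (Q k) n) * cip h (mult_op a (unit_seq n))) sums cip h (mult_op a (Q k))"
        by (rule cip_mult_op_sums(2)[OF contr_a])
      moreover have "(\<lambda>n. cnj (coeff_seq (Q k) n) * cip h (mult_op a (unit_seq n))) sums
          (\<Sum>n\<le>N k. cnj (coeff_seq (Q k) n) * cip h (mult_op a (unit_seq n)))"
        by (rule sums_finite) (auto simp: Q)
      ultimately have "cip h (mult_op a (Q k)) = (\<Sum>n\<le>N k. cnj (coeff_seq (Q k) n) * cip h (mult_op a (unit_seq n)))"
        by (rule sums_unique2)
      also have "\<dots> = (\<Sum>n\<le>N k. cnj (c n) * taylor_coeff f n)"
        by (rule sum.cong) (auto simp: Q coeff)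
      finally have "norm (cip h (mult_op a (Q k))) \<le> K"
        using K by simp
      moreover have "\<bar>inner h (mult_op a (Q k))\<bar> \<le> norm (cip h (mult_op a (Q k)))"
        unfolding inner_ell2_def by (rule abs_Re_le_cmod)
      ultimately show ?thesis using h[of k] by linarith
    qed
    moreover obtain k where "2 * K < (4 / 3) ^ k"
      using real_arch_pow[of "4 / 3" "2 * K"] by auto
    ultimately show False using not_less by blast
  qed
  then show ?thesis using adj_mem[of h] f_def by blast
qed

lemma taylor_coeff_shift:
  assumes "f holomorphic_on unit_disc"
  shows "taylor_coeff (\<lambda>z. z ^ n * f z) i = (if i < n then 0 else taylor_coeff f (i - n))"
proof -
  have "taylor_coeff (\<lambda>z. z ^ n * f z) = (\<lambda>i. if i < n then 0 else taylor_coeff f (i - n))"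
  proof (rule taylor_coeff_unique(1))
    fix z :: complex assume z: "norm z < 1"
    define g where "g = (\<lambda>i. (if i < n then 0 else taylor_coeff f (i - n)) * z ^ i)"
    have "(\<lambda>i. z ^ n * (taylor_coeff f i * z ^ i)) sums (z ^ n * f z)"
      by (intro sums_mult taylor_sums assms z)
    then have "(\<lambda>i. g (i + n)) sums (z ^ n * f z)"
      by (simp add: g_def power_add mult_ac)
    then have "g sums (z ^ n * f z + (\<Sum>i<n. g i))"
      by (simp add: sums_iff_shift)
    moreover have "(\<Sum>i<n. g i) = 0" by (simp add: g_def)
    ultimately show "(\<lambda>i. (if i < n then 0 else taylor_coeff f (i - n)) * z ^ i) sums (z ^ n * f z)"
      by (simp add: g_def)
  qed
  then show ?thesis by simp
qed

lemma taylor_coeff_0: "taylor_coeff f 0 = f 0"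
  by (simp add: taylor_coeff_def fps_expansion_def)

section \<open>Outer functions and their boundary behaviour\<close>

definition outer_exp :: "(real \<Rightarrow> real) \<Rightarrow> complex \<Rightarrow> complex" where
  "outer_exp u z = exp (schwarz u z)"

lemma outer_exp_nonzero [simp]: "outer_exp u z \<noteq> 0"
  by (simp add: outer_exp_def)

lemma contractive_outer_exp:
  assumes "integrable circ u" "\<And>t. u t \<le> 0"
  shows "contractive (outer_exp u)"
  unfolding contractive_def
proof (intro conjI ballI)
  show "outer_exp u holomorphic_on unit_disc"
    unfolding outer_exp_def[abs_def] by (intro holomorphic_on_exp' holomorphic_schwarz assms)
  fix z assume "z \<in> unit_disc"
  then have z: "norm z < 1" by simp
  have "Re (schwarz u z) \<le> Re (schwarz (\<lambda>_. 0) z)"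
    by (rule Re_schwarz_mono) (use assms z in auto)
  then show "norm (outer_exp u z) \<le> 1"
    by (simp add: outer_exp_def schwarz_const[OF z])
qed

text \<open>
  With \<open>v = max u (- K)\<close> the function \<open>exp (S u) / exp (S v)\<close> is contractive, is a bounded multiple of
  \<open>exp (S u)\<close>, and its value at \<open>0\<close> tends to \<open>1\<close>; a contractive function whose value at \<open>0\<close> is close
  to \<open>1\<close> is close to \<open>1\<close> in \<open>H\<^sup>2\<close>.
\<close>

lemma outer_exp_cyclic:
  assumes u: "integrable circ u" "\<And>t. u t \<le> 0"
    and g: "\<And>x. cip g (mult_op (outer_exp u) x) = 0"
  shows "g = 0"
proof -
  note ca = contractive_outer_exp[OF u]
  define v where "v = (\<lambda>K t. max (u t) (- real K))"
  define w where "w = (\<lambda>K t. u t - v K t)"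
  have um: "u \<in> borel_measurable circ" using u(1) by (rule borel_measurable_integrable)
  have v: "integrable circ (v K)" for K
    by (rule Bochner_Integration.integrable_bound[OF u(1)])
       (use um u(2) in \<open>auto simp: v_def\<close>)
  have w: "integrable circ (w K)" for K
    unfolding w_def by (intro Bochner_Integration.integrable_diff u v)
  have cF: "contractive (outer_exp (w K))" for K
    by (rule contractive_outer_exp[OF w]) (simp add: w_def v_def)
  \<comment> \<open>The reciprocal of \<open>outer_exp (v K)\<close>, scaled: since
    \<open>v K\<close> is at least - K, the factor \<open>exp (- K)\<close> brings it into the unit
    ball. Then \<open>outer_exp (w K)\<close> is a multiple of \<open>outer_exp u * q K\<close>, so
    its products with powers of z lie in the range orthogonal to \<open>g\<close>.\<close>
  define q where "q = (\<lambda>K z. exp (- of_nat K) * exp (- schwarz (v K) z))"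
  have cq: "contractive (q K)" for K
    unfolding contractive_def
  proof (intro conjI ballI)
    show "q K holomorphic_on unit_disc"
      unfolding q_def by (intro holomorphic_intros holomorphic_schwarz v)
    fix z assume "z \<in> unit_disc"
    then have z: "norm z < 1" by simp
    have "Re (schwarz (\<lambda>_. - real K) z) \<le> Re (schwarz (v K) z)"
      by (rule Re_schwarz_mono) (use v z in \<open>auto simp: v_def\<close>)
    then show "norm (q K z) \<le> 1"
      by (simp add: q_def norm_mult schwarz_const[OF z] flip: exp_add)
  qed
  have F_eq: "mult_op (outer_exp (w K)) (unit_seq n)
      = scaleC (exp (of_nat K)) (mult_op (outer_exp u) (mult_op (q K) (unit_seq n)))" for K n
  proof (rule ev_inject)
    fix z :: complex assume z: "norm z < 1"
    have "outer_exp (w K) z = exp (of_nat K) * (outer_exp u z * q K z)"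
      unfolding w_def outer_exp_def schwarz_diff[OF u(1) v z] q_def
      by (simp add: exp_diff exp_minus field_simps)
    then show "ev (mult_op (outer_exp (w K)) (unit_seq n)) z
        = ev (scaleC (exp (of_nat K)) (mult_op (outer_exp u) (mult_op (q K) (unit_seq n)))) z"
      using z by (simp add: ev_mult_op cF ca cq ev_simps)
  qed
  have orth: "cip g (mult_op (outer_exp (w K)) (unit_seq n)) = 0" for K n
    unfolding F_eq by (simp add: cip_scaleC_right g)
  have lim0: "(\<lambda>K. Re (outer_exp (w K) 0)) \<longlonglongrightarrow> 1"
  proof -
    have "(\<lambda>K. integral\<^sup>L circ (w K)) \<longlonglongrightarrow> integral\<^sup>L circ (\<lambda>_. 0)"
    proof (rule integral_dominated_convergence[where w = "\<lambda>t. norm (u t)"])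
      show "integrable circ (\<lambda>t. norm (u t))" using u(1) by simp
      show "w K \<in> borel_measurable circ" for K using w by (rule borel_measurable_integrable)
      show "AE t in circ. norm (w K t) \<le> norm (u t)" for K
        using u(2) by (intro AE_I2) (auto simp: w_def v_def abs_if max_def)
      show "AE t in circ. (\<lambda>K. w K t) \<longlonglongrightarrow> 0"
      proof (rule AE_I2, rule tendsto_eventually)
        fix t
        obtain K0 :: nat where "- u t \<le> K0" using real_arch_simple by blast
        then show "\<forall>\<^sub>F K in sequentially. w K t = 0"
          by (intro eventually_sequentiallyI[of K0]) (auto simp: w_def v_def max_def)
      qed
    qed simp
    then have "(\<lambda>K. exp (integral\<^sup>L circ (w K) / (2 * pi))) \<longlonglongrightarrow> exp (0 / (2 * pi))"
      by (intro tendsto_intros) auto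
    moreover have "Re (outer_exp (w K) 0) = exp (integral\<^sup>L circ (w K) / (2 * pi))" for K
      unfolding outer_exp_def schwarz_zero by (simp only: exp_of_real Re_complex_of_real)
    ultimately show ?thesis by simp
  qed
  have "coeff_seq g n = 0" for n
  proof -
    have le: "(norm (mult_op (outer_exp (w K)) (unit_seq n) - unit_seq n))\<^sup>2 \<le> 2 - 2 * Re (outer_exp (w K) 0)" for K
    proof -
      define y where "y = mult_op (outer_exp (w K)) (unit_seq n)"
      have unit: "norm (unit_seq n) = 1"
        by (simp add: norm_eq_sqrt_inner inner_ell2_def cip_unit_seq)
      then have y: "norm y \<le> 1"
        using norm_mult_op[OF cF, of K "unit_seq n"] by (simp add: y_def)
      have hol: "outer_exp (w K) holomorphic_on unit_disc"
        using cF[of K] by (simp add: contractive_def)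
      have "cip y (unit_seq n) = taylor_coeff (\<lambda>z. z ^ n * outer_exp (w K) z) n"
        by (simp add: y_def cip_unit_seq coeff_mult_op cF ev_unit_seq mult.commute)
      also have "\<dots> = outer_exp (w K) 0"
        by (simp add: taylor_coeff_shift[OF hol] taylor_coeff_0)
      finally have "inner y (unit_seq n) = Re (outer_exp (w K) 0)"
        by (simp add: inner_ell2_def)
      then have "(norm (y - unit_seq n))\<^sup>2 = (norm y)\<^sup>2 - 2 * Re (outer_exp (w K) 0) + 1"
        using unit by (simp add: power2_norm_eq_inner inner_diff inner_commute[of "unit_seq n" y])
          (simp flip: power2_norm_eq_inner)
      moreover have "(norm y)\<^sup>2 \<le> 1" using y by (simp add: power_le_one)
      ultimately show ?thesis by (simp add: y_def)
    qed
    have "(\<lambda>K. (norm (mult_op (outer_exp (w K)) (unit_seq n) - unit_seq n))\<^sup>2) \<longlonglongrightarrow> 0"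
    proof (rule tendsto_sandwich[where f = "\<lambda>_. 0"])
      have "(\<lambda>K. 2 - 2 * Re (outer_exp (w K) 0)) \<longlonglongrightarrow> 2 - 2 * 1"
        by (intro tendsto_intros lim0)
      then show "(\<lambda>K. 2 - 2 * Re (outer_exp (w K) 0)) \<longlonglongrightarrow> 0" by simp
    qed (auto simp: le)
    then have "(\<lambda>K. norm (mult_op (outer_exp (w K)) (unit_seq n) - unit_seq n)) \<longlonglongrightarrow> 0"
      using tendsto_real_sqrt[of _ 0] by fastforce
    then have "(\<lambda>K. mult_op (outer_exp (w K)) (unit_seq n)) \<longlonglongrightarrow> unit_seq n"
      by (metis LIM_zero_cancel tendsto_norm_zero_cancel)
    then have "(\<lambda>K. cip g (mult_op (outer_exp (w K)) (unit_seq n))) \<longlonglongrightarrow> cip g (unit_seq n)"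
      by (rule bounded_linear.tendsto[OF bounded_linear_cip_right])
    then show ?thesis
      unfolding orth cip_unit_seq using LIMSEQ_unique tendsto_const by blast
  qed
  then show ?thesis by (intro ell2_eqI) simp
qed

text \<open>The point r cis t is at distance 1 - r from cis t and no closer than that to any cis s;
  the triangle inequality gives the factor 2. This makes kernel estimates along a radius uniform in
  r.\<close>

lemma norm_cis_diff_le:
  assumes "0 \<le> r" "r < 1"
  shows "norm (cis s - cis t) \<le> 2 * norm (cis s - complex_of_real r * cis t)"
proof -
  have "norm (cis s - cis t) \<le> norm (cis s - complex_of_real r * cis t) + norm (complex_of_real r * cis t - cis t)"
    using norm_triangle_ineq[of "cis s - complex_of_real r * cis t" "complex_of_real r * cis t - cis t"] by simp
  also have "norm (complex_of_real r * cis t - cis t) = 1 - r"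
  proof -
    have "complex_of_real r * cis t - cis t = complex_of_real (r - 1) * cis t" by (simp add: algebra_simps)
    then show ?thesis by (simp only: norm_mult norm_cis norm_of_real) (use assms in simp)
  qed
  also have "1 - r \<le> norm (cis s - complex_of_real r * cis t)"
    using norm_triangle_ineq2[of "cis s" "complex_of_real r * cis t"] assms by (simp add: norm_mult)
  finally show ?thesis by simp
qed

text \<open>Subtracting the constant \<open>u t0\<close> makes the density vanish at
  \<open>t0\<close>; \<open>le\<close> and \<open>norm_cis_diff_le\<close> then dominate the
  integrand by \<open>4 * w t\<close> for every radius. The limiting kernel (cis t + cis t0) / (cis
  t - cis t0) is purely imaginary, so only \<open>u t0\<close> survives in the real part.\<close>

lemma schwarz_radial_limit:
  assumes u: "integrable circ u" and w: "integrable circ w"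
    and le: "\<And>t. \<bar>u t - u t0\<bar> \<le> norm (cis t - cis t0) * w t" and w0: "\<And>t. 0 \<le> w t"
  shows "\<exists>l. has_radial_limit (schwarz u) t0 l \<and> Re l = u t0"
proof -
  define k where "k = (\<lambda>z t. (cis t + z) / (cis t - z) * complex_of_real (u t - u t0))"
  define L where "L = 1 / (2 * complex_of_real pi) * integral\<^sup>L circ (k (cis t0)) + u t0"
  have c0: "integrable circ (\<lambda>_. u t0)" by simp
  have um: "u \<in> borel_measurable circ" using u by (rule borel_measurable_integrable)
  have "(\<lambda>t. complex_of_real (u t - u t0)) \<in> borel_measurable circ"
    using um by measurable
  then have km: "k z \<in> borel_measurable circ" for z
    unfolding k_def
    by (intro borel_measurable_times borel_measurable_divide borel_measurable_add
        borel_measurable_diff borel_measurable_const borel_measurable_circ[OF measurable_cis])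
  have eq: "schwarz u z = 1 / (2 * complex_of_real pi) * integral\<^sup>L circ (k z) + u t0" if "norm z < 1" for z
  proof -
    have "schwarz (\<lambda>t. u t - u t0) z = 1 / (2 * complex_of_real pi) * integral\<^sup>L circ (k z)"
      by (simp add: schwarz_def k_def)
    then show ?thesis
      using schwarz_diff[OF u c0 that] schwarz_const[OF that, of "u t0"]
      by (simp add: diff_eq_eq)
  qed
  have bd: "norm (k (complex_of_real r * cis t0) t) \<le> 4 * w t" if r: "0 \<le> r" "r < 1" for r t
  proof -
    define z where "z = complex_of_real r * cis t0"
    have z1: "norm z < 1" using r by (simp add: z_def norm_mult)
    then have nz: "0 < norm (cis t - z)" by auto
    have "norm (k z t) = norm (cis t + z) / norm (cis t - z) * \<bar>u t - u t0\<bar>"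
      by (simp only: k_def norm_mult norm_divide norm_of_real)
    also have "\<dots> \<le> 2 / norm (cis t - z) * (norm (cis t - cis t0) * w t)"
      using z1 norm_triangle_ineq[of "cis t" z]
      by (intro mult_mono divide_right_mono le) auto
    also have "\<dots> \<le> 2 / norm (cis t - z) * (2 * norm (cis t - z) * w t)"
      unfolding z_def by (intro mult_left_mono mult_right_mono norm_cis_diff_le r w0) auto
    also have "\<dots> = 4 * w t" using nz by simp
    finally show ?thesis by (simp add: z_def)
  qed
  have lim: "((\<lambda>r. integral\<^sup>L circ (k (complex_of_real r * cis t0))) \<longlongrightarrow> integral\<^sup>L circ (k (cis t0))) (at_left 1)"
  proof (rule tendsto_at_left_sequentially)
    show "(0::real) < 1" by simp
    fix S :: "nat \<Rightarrow> real"
    assume S: "\<And>n. S n < 1" "\<And>n. 0 < S n" "S \<longlonglongrightarrow> 1"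
    show "(\<lambda>n. integral\<^sup>L circ (k (complex_of_real (S n) * cis t0))) \<longlonglongrightarrow> integral\<^sup>L circ (k (cis t0))"
    proof (rule integral_dominated_convergence[where w = "\<lambda>t. 4 * w t"])
      show "integrable circ (\<lambda>t. 4 * w t)" using w by simp
      show "AE t in circ. norm (k (complex_of_real (S n) * cis t0) t) \<le> 4 * w t" for n
        using S(1,2)[of n] by (intro AE_I2 bd) auto
      show "AE t in circ. (\<lambda>n. k (complex_of_real (S n) * cis t0) t) \<longlonglongrightarrow> k (cis t0) t"
      proof (rule AE_I2)
        fix t
        have z: "(\<lambda>n. complex_of_real (S n) * cis t0) \<longlonglongrightarrow> cis t0"
          using tendsto_mult[OF tendsto_of_real[OF S(3)] tendsto_const[of "cis t0"]] by simp
        show "(\<lambda>n. k (complex_of_real (S n) * cis t0) t) \<longlonglongrightarrow> k (cis t0) t"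
        proof (cases "cis t = cis t0")
          case True
          \<comment> \<open>The limiting kernel divides by zero here, but \<open>le\<close> forces
            the other factor of \<open>k\<close> to vanish.\<close>
          then have "u t = u t0" using le[of t] by simp
          then show ?thesis by (simp add: k_def)
        next
          case False
          then show ?thesis
            unfolding k_def by (intro tendsto_intros z) auto
        qed
      qed
    qed (rule km)+
  qed
  have "has_radial_limit (schwarz u) t0 L"
    unfolding has_radial_limit_def L_def
  proof (rule Lim_transform_eventually)
    show "((\<lambda>r. 1 / (2 * complex_of_real pi) * integral\<^sup>L circ (k (complex_of_real r * cis t0)) + u t0)
       \<longlongrightarrow> 1 / (2 * complex_of_real pi) * integral\<^sup>L circ (k (cis t0)) + u t0) (at_left 1)"
      by (intro tendsto_intros lim)
    show "\<forall>\<^sub>F r in at_left 1. 1 / (2 * complex_of_real pi) * integral\<^sup>L circ (k (complex_of_real r * cis t0)) + u t0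
       = schwarz u (complex_of_real r * cis t0)"
      using eventually_at_left_real[OF zero_less_one]
      by eventually_elim (rule eq[symmetric], auto simp: norm_mult)
  qed
  moreover have "Re L = u t0"
  proof -
    have "Re ((cis t + cis t0) / (cis t - cis t0)) = 0" for t
    proof -
      have "(cis t + cis t0) / (cis t - cis t0) = (cis t + cis t0) * cnj (cis t - cis t0) / complex_of_real ((norm (cis t - cis t0))\<^sup>2)"
        by (rule complex_div_cnj)
      moreover have "Re ((cis t + cis t0) * cnj (cis t - cis t0)) = 0"
        using sin_cos_squared_add[of t] sin_cos_squared_add[of t0]
        by (simp add: algebra_simps power2_eq_square)
      ultimately show ?thesis by (simp only: Re_divide_of_real)
    qed
    moreover have "Re (x * complex_of_real c) = Re x * c" for x c by simp
    ultimately have k0: "Re (k (cis t0) t) = 0" for t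
      by (simp only: k_def)
    \<comment> \<open>If the limiting kernel is not integrable, its integral is 0 by convention, so
      both cases give a vanishing real part.\<close>
    have "Re (integral\<^sup>L circ (k (cis t0))) = 0"
    proof (cases "integrable circ (k (cis t0))")
      case True
      then show ?thesis by (subst integral_Re[symmetric]) (simp_all add: k0)
    qed (simp add: not_integrable_integral_eq)
    then show ?thesis by (simp add: L_def)
  qed
  ultimately show ?thesis by blast
qed

text \<open>With x = y + d the claim is 1 + x^2 \<le> (1 + d)^2 (1 + y^2) together with ln (1 + d)
  \<le> d. It carries Lipschitz bounds from \<phi> to the logarithm of the outer modulus, and for y
  = 0 bounds that logarithm by |\<phi>|.\<close>

lemma ln_sqrt_lipschitz:
  fixes x y :: real
  assumes "0 \<le> x" "0 \<le> y"
  shows "\<bar>1/2 * ln (1 + x\<^sup>2) - 1/2 * ln (1 + y\<^sup>2)\<bar> \<le> \<bar>x - y\<bar>"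
proof -
  have main: "1/2 * ln (1 + x\<^sup>2) - 1/2 * ln (1 + y\<^sup>2) \<le> x - y" if "0 \<le> y" "y \<le> x" for x y :: real
  proof -
    define d where "d = x - y"
    have d: "0 \<le> d" "x = y + d" using that by (auto simp: d_def)
    have "y \<le> 1 + y\<^sup>2"
      using zero_le_power2[of "y - 1"] that by (simp add: power2_eq_square algebra_simps)
    then have "2 * d * y \<le> 2 * d * (1 + y\<^sup>2)" using d by (intro mult_left_mono) auto
    moreover have "d\<^sup>2 * 1 \<le> d\<^sup>2 * (1 + y\<^sup>2)" by (intro mult_left_mono) auto
    ultimately have "1 + x\<^sup>2 \<le> (1 + d)\<^sup>2 * (1 + y\<^sup>2)"
      unfolding d(2) by (simp add: power2_eq_square algebra_simps)
    then have "ln (1 + x\<^sup>2) \<le> ln ((1 + d)\<^sup>2 * (1 + y\<^sup>2))"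
      using d by (subst ln_le_cancel_iff) (auto intro!: mult_pos_pos zero_less_power add_pos_nonneg)
    also have "\<dots> = 2 * ln (1 + d) + ln (1 + y\<^sup>2)"
    proof -
      have "0 < 1 + d" "0 < 1 + y\<^sup>2" using d by (auto simp: add_pos_nonneg)
      then show ?thesis by (simp add: ln_mult ln_realpow)
    qed
    also have "ln (1 + d) \<le> d" using d by (intro ln_add_one_self_le_self)
    finally show ?thesis by (simp add: d_def)
  qed
  show ?thesis
  proof (cases "y \<le> x")
    case True
    moreover have "ln (1 + y\<^sup>2) \<le> ln (1 + x\<^sup>2)"
      using True assms by (subst ln_le_cancel_iff) (auto simp: add_pos_nonneg power_mono)
    ultimately show ?thesis using main[of y x] assms by simp
  next
    case False
    moreover have "ln (1 + x\<^sup>2) \<le> ln (1 + y\<^sup>2)"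
      using False assms by (subst ln_le_cancel_iff) (auto simp: add_pos_nonneg power_mono)
    ultimately show ?thesis using main[of x y] assms by simp
  qed
qed

text \<open>The inequality of arithmetic and geometric means trades the Lipschitz error \<Lambda> d
  for \<open>e\<close> plus a multiple of d^2. The square d^2 cancels the singularity of the Poisson
  kernel and leaves 4 (1 - r^2), uniformly in the boundary point.\<close>

lemma Re_schwarz_upper:
  assumes u: "integrable circ u" and r: "0 \<le> r" "r < 1" and e: "0 < e"
    and lip: "\<And>s. \<bar>u s - u t\<bar> \<le> \<Lambda> * norm (cis s - cis t)"
  shows "Re (schwarz u (complex_of_real r * cis t)) \<le> u t + e + \<Lambda>\<^sup>2 / e * (1 - r\<^sup>2)"
proof -
  define z where "z = complex_of_real r * cis t"
  have z: "norm z < 1" "norm z = r" using r by (auto simp: z_def norm_mult)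
  define P where "P = (\<lambda>s. (1 - (norm z)\<^sup>2) / (norm (cis s - z))\<^sup>2)"
  have P0: "0 \<le> P s" for s using z r by (simp add: P_def power_le_one)
  have c: "integrable circ (\<lambda>_. c :: real)" for c by simp
  have Pint: "integrable circ (\<lambda>s. P s * c)" for c
    using poisson_integrable(1)[OF c z(1)] by (simp add: P_def)
  have Pone: "integral\<^sup>L circ (\<lambda>s. P s * c) / (2 * pi) = c" for c
    using poisson_integrable(2)[OF c z(1), of c] schwarz_const[OF z(1), of c] by (simp add: P_def)
  define C where "C = u t + e + \<Lambda>\<^sup>2 / e * (1 - r\<^sup>2)"
  have pt: "P s * u s \<le> P s * (u t + e) + \<Lambda>\<^sup>2 / e * (1 - r\<^sup>2)" for s
  proof -
    define d where "d = norm (cis s - cis t)"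
    have "0 \<le> (e - \<Lambda> * d / 2)\<^sup>2" by simp
    then have "\<Lambda> * d * e \<le> e * e + \<Lambda>\<^sup>2 * d\<^sup>2 / 4"
      by (simp add: power2_eq_square algebra_simps)
    then have "\<Lambda> * d \<le> e + \<Lambda>\<^sup>2 / (4 * e) * d\<^sup>2" using e by (simp add: field_simps power2_eq_square)
    then have "u s \<le> (u t + e) + \<Lambda>\<^sup>2 / (4 * e) * d\<^sup>2"
      using lip[of s] unfolding d_def by linarith
    then have "P s * u s \<le> P s * ((u t + e) + \<Lambda>\<^sup>2 / (4 * e) * d\<^sup>2)"
      by (rule mult_left_mono[OF _ P0])
    also have "\<dots> = P s * (u t + e) + \<Lambda>\<^sup>2 / (4 * e) * (P s * d\<^sup>2)"
      by (simp add: algebra_simps)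
    also have "P s * d\<^sup>2 \<le> 4 * (1 - r\<^sup>2)"
    proof -
      have "d\<^sup>2 \<le> (2 * norm (cis s - z))\<^sup>2"
        unfolding d_def z_def by (intro power_mono norm_cis_diff_le r) auto
      then have "P s * d\<^sup>2 \<le> P s * (2 * norm (cis s - z))\<^sup>2"
        by (rule mult_left_mono[OF _ P0])
      moreover have "cis s \<noteq> z" using z by auto
      ultimately show ?thesis by (simp add: P_def z power_mult_distrib)
    qed
    then have "\<Lambda>\<^sup>2 / (4 * e) * (P s * d\<^sup>2) \<le> \<Lambda>\<^sup>2 / (4 * e) * (4 * (1 - r\<^sup>2))"
      using e by (intro mult_left_mono) auto
    also have "\<Lambda>\<^sup>2 / (4 * e) * (4 * (1 - r\<^sup>2)) = \<Lambda>\<^sup>2 / e * (1 - r\<^sup>2)"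
      using e by (simp add: field_simps)
    finally show ?thesis by simp
  qed
  have "Re (schwarz u z) = integral\<^sup>L circ (\<lambda>s. P s * u s) / (2 * pi)"
    unfolding P_def by (rule poisson_integrable(2)[OF u z(1)])
  also have "\<dots> \<le> integral\<^sup>L circ (\<lambda>s. P s * (u t + e) + \<Lambda>\<^sup>2 / e * (1 - r\<^sup>2)) / (2 * pi)"
    using poisson_integrable(1)[OF u z(1)] Pint
    by (intro divide_right_mono integral_mono pt) (auto simp: P_def)
  also have "\<dots> = integral\<^sup>L circ (\<lambda>s. P s * (u t + e)) / (2 * pi) + \<Lambda>\<^sup>2 / e * (1 - r\<^sup>2)"
    by (subst Bochner_Integration.integral_add[OF Pint c])
      (simp add: measure_circ add_divide_distrib)
  also have "\<dots> = u t + e + \<Lambda>\<^sup>2 / e * (1 - r\<^sup>2)" by (simp only: Pone)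
  finally show ?thesis by (simp add: z_def)
qed

text \<open>
  Close to the circle the harmonic function \<open>Re (S u)\<close> is uniformly close to \<open>u\<close>, so that the claim is
  the maximum principle.
\<close>

lemma outer_majorant_lipschitz:
  fixes P :: "complex \<Rightarrow> complex"
  assumes P: "P holomorphic_on unit_disc"
    and lip: "\<And>z w. norm z \<le> 1 \<Longrightarrow> norm w \<le> 1 \<Longrightarrow> norm (P z - P w) \<le> \<Lambda> * norm (z - w)"
    and u_def: "u = (\<lambda>t. - (1/2 * ln (1 + (norm (P (cis t)))\<^sup>2)))"
    and u: "integrable circ u" and z0: "norm z0 < 1"
  shows "norm (P z0 * outer_exp u z0) \<le> 1"
proof -
  have hol: "(\<lambda>z. P z * outer_exp u z) holomorphic_on unit_disc"
    unfolding outer_exp_def by (intro holomorphic_intros P holomorphic_schwarz u)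
  have L0: "0 \<le> \<Lambda>" using lip[of 0 1] by (intro order_trans[OF norm_ge_zero[of "P 0 - P 1"]]) simp
  have ulip: "\<bar>u s - u t\<bar> \<le> \<Lambda> * norm (cis s - cis t)" for s t
  proof -
    have "\<bar>u s - u t\<bar> \<le> \<bar>norm (P (cis s)) - norm (P (cis t))\<bar>"
      unfolding u_def using ln_sqrt_lipschitz[of "norm (P (cis s))" "norm (P (cis t))"] by simp
    also have "\<dots> \<le> norm (P (cis s) - P (cis t))" by (rule norm_triangle_ineq3)
    also have "\<dots> \<le> \<Lambda> * norm (cis s - cis t)" by (rule lip) auto
    finally show ?thesis .
  qed
  have bound: "norm (P z0 * outer_exp u z0) \<le> (1 + \<Lambda> * (1 - r)) * exp (e + \<Lambda>\<^sup>2 / e * (1 - r\<^sup>2))"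
    if r: "norm z0 < r" "r < 1" and e: "0 < e" for r e
  proof (rule maximum_modulus_frontier[of "\<lambda>z. P z * outer_exp u z" "cball 0 r"])
    have r0: "0 \<le> r" using r norm_ge_zero[of z0] by linarith
    have sub: "cball 0 r \<subseteq> unit_disc" using r by auto
    show "(\<lambda>z. P z * outer_exp u z) holomorphic_on interior (cball 0 r)"
      by (rule holomorphic_on_subset[OF hol]) (use sub interior_subset in blast)
    show "continuous_on (closure (cball 0 r)) (\<lambda>z. P z * outer_exp u z)"
      using holomorphic_on_imp_continuous_on[OF hol] sub by (auto intro: continuous_on_subset)
    show "z0 \<in> cball 0 r" using r by simp
    fix z :: complex assume "z \<in> frontier (cball 0 r)"
    then have nz: "norm z = r" using r by (simp add: frontier_cball sphere_def)
    then obtain t where zt: "z = complex_of_real r * cis t"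
      by (metis rcis_cmod_Arg rcis_def)
    have "norm (P z) \<le> norm (P (cis t)) + \<Lambda> * (1 - r)"
    proof -
      have "norm (P z) \<le> norm (P (cis t)) + norm (P z - P (cis t))"
        by (rule norm_triangle_sub)
      also have "norm (P z - P (cis t)) \<le> \<Lambda> * norm (z - cis t)"
        using r nz by (intro lip) auto
      also have "norm (z - cis t) = 1 - r"
      proof -
        have "z - cis t = complex_of_real (r - 1) * cis t" by (simp add: zt algebra_simps)
        then show ?thesis by (simp only: norm_mult norm_cis norm_of_real) (use r in simp)
      qed
      finally show ?thesis by simp
    qed
    moreover have "norm (outer_exp u z) \<le> exp (u t + (e + \<Lambda>\<^sup>2 / e * (1 - r\<^sup>2)))"
      using Re_schwarz_upper[OF u r0 r(2) e ulip, of t] by (simp add: outer_exp_def zt)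
    ultimately have "norm (P z * outer_exp u z)
        \<le> (norm (P (cis t)) + \<Lambda> * (1 - r)) * exp (u t + (e + \<Lambda>\<^sup>2 / e * (1 - r\<^sup>2)))"
      unfolding norm_mult using L0 r by (intro mult_mono) auto
    also have "\<dots> = ((norm (P (cis t)) + \<Lambda> * (1 - r)) * exp (u t)) * exp (e + \<Lambda>\<^sup>2 / e * (1 - r\<^sup>2))"
      by (simp add: exp_add)
    also have "\<dots> \<le> (1 + \<Lambda> * (1 - r)) * exp (e + \<Lambda>\<^sup>2 / e * (1 - r\<^sup>2))"
    proof (intro mult_right_mono)
      define x where "x = norm (P (cis t))"
      have "exp (u t) = 1 / sqrt (1 + x\<^sup>2)"
        by (simp add: u_def x_def exp_minus ln_sqrt[symmetric] add_pos_nonneg inverse_eq_divide)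
      moreover have "x \<le> sqrt (1 + x\<^sup>2)" by (rule real_le_rsqrt) simp
      moreover have s1: "1 \<le> sqrt (1 + x\<^sup>2)" by simp
      moreover have s0: "0 < sqrt (1 + x\<^sup>2)" by (simp add: add_pos_nonneg)
      ultimately have "x * exp (u t) \<le> 1" "exp (u t) \<le> 1"
        by (simp_all only: mult_1_right times_divide_eq_right divide_le_eq_1_pos[OF s0])
      moreover have "\<Lambda> * (1 - r) * exp (u t) \<le> \<Lambda> * (1 - r)"
        using L0 r \<open>exp (u t) \<le> 1\<close> by (intro mult_left_le) auto
      ultimately show "(norm (P (cis t)) + \<Lambda> * (1 - r)) * exp (u t) \<le> 1 + \<Lambda> * (1 - r)"
        by (simp add: x_def distrib_right)
    qed simp
    finally show "norm (P z * outer_exp u z) \<le> (1 + \<Lambda> * (1 - r)) * exp (e + \<Lambda>\<^sup>2 / e * (1 - r\<^sup>2))" .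
  qed auto
  \<comment> \<open>The limits are taken in this order because the error contains (1 - r^2) / e:
    first r tends to 1 for fixed \<open>e\<close>, then \<open>e\<close> tends to 0.\<close>
  have e_bound: "norm (P z0 * outer_exp u z0) \<le> exp e" if e: "0 < e" for e
  proof (rule tendsto_lowerbound)
    show "((\<lambda>r. (1 + \<Lambda> * (1 - r)) * exp (e + \<Lambda>\<^sup>2 / e * (1 - r\<^sup>2))) \<longlongrightarrow> exp e) (at_left 1)"
      by (rule tendsto_eq_intros refl | simp)+
    show "\<forall>\<^sub>F r in at_left 1. norm (P z0 * outer_exp u z0) \<le> (1 + \<Lambda> * (1 - r)) * exp (e + \<Lambda>\<^sup>2 / e * (1 - r\<^sup>2))"
      using eventually_at_left_real[OF z0] by eventually_elim (rule bound, use e in auto)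
  qed simp
  have "norm (P z0 * outer_exp u z0) \<le> exp 0"
  proof (rule tendsto_lowerbound)
    show "(exp \<longlongrightarrow> exp (0::real)) (at_right 0)"
      by (intro tendsto_intros)
    show "\<forall>\<^sub>F e in at_right 0. norm (P z0 * outer_exp u z0) \<le> exp e"
      using eventually_at_right_less[of "0::real"] by eventually_elim (rule e_bound)
  qed simp
  then show ?thesis by simp
qed

section \<open>The pair attached to a series with one boundary singularity\<close>

lemma AE_circ_cis: "AE t in circ. cis t \<noteq> 1"
proof -
  have "AE t in lborel. t \<noteq> (0::real)" "AE t in lborel. t \<noteq> 2 * pi"
    by (rule AE_lborel_singleton)+
  then show ?thesis
    unfolding AE_circ
  proof eventually_elim
    fix t :: real assume t: "t \<noteq> 0" "t \<noteq> 2 * pi"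
    show "t \<in> {0..2 * pi} \<longrightarrow> cis t \<noteq> 1"
    proof (intro impI notI)
      assume "t \<in> {0..2 * pi}" "cis t = 1"
      then have "cos t = 1" by (simp add: complex_eq_iff)
      then obtain n :: int where n: "t = n * 2 * pi" by (auto simp: cos_one_2pi_int)
      then have "real_of_int n = t / (2 * pi)" by simp
      moreover have "0 \<le> t / (2 * pi)" "t / (2 * pi) \<le> 1"
        using \<open>t \<in> _\<close> by (auto simp: divide_le_eq)
      ultimately have "0 \<le> n" "n \<le> 1" by linarith+
      then have "n = 0 \<or> n = 1" by auto
      with n t show False by auto
    qed
  qed
qed

text \<open>\<open>locB\<close> confines the singularity to the point 1: near every other point of
  the closed disc the blocks and their Lipschitz constants have a common summable majorant.
  \<open>lipB\<close> may depend on k, as it serves finite partial sums, and \<open>L1B\<close>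
  makes the logarithm of the outer modulus integrable and dominates the passage to the full
  series.\<close>

locale block_series =
  fixes B :: "nat \<Rightarrow> complex \<Rightarrow> complex"
  assumes holB: "\<And>k. B k holomorphic_on UNIV"
    and lipB: "\<And>k. \<exists>\<Lambda>. \<forall>z w. norm z \<le> 1 \<longrightarrow> norm w \<le> 1 \<longrightarrow> norm (B k z - B k w) \<le> \<Lambda> * norm (z - w)"
    and locB: "\<And>\<zeta>. norm \<zeta> \<le> 1 \<Longrightarrow> \<zeta> \<noteq> 1 \<Longrightarrow> \<exists>\<delta> M. 0 < \<delta> \<and> summable M \<and>
       (\<forall>k z w. norm z \<le> 1 \<longrightarrow> norm w \<le> 1 \<longrightarrow> norm (z - \<zeta>) < \<delta> \<longrightarrow> norm (w - \<zeta>) < \<delta> \<longrightarrow>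
          norm (B k z) \<le> M k \<and> norm (B k z - B k w) \<le> M k * norm (z - w))"
    and L1B: "summable (\<lambda>k. (LINT t|circ. norm (B k (cis t))))"
begin

definition \<phi> :: "complex \<Rightarrow> complex" where "\<phi> z = (\<Sum>k. B k z)"

definition u :: "real \<Rightarrow> real" where "u t = - (1/2 * ln (1 + (norm (\<phi> (cis t)))\<^sup>2))"

definition a :: "complex \<Rightarrow> complex" where "a = outer_exp u"

definition b :: "complex \<Rightarrow> complex" where "b z = \<phi> z * a z"

lemma contB: "continuous_on UNIV (B k)"
  using holB by (rule holomorphic_on_imp_continuous_on)

lemma contB_cis: "continuous_on UNIV (\<lambda>t. B k (cis t))"
  by (rule continuous_on_compose2[OF contB]) (auto intro: continuous_intros)

lemma summable_norm_B: "norm z \<le> 1 \<Longrightarrow> z \<noteq> 1 \<Longrightarrow> summable (\<lambda>k. norm (B k z))"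
proof -
  assume z: "norm z \<le> 1" "z \<noteq> 1"
  from locB[OF this] obtain d M where "0 < d" "summable M" and
    M: "\<forall>k y w. norm y \<le> 1 \<longrightarrow> norm w \<le> 1 \<longrightarrow> norm (y - z) < d \<longrightarrow> norm (w - z) < d \<longrightarrow>
          norm (B k y) \<le> M k \<and> norm (B k y - B k w) \<le> M k * norm (y - w)" by blast
  have "norm (B k z) \<le> M k" for k
    using M[rule_format, of z z k] z \<open>0 < d\<close> by simp
  then show ?thesis
    by (intro summable_comparison_test[OF _ \<open>summable M\<close>]) auto
qed

lemma B_sums: "norm z \<le> 1 \<Longrightarrow> z \<noteq> 1 \<Longrightarrow> (\<lambda>k. B k z) sums \<phi> z"
  unfolding \<phi>_def by (intro summable_sums summable_norm_cancel[OF summable_norm_B])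

lemma phi_local_lipschitz:
  assumes "norm \<zeta> \<le> 1" "\<zeta> \<noteq> 1"
  shows "\<exists>\<delta> C. 0 < \<delta> \<and> 0 \<le> C \<and> (\<forall>z. norm z \<le> 1 \<longrightarrow> norm (z - \<zeta>) < \<delta> \<longrightarrow> norm (\<phi> z - \<phi> \<zeta>) \<le> C * norm (z - \<zeta>))"
proof -
  from locB[OF assms] obtain d0 M where d0: "0 < d0" and M: "summable M" and
    bd: "\<forall>k y w. norm y \<le> 1 \<longrightarrow> norm w \<le> 1 \<longrightarrow> norm (y - \<zeta>) < d0 \<longrightarrow> norm (w - \<zeta>) < d0 \<longrightarrow>
          norm (B k y) \<le> M k \<and> norm (B k y - B k w) \<le> M k * norm (y - w)" by blast
  \<comment> \<open>The second bound keeps the ball away from 1, where the series is not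
    controlled.\<close>
  define d where "d = min d0 (norm (1 - \<zeta>))"
  have d: "0 < d" "d \<le> d0" using d0 assms by (auto simp: d_def)
  have M0: "0 \<le> M k" for k
    using bd[rule_format, of \<zeta> \<zeta> k] assms d0 by (intro order_trans[OF norm_ge_zero[of "B k \<zeta>"]]) simp
  have "norm (\<phi> z - \<phi> \<zeta>) \<le> suminf M * norm (z - \<zeta>)" if z: "norm z \<le> 1" "norm (z - \<zeta>) < d" for z
  proof -
    have "z \<noteq> 1" using z by (auto simp: d_def)
    have s: "(\<lambda>k. B k z - B k \<zeta>) sums (\<phi> z - \<phi> \<zeta>)"
      by (intro sums_diff B_sums z assms \<open>z \<noteq> 1\<close>)
    have le: "norm (B k z - B k \<zeta>) \<le> M k * norm (z - \<zeta>)" for k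
      using bd[rule_format, of z \<zeta> k] z assms d d0 by simp
    have sM: "summable (\<lambda>k. M k * norm (z - \<zeta>))" by (intro summable_mult2 M)
    have sn: "summable (\<lambda>k. norm (B k z - B k \<zeta>))"
      by (rule summable_comparison_test[OF _ sM]) (use le in auto)
    have "norm (\<phi> z - \<phi> \<zeta>) \<le> (\<Sum>k. norm (B k z - B k \<zeta>))"
      using summable_norm[OF sn] s by (simp add: sums_iff)
    also have "\<dots> \<le> (\<Sum>k. M k * norm (z - \<zeta>))" by (intro suminf_le le sn sM)
    also have "\<dots> = suminf M * norm (z - \<zeta>)" by (rule suminf_mult2[symmetric, OF M])
    finally show ?thesis .
  qed
  then show ?thesis using d M0 suminf_nonneg[OF M] by blast
qed

lemma holomorphic_phi: "\<phi> holomorphic_on unit_disc"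
proof -
  have "\<exists>g. \<forall>x\<in>unit_disc. ((\<lambda>n. B n x) sums g x) \<and> g field_differentiable (at x)"
  proof (rule series_differentiable_comparison_complex)
    show "open unit_disc" by simp
    show "B n field_differentiable at x" for n x
      using holB[of n] by (simp add: holomorphic_on_def)
    fix x :: complex assume "x \<in> unit_disc"
    then have x: "norm x \<le> 1" "x \<noteq> 1" by auto
    from locB[OF this] obtain d M where d: "0 < d" and M: "summable M" and
      bd: "\<forall>k y w. norm y \<le> 1 \<longrightarrow> norm w \<le> 1 \<longrightarrow> norm (y - x) < d \<longrightarrow> norm (w - x) < d \<longrightarrow>
          norm (B k y) \<le> M k \<and> norm (B k y - B k w) \<le> M k * norm (y - w)" by blast
    have le: "norm (B n y) \<le> M n" if "y \<in> ball x d \<inter> unit_disc" for y n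
      using bd[rule_format, of y y n] that by (auto simp: dist_norm norm_minus_commute)
    have M0: "0 \<le> M n" for n
      using bd[rule_format, of x x n] x d by (intro order_trans[OF norm_ge_zero[of "B n x"]]) simp
    show "\<exists>d h. 0 < d \<and> summable h \<and> range h \<subseteq> \<real>\<^sub>\<ge>\<^sub>0 \<and>
        (\<forall>\<^sub>F n in sequentially. \<forall>y\<in>ball x d \<inter> unit_disc. cmod (B n y) \<le> cmod (h n))"
      using d M M0 le by (intro exI[of _ d] exI[of _ "\<lambda>n. complex_of_real (M n)"])
        (auto simp: summable_of_real)
  qed blast
  then obtain g where g: "\<And>x. x \<in> unit_disc \<Longrightarrow> (\<lambda>n. B n x) sums g x" "\<And>x. x \<in> unit_disc \<Longrightarrow> g field_differentiable (at x)"
    by blast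
  have ghol: "g holomorphic_on unit_disc"
    unfolding holomorphic_on_def by (rule ballI, rule field_differentiable_at_within, rule g(2))
  have "g x = \<phi> x" if "x \<in> unit_disc" for x
    using g(1)[OF that] by (simp add: \<phi>_def sums_iff)
  then show ?thesis by (rule holomorphic_transform[OF ghol])
qed

lemma integrable_abs_sum:
  "integrable circ (\<lambda>t. \<Sum>k. norm (B k (cis t)))" "integrable circ (\<lambda>t. \<phi> (cis t))"
proof -
  have i: "integrable circ (\<lambda>t. B k (cis t))" for k
    by (intro integrable_continuous_circ contB_cis)
  have ae: "AE t in circ. summable (\<lambda>k. norm (B k (cis t)))"
    using AE_circ_cis by eventually_elim (rule summable_norm_B, auto)
  show "integrable circ (\<lambda>t. \<phi> (cis t))"
    unfolding \<phi>_def by (rule integrable_suminf[OF i ae L1B])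
  show "integrable circ (\<lambda>t. \<Sum>k. norm (B k (cis t)))"
    by (rule integrable_suminf) (use i ae L1B in auto)
qed

lemma u_nonpos: "u t \<le> 0"
  by (simp add: u_def)

lemma abs_u_le: "\<bar>u t\<bar> \<le> norm (\<phi> (cis t))"
  unfolding u_def using ln_sqrt_lipschitz[of "norm (\<phi> (cis t))" 0] by simp

lemma exp_u: "exp (2 * u t) = 1 / (1 + (norm (\<phi> (cis t)))\<^sup>2)"
  by (simp add: u_def exp_minus add_pos_nonneg inverse_eq_divide)

lemma phi_cis_measurable: "(\<lambda>t. \<phi> (cis t)) \<in> borel_measurable circ"
  by (rule borel_measurable_integrable[OF integrable_abs_sum(2)])

lemma integrable_u: "integrable circ u"
proof (rule Bochner_Integration.integrable_bound[OF integrable_abs_sum(2)])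
  show "u \<in> borel_measurable circ"
    unfolding u_def[abs_def] using phi_cis_measurable by measurable
qed (simp add: abs_u_le)

lemma contractive_a: "contractive a"
  unfolding a_def by (rule contractive_outer_exp[OF integrable_u u_nonpos])

lemma phi_partial_tendsto:
  "norm z \<le> 1 \<Longrightarrow> z \<noteq> 1 \<Longrightarrow> (\<lambda>K. \<Sum>k<K. B k z) \<longlonglongrightarrow> \<phi> z"
  using B_sums by (simp add: sums_def)

text \<open>\<phi> may be unbounded near 1, so the maximum principle is applied to partial sums
  instead. Each is Lipschitz on the closed disc and is paired with its own outer function through
  \<open>outer_majorant_lipschitz\<close>; the bound 1 survives the limit.\<close>

lemma contractive_b: "contractive b"
  unfolding contractive_def
proof (intro conjI ballI)
  show "b holomorphic_on unit_disc"
    unfolding b_def[abs_def] using contractive_a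
    by (intro holomorphic_intros holomorphic_phi) (simp add: contractive_def)
  fix z assume "z \<in> unit_disc"
  then have z: "norm z < 1" by simp
  define P where "P = (\<lambda>K z. \<Sum>k<K. B k z)"
  define v where "v = (\<lambda>K t. - (1/2 * ln (1 + (norm (P K (cis t)))\<^sup>2)))"
  have contP: "continuous_on UNIV (\<lambda>t. P K (cis t))" for K
    unfolding P_def by (intro continuous_intros contB_cis)
  have one: "1 + (norm x)\<^sup>2 \<noteq> 0" for x :: complex
    using zero_le_power2[of "norm x"] by linarith
  have "continuous_on UNIV (v K)" for K
    unfolding v_def by (intro continuous_intros contP) (simp add: one)
  then have v: "integrable circ (v K)" for K
    by (rule integrable_continuous_circ)
  have le1: "norm (P K z * outer_exp (v K) z) \<le> 1" for K
  proof -
    obtain \<Lambda> where \<Lambda>: "\<And>k z w. norm z \<le> 1 \<Longrightarrow> norm w \<le> 1 \<Longrightarrow> norm (B k z - B k w) \<le> \<Lambda> k * norm (z - w)"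
      using lipB by metis
    show ?thesis
    proof (rule outer_majorant_lipschitz[where P = "P K" and \<Lambda> = "\<Sum>k<K. \<Lambda> k" and u = "v K"])
      show "P K holomorphic_on unit_disc"
        unfolding P_def using holB by (intro holomorphic_intros) (auto intro: holomorphic_on_subset)
      fix x y :: complex assume "norm x \<le> 1" "norm y \<le> 1"
      then have "norm (\<Sum>k<K. B k x - B k y) \<le> (\<Sum>k<K. \<Lambda> k * norm (x - y))"
        by (intro sum_norm_le \<Lambda>)
      then show "norm (P K x - P K y) \<le> (\<Sum>k<K. \<Lambda> k) * norm (x - y)"
        by (simp add: P_def sum_subtractf sum_distrib_right)
    qed (simp_all only: v_def v[unfolded v_def] z)
  qed
  \<comment> \<open>The logarithm \<open>v K\<close> is at most |P K| in modulus, hence at most the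
    sum of all block moduli, which is integrable by \<open>L1B\<close>. The kernel is bounded by 2 /
    (1 - |z|) at the fixed point \<open>z\<close>.\<close>
  have "(\<lambda>K. (LINT t|circ. (cis t + z) / (cis t - z) * complex_of_real (v K t)))
     \<longlonglongrightarrow> (LINT t|circ. (cis t + z) / (cis t - z) * complex_of_real (u t))"
  proof (rule integral_dominated_convergence[where w = "\<lambda>t. 2 / (1 - norm z) * (\<Sum>k. norm (B k (cis t)))"])
    show "(\<lambda>t. (cis t + z) / (cis t - z) * complex_of_real (u t)) \<in> borel_measurable circ"
      by (rule borel_measurable_integrable[OF schwarz_series(2)[OF integrable_u z]])
    show "(\<lambda>t. (cis t + z) / (cis t - z) * complex_of_real (v K t)) \<in> borel_measurable circ" for K
      by (rule borel_measurable_integrable[OF schwarz_series(2)[OF v z]])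
    show "integrable circ (\<lambda>t. 2 / (1 - norm z) * (\<Sum>k. norm (B k (cis t))))"
      by (intro integrable_mult_right integrable_abs_sum)
    show "AE t in circ. (\<lambda>K. (cis t + z) / (cis t - z) * complex_of_real (v K t)) \<longlonglongrightarrow>
        (cis t + z) / (cis t - z) * complex_of_real (u t)"
      using AE_circ_cis
    proof eventually_elim
      fix t assume t: "cis t \<noteq> 1"
      have "(\<lambda>K. P K (cis t)) \<longlonglongrightarrow> \<phi> (cis t)"
        unfolding P_def by (rule phi_partial_tendsto) (use t in auto)
      then show "(\<lambda>K. (cis t + z) / (cis t - z) * complex_of_real (v K t)) \<longlonglongrightarrow>
        (cis t + z) / (cis t - z) * complex_of_real (u t)"
        unfolding v_def u_def by (intro tendsto_intros) (auto simp: one)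
    qed
    show "AE t in circ. norm ((cis t + z) / (cis t - z) * complex_of_real (v K t)) \<le> 2 / (1 - norm z) * (\<Sum>k. norm (B k (cis t)))" for K
      using AE_circ_cis
    proof eventually_elim
      fix t assume t: "cis t \<noteq> 1"
      have "norm (complex_of_real (v K t)) \<le> norm (P K (cis t))"
        unfolding v_def using ln_sqrt_lipschitz[of "norm (P K (cis t))" 0] by simp
      also have "\<dots> \<le> (\<Sum>k<K. norm (B k (cis t)))" unfolding P_def by (rule norm_sum)
      also have "\<dots> \<le> (\<Sum>k. norm (B k (cis t)))"
        by (intro sum_le_suminf summable_norm_B) (use t in auto)
      finally have 1: "norm (complex_of_real (v K t)) \<le> (\<Sum>k. norm (B k (cis t)))" .
      have "norm (cis t + z) \<le> 2" using norm_triangle_ineq[of "cis t" z] z by simp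
      moreover have "1 - norm z \<le> norm (cis t - z)" using norm_triangle_ineq2[of "cis t" z] by simp
      ultimately have "norm ((cis t + z) / (cis t - z)) \<le> 2 / (1 - norm z)"
        unfolding norm_divide using z by (intro frac_le) auto
      then show "norm ((cis t + z) / (cis t - z) * complex_of_real (v K t)) \<le> 2 / (1 - norm z) * (\<Sum>k. norm (B k (cis t)))"
        unfolding norm_mult using 1 z by (intro mult_mono) auto
    qed
  qed
  then have "(\<lambda>K. schwarz (v K) z) \<longlonglongrightarrow> schwarz u z"
    unfolding schwarz_def by (intro tendsto_intros)
  then have "(\<lambda>K. norm (P K z * outer_exp (v K) z)) \<longlonglongrightarrow> norm (\<phi> z * outer_exp u z)"
    unfolding outer_exp_def P_def using z by (intro tendsto_intros phi_partial_tendsto) auto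
  then have "norm (\<phi> z * outer_exp u z) \<le> 1"
    by (rule tendsto_upperbound) (auto simp: le1)
  then show "norm (b z) \<le> 1" by (simp add: b_def a_def)
qed

lemma radial_limits:
  assumes t0: "cis t0 \<noteq> 1"
  shows "\<exists>\<alpha>. has_radial_limit a t0 \<alpha> \<and> has_radial_limit b t0 (\<phi> (cis t0) * \<alpha>) \<and> norm \<alpha> = exp (u t0)"
proof -
  obtain d C where d: "0 < d" and C: "0 \<le> C" and
    lip: "\<And>z. norm z \<le> 1 \<Longrightarrow> norm (z - cis t0) < d \<Longrightarrow> norm (\<phi> z - \<phi> (cis t0)) \<le> C * norm (z - cis t0)"
    using phi_local_lipschitz[of "cis t0"] t0 by auto
  \<comment> \<open>Within distance \<open>d\<close> the local Lipschitz constant \<open>C\<close>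
    is used; farther away the trivial bound on the difference is divided by
    \<open>d\<close>.\<close>
  define w where "w = (\<lambda>t. C + (\<bar>u t\<bar> + \<bar>u t0\<bar>) / d)"
  have "\<exists>l. has_radial_limit (schwarz u) t0 l \<and> Re l = u t0"
  proof (rule schwarz_radial_limit[OF integrable_u])
    show "integrable circ w"
      unfolding w_def using integrable_u
      by (intro Bochner_Integration.integrable_add integrable_divide_zero integrable_abs) auto
    show w0: "0 \<le> w t" for t using C d by (simp add: w_def)
    fix t
    show "\<bar>u t - u t0\<bar> \<le> norm (cis t - cis t0) * w t"
    proof (cases "norm (cis t - cis t0) < d")
      case True
      have "\<bar>u t - u t0\<bar> \<le> \<bar>norm (\<phi> (cis t)) - norm (\<phi> (cis t0))\<bar>"
        unfolding u_def using ln_sqrt_lipschitz[of "norm (\<phi> (cis t))" "norm (\<phi> (cis t0))"] by simp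
      also have "\<dots> \<le> norm (\<phi> (cis t) - \<phi> (cis t0))" by (rule norm_triangle_ineq3)
      also have "\<dots> \<le> C * norm (cis t - cis t0)" using True by (intro lip) auto
      also have "\<dots> \<le> norm (cis t - cis t0) * w t"
        unfolding w_def using d by (subst mult.commute) (intro mult_left_mono, auto)
      finally show ?thesis .
    next
      case False
      have "\<bar>u t - u t0\<bar> \<le> d * ((\<bar>u t\<bar> + \<bar>u t0\<bar>) / d)" using d by simp
      also have "\<dots> \<le> norm (cis t - cis t0) * w t"
        using False d C by (intro mult_mono) (auto simp: w_def)
      finally show ?thesis .
    qed
  qed
  then obtain l where l: "has_radial_limit (schwarz u) t0 l" "Re l = u t0" by blast
  have a: "has_radial_limit a t0 (exp l)"
    using l(1) unfolding has_radial_limit_def a_def outer_exp_def by (rule tendsto_exp)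
  have z: "((\<lambda>r. complex_of_real r * cis t0) \<longlongrightarrow> cis t0) (at_left 1)"
    by (rule tendsto_eq_intros refl | simp)+
  have "has_radial_limit \<phi> t0 (\<phi> (cis t0))"
    unfolding has_radial_limit_def
  proof (rule LIM_zero_cancel, rule Lim_null_comparison)
    show "((\<lambda>r. C * norm (complex_of_real r * cis t0 - cis t0)) \<longlongrightarrow> 0) (at_left 1)"
      by (rule tendsto_eq_intros z refl | simp)+
    have "\<forall>\<^sub>F r in at_left 1. norm (complex_of_real r * cis t0 - cis t0) < d"
      using tendstoD[OF z d] by (simp add: dist_norm)
    then show "\<forall>\<^sub>F r in at_left 1. norm (\<phi> (complex_of_real r * cis t0) - \<phi> (cis t0)) \<le> C * norm (complex_of_real r * cis t0 - cis t0)"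
      using eventually_at_left_real[OF zero_less_one]
      by eventually_elim (rule lip, auto simp: norm_mult)
  qed
  then have "has_radial_limit b t0 (\<phi> (cis t0) * exp l)"
    unfolding b_def[abs_def] using a by (rule has_radial_limit_mult)
  moreover have "norm (exp l) = exp (u t0)" by (simp add: l(2))
  ultimately show ?thesis using a by blast
qed

lemma boundary_identity:
  "AE t in circ. \<exists>\<beta> \<alpha>. has_radial_limit b t \<beta> \<and> has_radial_limit a t \<alpha> \<and> (norm \<beta>)\<^sup>2 + (norm \<alpha>)\<^sup>2 = 1"
  using AE_circ_cis
proof eventually_elim
  fix t assume "cis t \<noteq> 1"
  from radial_limits[OF this] obtain \<alpha> where \<alpha>: "has_radial_limit a t \<alpha>"
    "has_radial_limit b t (\<phi> (cis t) * \<alpha>)" "norm \<alpha> = exp (u t)" by blast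
  have "(norm (\<phi> (cis t) * \<alpha>))\<^sup>2 + (norm \<alpha>)\<^sup>2 = (1 + (norm (\<phi> (cis t)))\<^sup>2) * exp (2 * u t)"
    by (simp add: norm_mult \<alpha>(3) power_mult_distrib algebra_simps exp_double)
  also have "\<dots> = 1"
    unfolding exp_u using zero_le_power2[of "norm (\<phi> (cis t))"] by (simp add: add_nonneg_eq_0_iff)
  finally show "\<exists>\<beta> \<alpha>. has_radial_limit b t \<beta> \<and> has_radial_limit a t \<alpha> \<and> (norm \<beta>)\<^sup>2 + (norm \<alpha>)\<^sup>2 = 1"
    using \<alpha> by blast
qed

sublocale pyth_pair a b
proof
  show "contractive a" by (rule contractive_a)
  show "contractive b" by (rule contractive_b)
  show "AE t in circ. \<exists>\<beta> \<alpha>. has_radial_limit b t \<beta> \<and> has_radial_limit a t \<alpha> \<and> (norm \<beta>)\<^sup>2 + (norm \<alpha>)\<^sup>2 = 1"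
    by (rule boundary_identity)
  show "g = 0" if "\<And>x. cip g (mult_op a x) = 0" for g
    using outer_exp_cyclic[OF integrable_u u_nonpos] that by (simp add: a_def)
qed

lemma pythagorean: "pythagorean_pair b a"
  unfolding pythagorean_pair_def
proof (intro conjI)
  have "c \<in> hardy_infinity" if "contractive c" for c
    using that unfolding hardy_infinity_def contractive_def bounded_iff by auto
  then show "b \<in> hardy_infinity" "a \<in> hardy_infinity"
    using contractive_a contractive_b by auto
  show "AE t in lborel. t \<in> {0..2 * pi} \<longrightarrow>
        (\<exists>\<beta> \<alpha>. has_radial_limit b t \<beta> \<and> has_radial_limit a t \<alpha> \<and> (norm \<beta>)\<^sup>2 + (norm \<alpha>)\<^sup>2 = 1)"
    using boundary_identity unfolding AE_circ .
  show "outer_function a"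
    unfolding outer_function_def
    by (intro exI[of _ 1] exI[of _ u])
       (simp add: set_integrable_circ integrable_u set_integral_circ a_def outer_exp_def schwarz_def)
  have "a 0 = complex_of_real (exp (integral\<^sup>L circ u / (2 * pi)))"
    unfolding a_def outer_exp_def schwarz_zero by (rule exp_of_real)
  then show "a 0 \<in> \<real>" "Re (a 0) > 0" by simp_all
qed

lemma quotient: "b z / a z = \<phi> z"
  by (simp add: b_def a_def)

text \<open>Here the weight enters: |a|^2 = exp (2 u) = 1 / (1 + |\<phi>|^2) in the radial limit. As
  \<open>Q\<close> is bounded on the closed disc, dominated convergence matches the limit of the
  means with the one in \<open>radial_cip\<close>.\<close>

lemma norm_mult_op_boundary:
  assumes Q: "Q holomorphic_on UNIV" and x: "\<And>z. norm z < 1 \<Longrightarrow> ev x z = Q z"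
  shows "(norm (mult_op a x))\<^sup>2 = (LINT t|circ. (norm (Q (cis t)))\<^sup>2 / (1 + (norm (\<phi> (cis t)))\<^sup>2)) / (2 * pi)"
proof -
  have contQ: "continuous_on UNIV Q" using Q by (rule holomorphic_on_imp_continuous_on)
  have in_disc: "norm (rad k * cis t) < 1" for k t
    using rad(1,2)[of k] by (simp add: norm_mult)
  have "compact (Q ` cball 0 1)"
    by (intro compact_continuous_image continuous_on_subset[OF contQ]) auto
  then have "bounded (Q ` cball 0 1)" by (rule compact_imp_bounded)
  then obtain K where "\<forall>x\<in>Q ` cball 0 1. norm x \<le> K"
    unfolding bounded_iff ..
  then have K: "norm (Q z) \<le> K" if "norm z \<le> 1" for z
    using that by simp
  define F where "F = (\<lambda>k t. (norm (a (rad k * cis t) * Q (rad k * cis t)))\<^sup>2)"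
  have "(\<lambda>k. integral\<^sup>L circ (F k)) \<longlonglongrightarrow> (LINT t|circ. (norm (Q (cis t)))\<^sup>2 / (1 + (norm (\<phi> (cis t)))\<^sup>2))"
  proof (rule integral_dominated_convergence[where w = "\<lambda>_. K\<^sup>2"])
    have "(\<lambda>t. Q (cis t)) \<in> borel_measurable circ"
      by (intro borel_measurable_circ borel_measurable_continuous_onI continuous_on_compose2[OF contQ]) (auto intro: continuous_intros)
    then show "(\<lambda>t. (norm (Q (cis t)))\<^sup>2 / (1 + (norm (\<phi> (cis t)))\<^sup>2)) \<in> borel_measurable circ"
      using phi_cis_measurable by measurable
    show "F k \<in> borel_measurable circ" for k
      unfolding F_def using contractive_a rad(1,2)[of k]
      by (intro borel_measurable_circ borel_measurable_continuous_onI continuous_intros continuous_on_circle_radius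
          continuous_on_compose2[OF contQ]) (auto simp: contractive_def)
    show "integrable circ (\<lambda>_. K\<^sup>2)" by simp
    show "AE t in circ. norm (F k t) \<le> K\<^sup>2" for k
    proof (rule AE_I2)
      fix t
      have "norm (a (rad k * cis t)) \<le> 1" using contractive_a in_disc[of k t] by (auto simp: contractive_def)
      then have "norm (a (rad k * cis t) * Q (rad k * cis t)) \<le> 1 * K"
        unfolding norm_mult using in_disc[of k t] by (intro mult_mono K) auto
      then have "(norm (a (rad k * cis t) * Q (rad k * cis t)))\<^sup>2 \<le> K\<^sup>2"
        by (intro power_mono) auto
      then show "norm (F k t) \<le> K\<^sup>2" by (simp add: F_def)
    qed
    show "AE t in circ. (\<lambda>k. F k t) \<longlonglongrightarrow> (norm (Q (cis t)))\<^sup>2 / (1 + (norm (\<phi> (cis t)))\<^sup>2)"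
      using AE_circ_cis
    proof eventually_elim
      fix t assume "cis t \<noteq> 1"
      from radial_limits[OF this] obtain \<alpha> where \<alpha>: "has_radial_limit a t \<alpha>" "norm \<alpha> = exp (u t)" by blast
      have z: "(\<lambda>k. rad k * cis t) \<longlonglongrightarrow> cis t"
        using tendsto_mult[OF tendsto_of_real[OF rad_tendsto] tendsto_const[of "cis t"]] by simp
      have "isCont Q (cis t)" using contQ by (simp add: continuous_on_eq_continuous_at)
      then have Qt: "(\<lambda>k. Q (rad k * cis t)) \<longlonglongrightarrow> Q (cis t)"
        using z by (rule isCont_tendsto_compose)
      have "(\<lambda>k. F k t) \<longlonglongrightarrow> (norm (\<alpha> * Q (cis t)))\<^sup>2"
        unfolding F_def by (intro tendsto_intros has_radial_limit_rad[OF \<alpha>(1)] Qt)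
      also have "(norm (\<alpha> * Q (cis t)))\<^sup>2 = (norm (Q (cis t)))\<^sup>2 * exp (2 * u t)"
        by (simp add: norm_mult \<alpha>(2) power_mult_distrib exp_double)
      finally show "(\<lambda>k. F k t) \<longlonglongrightarrow> (norm (Q (cis t)))\<^sup>2 / (1 + (norm (\<phi> (cis t)))\<^sup>2)"
        by (simp add: exp_u)
    qed
  qed
  then have "(\<lambda>k. complex_of_real (integral\<^sup>L circ (F k) / (2 * pi))) \<longlonglongrightarrow>
      complex_of_real ((LINT t|circ. (norm (Q (cis t)))\<^sup>2 / (1 + (norm (\<phi> (cis t)))\<^sup>2)) / (2 * pi))"
    by (intro tendsto_intros) auto
  moreover have "complex_of_real (integral\<^sup>L circ (F k) / (2 * pi))
    = (LINT t|circ. ev (mult_op a x) (rad k * cis t) * cnj (ev (mult_op a x) (rad k * cis t))) / (2 * pi)" for k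
    unfolding F_def ev_mult_op[OF contractive_a in_disc] x[OF in_disc]
    by (simp only: complex_norm_square[symmetric] integral_complex_of_real of_real_divide)
  ultimately have "cip (mult_op a x) (mult_op a x)
     = complex_of_real ((LINT t|circ. (norm (Q (cis t)))\<^sup>2 / (1 + (norm (\<phi> (cis t)))\<^sup>2)) / (2 * pi))"
    using radial_cip[of "mult_op a x" "mult_op a x"] by (simp only:) (rule LIMSEQ_unique)
  then show ?thesis unfolding cip_self_norm by (simp only: of_real_eq_iff)
qed

text \<open>The weights \<open>4 ^ (k + 1)\<close> allow p-th powers of sums to be estimated
  termwise for all p \<le> 2 at once, because (2^(k+1))^p \<le> 4^(k+1). Smaller exponents q follow
  from x^q \<le> 1 + x^p and the finite mass of the circle.\<close>

lemma phi_hardy: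
  assumes p: "0 < p" "p \<le> 2" and m: "summable m"
    and le: "\<And>k r. 0 \<le> r \<Longrightarrow> r < 1 \<Longrightarrow>
       4 ^ (k + 1) * (LINT t|circ. norm (B k (complex_of_real r * cis t)) powr p) \<le> m k"
    and q: "0 < q" "q \<le> p"
  shows "\<phi> \<in> hardy_space q"
proof -
  have m0: "0 \<le> m k" for k
    using le[of 0 k] by (rule order_trans[rotated]) (auto intro!: mult_nonneg_nonneg integral_nonneg_AE)
  \<comment> \<open>the largest of the numbers \<open>2 ^ (k + 1) * norm (y k)\<close> bounds the norm of the sum\<close>
  have partial: "norm (\<Sum>k<K. y k) powr p \<le> (\<Sum>k<K. 4 ^ (k + 1) * norm (y k) powr p)" for K and y :: "nat \<Rightarrow> complex"
  proof (cases "K = 0")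
    case False
    define M where "M = Max ((\<lambda>k. 2 ^ (k + 1) * norm (y k)) ` {..<K})"
    have "M \<in> (\<lambda>k. 2 ^ (k + 1) * norm (y k)) ` {..<K}"
      unfolding M_def using False by (intro Max_in) auto
    then obtain j where j: "j < K" "M = 2 ^ (j + 1) * norm (y j)" by auto
    have "norm (\<Sum>k<K. y k) \<le> (\<Sum>k<K. (1 / 2) ^ (k + 1) * M)"
    proof (rule sum_norm_le)
      fix k assume "k \<in> {..<K}"
      then have "2 ^ (k + 1) * norm (y k) \<le> M" unfolding M_def by (intro Max_ge) auto
      then show "norm (y k) \<le> (1 / 2) ^ (k + 1) * M" by (simp add: field_simps)
    qed
    also have "\<dots> = (1 - (1 / 2) ^ K) * M"
      by (induction K) (simp_all add: field_simps)
    also have "\<dots> \<le> M" using j by (intro mult_left_le_one_le) (auto simp: power_le_one)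
    finally have "norm (\<Sum>k<K. y k) powr p \<le> (2 ^ (j + 1) * norm (y j)) powr p"
      using p by (intro powr_mono2) (auto simp: j)
    also have "\<dots> = (2 ^ (j + 1)) powr p * norm (y j) powr p" by (simp add: powr_mult)
    also have "\<dots> \<le> 4 ^ (j + 1) * norm (y j) powr p"
    proof (rule mult_right_mono)
      have "(2 ^ (j + 1)) powr p \<le> (2 ^ (j + 1) :: real) powr 2"
        using p by (intro powr_mono one_le_power) auto
      also have "\<dots> = (2 ^ (j + 1))\<^sup>2" by simp
      also have "\<dots> = (2\<^sup>2) ^ (j + 1)" by (simp only: power_mult[symmetric] mult.commute)
      also have "\<dots> = 4 ^ (j + 1)" by simp
      finally show "(2 ^ (j + 1)) powr p \<le> (4 ^ (j + 1) :: real)" .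
    qed simp
    also have "\<dots> \<le> (\<Sum>k<K. 4 ^ (k + 1) * norm (y k) powr p)"
      using j by (intro member_le_sum) auto
    finally show ?thesis .
  qed simp
  have main: "(LINT t|circ. norm (\<phi> (complex_of_real r * cis t)) powr p) \<le> suminf m"
    and int: "integrable circ (\<lambda>t. norm (\<phi> (complex_of_real r * cis t)) powr p)"
    and int': "integrable circ (\<lambda>t. norm (\<phi> (complex_of_real r * cis t)) powr q)"
    if r: "0 \<le> r" "r < 1" for r
  proof -
    define z where "z = (\<lambda>t. complex_of_real r * cis t)"
    have nz: "norm (z t) = r" for t
      using r by (simp add: z_def norm_mult)
    have z: "norm (z t) \<le> 1" "z t \<noteq> 1" for t
      using nz[of t] r by auto
    have contphi: "continuous_on UNIV (\<lambda>t. \<phi> (z t))"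
      unfolding z_def by (rule continuous_on_circle_radius[OF holomorphic_phi r])
    have contBz: "continuous_on UNIV (\<lambda>t. B k (z t))" for k
      by (rule continuous_on_compose2[OF contB]) (auto intro!: continuous_intros simp: z_def)
    have powr_int: "integrable circ (\<lambda>t. norm (f t) powr s)"
      if "continuous_on UNIV f" "0 < s" for f :: "real \<Rightarrow> complex" and s
      using that by (intro integrable_continuous_circ continuous_on_powr' continuous_intros) auto
    show int: "integrable circ (\<lambda>t. norm (\<phi> (complex_of_real r * cis t)) powr p)"
      using powr_int[OF contphi p(1)] by (simp add: z_def)
    show "integrable circ (\<lambda>t. norm (\<phi> (complex_of_real r * cis t)) powr q)"
      using powr_int[OF contphi q(1)] by (simp add: z_def)
    have iB: "integrable circ (\<lambda>t. 4 ^ (k + 1) * norm (B k (z t)) powr p)" for k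
      by (intro integrable_mult_right powr_int contBz p)
    \<comment> \<open>In \<open>ennreal\<close> the right-hand side may be infinite, so sum and
      integral can be interchanged before any convergence is settled.\<close>
    have pt: "ennreal (norm (\<phi> (z t)) powr p) \<le> (\<Sum>k. ennreal (4 ^ (k + 1) * norm (B k (z t)) powr p))" for t
    proof (rule tendsto_upperbound)
      show "(\<lambda>K. ennreal (norm (\<Sum>k<K. B k (z t)) powr p)) \<longlonglongrightarrow> ennreal (norm (\<phi> (z t)) powr p)"
        using p by (intro tendsto_ennrealI tendsto_powr' tendsto_norm phi_partial_tendsto z) auto
      have "ennreal (norm (\<Sum>k<K. B k (z t)) powr p) \<le> (\<Sum>k. ennreal (4 ^ (k + 1) * norm (B k (z t)) powr p))" for K
      proof -
        have "ennreal (norm (\<Sum>k<K. B k (z t)) powr p) \<le> ennreal (\<Sum>k<K. 4 ^ (k + 1) * norm (B k (z t)) powr p)"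
          by (intro ennreal_leI partial)
        also have "\<dots> = (\<Sum>k<K. ennreal (4 ^ (k + 1) * norm (B k (z t)) powr p))"
          by (subst sum_ennreal) auto
        also have "\<dots> \<le> (\<Sum>k. ennreal (4 ^ (k + 1) * norm (B k (z t)) powr p))"
          by (intro sum_le_suminf summableI) auto
        finally show ?thesis .
      qed
      then show "\<forall>\<^sub>F K in sequentially. ennreal (norm (\<Sum>k<K. B k (z t)) powr p)
          \<le> (\<Sum>k. ennreal (4 ^ (k + 1) * norm (B k (z t)) powr p))" by simp
    qed simp
    have "ennreal ((LINT t|circ. norm (\<phi> (z t)) powr p)) = (\<integral>\<^sup>+ t. ennreal (norm (\<phi> (z t)) powr p) \<partial>circ)"
      using powr_int[OF contphi p(1)] by (intro nn_integral_eq_integral[symmetric]) auto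
    also have "\<dots> \<le> (\<integral>\<^sup>+ t. (\<Sum>k. ennreal (4 ^ (k + 1) * norm (B k (z t)) powr p)) \<partial>circ)"
      by (intro nn_integral_mono pt)
    also have "\<dots> = (\<Sum>k. \<integral>\<^sup>+ t. ennreal (4 ^ (k + 1) * norm (B k (z t)) powr p) \<partial>circ)"
      by (intro nn_integral_suminf measurable_compose[OF borel_measurable_integrable[OF iB] measurable_ennreal])
    also have "\<dots> = (\<Sum>k. ennreal (4 ^ (k + 1) * (LINT t|circ. norm (B k (z t)) powr p)))"
      by (subst nn_integral_eq_integral[OF iB]) auto
    also have "\<dots> \<le> (\<Sum>k. ennreal (m k))"
      using le[OF r] by (intro suminf_le ennreal_leI summableI) (simp add: z_def)
    also have "\<dots> = ennreal (suminf m)" by (rule suminf_ennreal2[OF m0 m])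
    finally have "(LINT t|circ. norm (\<phi> (z t)) powr p) \<le> suminf m"
      using suminf_nonneg[OF m m0] by (simp add: ennreal_le_iff)
    then show "(LINT t|circ. norm (\<phi> (complex_of_real r * cis t)) powr p) \<le> suminf m"
      by (simp add: z_def)
  qed
  have "1 / (2 * pi) * (LBINT t:{0..2 * pi}. norm (\<phi> (complex_of_real r * cis t)) powr q)
      \<le> 1 / (2 * pi) * (2 * pi + suminf m)" if r: "0 \<le> r" "r < 1" for r
  proof (intro mult_left_mono)
    have le: "x powr q \<le> 1 + x powr p" if "0 \<le> x" for x :: real
    proof (cases "x \<le> 1")
      case True
      then have "x powr q \<le> 1" using q that powr_mono2[of q x 1] by simp
      then show ?thesis by (simp add: add_increasing2)
    next
      case False
      then have "x powr q \<le> x powr p" using q by (intro powr_mono) auto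
      then show ?thesis by simp
    qed
    have "(LINT t|circ. norm (\<phi> (complex_of_real r * cis t)) powr q)
       \<le> (LINT t|circ. 1 + norm (\<phi> (complex_of_real r * cis t)) powr p)"
      using int[OF r] int'[OF r] by (intro integral_mono le Bochner_Integration.integrable_add) auto
    also have "\<dots> = 2 * pi + (LINT t|circ. norm (\<phi> (complex_of_real r * cis t)) powr p)"
      using int[OF r] by (subst Bochner_Integration.integral_add) (auto simp: measure_circ)
    also have "\<dots> \<le> 2 * pi + suminf m" using main[OF r] by simp
    finally show "(LBINT t:{0..2 * pi}. norm (\<phi> (complex_of_real r * cis t)) powr q) \<le> 2 * pi + suminf m"
      by (simp add: set_integral_circ)
  qed simp
  then show ?thesis
    unfolding hardy_space_def
    by (intro CollectI conjI holomorphic_phi exI[of _ "1 / (2 * pi) * (2 * pi + suminf m)"] ballI)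
       (simp only: atLeastLessThan_iff)
qed

end

section \<open>A rapidly growing sequence of frequencies\<close>

text \<open>
  In the notation of the introduction the \<open>k\<close>-th block has \<open>r = k + 4\<close>, \<open>L = tower k\<close>, \<open>n = freq k\<close>,
  \<open>\<surd>n = sfreq k\<close>, \<open>c = peak k\<close> and maximum modulus at most \<open>amp k = 2\<^sup>r c\<close>.
\<close>

primrec tower :: "nat \<Rightarrow> nat" where
  "tower 0 = 20000000 * 9"
| "tower (Suc k) = 20000000 * 16 ^ Suc k * (Suc k * tower k ^ (4 * k + 12) + 3) ^ 2"

definition freq :: "nat \<Rightarrow> nat" where "freq k = tower k ^ (4 * k + 12)"

lemma tower_ge: "20000000 * 16 ^ k \<le> tower k"
proof (cases k)
  case (Suc m)
  have "20000000 * 16 ^ Suc m * 1 \<le> 20000000 * 16 ^ Suc m * (Suc m * tower m ^ (4 * m + 12) + 3) ^ 2"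
    by (intro mult_left_mono one_le_power) auto
  then show ?thesis using Suc by (simp only: tower.simps mult_1_right)
qed simp

lemma tower_pos: "0 < tower k"
  by (rule less_le_trans[OF _ tower_ge]) simp

lemma tower_le_freq: "tower k ^ 12 \<le> freq k" "tower k \<le> freq k"
proof -
  show "tower k ^ 12 \<le> freq k"
    unfolding freq_def using tower_pos[of k] by (intro power_increasing) auto
  show "tower k \<le> freq k"
    unfolding freq_def using tower_pos[of k] by (intro self_le_power) auto
qed

lemma freq_le_tower_Suc: "20000000 * freq k \<le> tower (Suc k)"
proof -
  have "freq k \<le> Suc k * freq k + 3" by simp
  also have "\<dots> \<le> (Suc k * freq k + 3) ^ 2" by (rule self_le_power) auto
  finally have "20000000 * 1 * freq k \<le> 20000000 * 16 ^ Suc k * (Suc k * freq k + 3) ^ 2"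
    by (intro mult_mono) auto
  then show ?thesis by (simp only: tower.simps freq_def mult_1_right)
qed

lemma tower_mono: "j \<le> k \<Longrightarrow> tower j \<le> tower k"
proof (rule lift_Suc_mono_le[of tower])
  show "tower n \<le> tower (Suc n)" for n
    using tower_le_freq(2)[of n] freq_le_tower_Suc[of n] by linarith
qed

lemma freq_le_tower: "k < j \<Longrightarrow> 20000000 * freq k \<le> tower j"
  using freq_le_tower_Suc[of k] tower_mono[of "Suc k" j] by linarith

lemma freq_mono: "j \<le> k \<Longrightarrow> freq j \<le> freq k"
proof (cases "j = k")
  case False
  assume "j \<le> k"
  then show ?thesis using False freq_le_tower[of j k] tower_le_freq(2)[of k] by linarith
qed simp

text \<open>This inequality dictates the recursion. With D the sum of the earlier frequencies, (D +
  3)^2 is the denominator that \<open>good_point\<close> has to beat, and 16^k is the growth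
  required at the end. For k = m + 1, D \<le> (m + 1) * \<open>freq m\<close> explains the product
  in the recursion; k = 0 gives the 9. The factor 20000000 is a generous margin over the numerical
  constants, such as 448 * 2 * pi and 1024.\<close>

lemma tower_ge_sum: "20000000 * 16 ^ k * ((\<Sum>j<k. freq j) + 3) ^ 2 \<le> tower k"
proof (cases k)
  case (Suc m)
  have "(\<Sum>j<Suc m. freq j) \<le> (\<Sum>j<Suc m. freq m)"
    by (intro sum_mono freq_mono) auto
  then have "(\<Sum>j<Suc m. freq j) + 3 \<le> Suc m * freq m + 3"
    by simp
  then have "20000000 * 16 ^ Suc m * ((\<Sum>j<Suc m. freq j) + 3) ^ 2
      \<le> 20000000 * 16 ^ Suc m * (Suc m * freq m + 3) ^ 2"
    by (intro mult_left_mono power_mono) auto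
  then show ?thesis unfolding Suc by (simp only: tower.simps freq_def)
qed simp

definition sfreq :: "nat \<Rightarrow> nat" where "sfreq k = tower k ^ (2 * k + 6)"

lemma freq_eq: "freq k = sfreq k ^ 2"
  by (simp add: freq_def sfreq_def algebra_simps flip: power_mult)

lemma sfreq_ge: "20000000 \<le> sfreq k"
proof -
  have "(20000000::nat) * 1 \<le> 20000000 * 16 ^ k" by (intro mult_left_mono) auto
  also have "\<dots> \<le> tower k" by (rule tower_ge)
  also have "\<dots> \<le> sfreq k" unfolding sfreq_def using tower_pos[of k] by (intro self_le_power) auto
  finally show ?thesis by simp
qed

definition amp :: "nat \<Rightarrow> real" where "amp k = (2 * real (tower k)) ^ (k + 4)"

text \<open>A crude bound that makes all growth polynomial in the frequency, so that the exponential
  decay of \<open>omega z ^ freq k\<close> away from 1 wins.\<close>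

lemma amp_le_freq: "amp k \<le> real (freq k)"
proof -
  have "2 \<le> real (tower k)"
    using order_trans[OF _ tower_ge[of k], of 2] by (simp add: mult_le_cancel_left)
  then have "2 * real (tower k) \<le> real (tower k) ^ 2" by (simp add: power2_eq_square)
  then have "amp k \<le> (real (tower k) ^ 2) ^ (k + 4)"
    unfolding amp_def by (intro power_mono) auto
  also have "\<dots> = real (tower k) ^ (2 * k + 8)" by (simp add: algebra_simps flip: power_mult)
  also have "\<dots> \<le> real (tower k) ^ (4 * k + 12)"
    using tower_pos[of k] by (intro power_increasing) auto
  finally show ?thesis by (simp add: freq_def)
qed

lemma one_le_amp: "1 \<le> amp k"
  unfolding amp_def using tower_pos[of k] by (intro one_le_power) simp

section \<open>The peak function and its integral means\<close>

definition omega :: "complex \<Rightarrow> complex" where "omega z = z * (1 + z) / 2"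

lemma norm_omega_le: "norm z \<le> 1 \<Longrightarrow> norm (omega z) \<le> norm z"
proof -
  assume z: "norm z \<le> 1"
  have "norm (1 + z) \<le> 2" using norm_triangle_ineq[of 1 z] z by simp
  then have "norm z * norm (1 + z) \<le> norm z * 2" by (intro mult_left_mono) auto
  then show ?thesis by (simp add: omega_def norm_mult norm_divide)
qed

lemma norm_omega_less: "norm z \<le> 1 \<Longrightarrow> z \<noteq> 1 \<Longrightarrow> norm (omega z) < 1"
proof -
  assume z: "norm z \<le> 1" "z \<noteq> 1"
  have z2: "(Re z)\<^sup>2 + (Im z)\<^sup>2 \<le> 1"
    using power_mono[OF z(1), of 2] by (simp add: cmod_power2)
  have "Re z < 1"
  proof (rule ccontr)
    assume "\<not> Re z < 1"
    moreover have "Re z \<le> 1" using complex_Re_le_cmod[of z] z by linarith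
    ultimately have "Re z = 1" by simp
    then have "(Im z)\<^sup>2 \<le> 0" using z2 by simp
    then have "Im z = 0" by simp
    with \<open>Re z = 1\<close> z(2) show False by (simp add: complex_eq_iff)
  qed
  moreover have "(norm (1 + z))\<^sup>2 = 1 + 2 * Re z + ((Re z)\<^sup>2 + (Im z)\<^sup>2)"
    unfolding cmod_power2 by (simp add: power2_eq_square algebra_simps)
  ultimately have "(norm (1 + z))\<^sup>2 < 2\<^sup>2"
    using z2 by simp
  then have "norm (1 + z) < 2" by (rule power2_less_imp_less) simp
  then have "norm z * norm (1 + z) < 2"
    using z(1) mult_left_le_one_le[of "norm (1 + z)" "norm z"] by simp
  then show ?thesis by (simp add: omega_def norm_mult norm_divide)
qed

text \<open>|omega|^2 is the convex combination of (r (1 + r) / 2)^2 and (r (1 - r) / 2)^2 with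
  weights 1 - \<sigma> and \<sigma>. The resulting bound is independent of r, as integral means over
  all radii require.\<close>

lemma norm_omega_circle:
  assumes r: "0 \<le> r" "r \<le> 1"
  shows "norm (omega (complex_of_real r * cis t)) \<le> 1 - (sin (t / 2))\<^sup>2 / 4"
proof (rule power2_le_imp_le)
  define \<sigma> where "\<sigma> = (sin (t / 2))\<^sup>2"
  have \<sigma>: "0 \<le> \<sigma>" "\<sigma> \<le> 1" by (simp_all add: \<sigma>_def abs_square_le_1)
  have ct: "cos t = 1 - 2 * \<sigma>" using cos_double_sin[of "t / 2"] by (simp add: \<sigma>_def)
  have "(norm (1 + complex_of_real r * cis t))\<^sup>2 = 1 + 2 * r * cos t + (r\<^sup>2 * (cos t)\<^sup>2 + r\<^sup>2 * (sin t)\<^sup>2)"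
    unfolding cmod_power2 by (simp add: power2_eq_square algebra_simps)
  also have "r\<^sup>2 * (cos t)\<^sup>2 + r\<^sup>2 * (sin t)\<^sup>2 = r\<^sup>2"
    by (simp flip: distrib_left)
  finally have n1: "(norm (1 + complex_of_real r * cis t))\<^sup>2 = 1 + 2 * r * (1 - 2 * \<sigma>) + r\<^sup>2"
    by (simp add: ct)
  have "(norm (omega (complex_of_real r * cis t)))\<^sup>2 = r\<^sup>2 * (1 + 2 * r * (1 - 2 * \<sigma>) + r\<^sup>2) / 4"
    using n1 r by (simp add: omega_def norm_mult norm_divide power_mult_distrib power_divide)
  also have "\<dots> = (1 - \<sigma>) * (r * (1 + r) / 2)\<^sup>2 + \<sigma> * (r * (1 - r) / 2)\<^sup>2"
    by (simp add: power2_eq_square field_simps)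
  also have "\<dots> \<le> (1 - \<sigma>) * 1 + \<sigma> * (1 / 2)"
  proof (intro add_mono mult_left_mono)
    have "r * (1 + r) \<le> 1 * 2" using r by (intro mult_mono) auto
    then show "(r * (1 + r) / 2)\<^sup>2 \<le> 1" using r by (intro power_le_one) auto
    have "r * (1 - r) \<le> 1 * 1" using r by (intro mult_mono) auto
    then have "(r * (1 - r) / 2)\<^sup>2 \<le> (1 / 2)\<^sup>2" using r by (intro power_mono) auto
    also have "(1 / 2)\<^sup>2 \<le> (1 / 2 :: real)" by (simp add: power2_eq_square)
    finally show "(r * (1 - r) / 2)\<^sup>2 \<le> 1 / 2" .
  qed (use \<sigma> in auto)
  also have "\<dots> \<le> (1 - \<sigma> / 4)\<^sup>2" using \<sigma> by (simp add: power2_eq_square algebra_simps)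
  finally show "(norm (omega (complex_of_real r * cis t)))\<^sup>2 \<le> (1 - (sin (t / 2))\<^sup>2 / 4)\<^sup>2"
    by (simp add: \<sigma>_def)
  show "0 \<le> 1 - (sin (t / 2))\<^sup>2 / 4" using \<sigma> by (simp add: \<sigma>_def)
qed

lemma sin_ge_half:
  assumes "0 \<le> y" "y \<le> pi / 2"
  shows "y / 2 \<le> sin y"
proof -
  have "\<bar>sin y - (\<Sum>m<3. sin_coeff m * y ^ m)\<bar> \<le> inverse (fact 3) * \<bar>y\<bar> ^ 3"
    by (rule Maclaurin_sin_bound)
  moreover have "(\<Sum>m<3. sin_coeff m * y ^ m) = y"
  proof -
    have "{..<3::nat} = {0, 1, 2}" by auto
    then show ?thesis by (simp add: sin_coeff_def)
  qed
  moreover have "inverse (fact 3 :: real) * \<bar>y\<bar> ^ 3 = y ^ 3 / 6"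
  proof -
    have "fact 3 = (6 :: real)" by (simp add: eval_nat_numeral)
    then show ?thesis using assms by simp
  qed
  ultimately have "\<bar>sin y - y\<bar> \<le> y ^ 3 / 6"
    by (simp only:)
  moreover have "y ^ 3 / 6 \<le> y / 2"
  proof -
    have "pi \<le> 16 / 5" using pi_approx(2) by simp
    then have "y \<le> 8 / 5" using assms(2) by linarith
    then have "y * y \<le> 8 / 5 * (8 / 5)" using assms by (intro mult_mono) auto
    then have "y * (y * y) \<le> y * 3" using assms by (intro mult_left_mono) auto
    then show ?thesis by (simp add: power3_eq_cube)
  qed
  ultimately show ?thesis by linarith
qed

lemma sin_sq_lower:
  assumes "0 \<le> t" "t \<le> 2 * pi"
  shows "(min t (2 * pi - t))\<^sup>2 / 16 \<le> (sin (t / 2))\<^sup>2"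
proof -
  define m where "m = min t (2 * pi - t)"
  have m: "0 \<le> m" "m \<le> pi" using assms by (auto simp: m_def)
  have "sin (t / 2) = sin (m / 2)"
  proof (cases "t \<le> pi")
    case False
    then have "m / 2 = pi - t / 2" by (simp add: m_def min_def field_simps)
    then have "sin (m / 2) = sin (pi - t / 2)" by (simp only:)
    then show ?thesis by (simp add: sin_diff)
  qed (simp add: m_def min_def)
  moreover have "m / 4 \<le> sin (m / 2)" using sin_ge_half[of "m / 2"] m by simp
  then have "(m / 4)\<^sup>2 \<le> (sin (m / 2))\<^sup>2" using m by (intro power_mono) auto
  ultimately show ?thesis by (simp add: m_def power_divide)
qed

lemma omega_power_exp:
  assumes "0 \<le> r" "r \<le> 1"
  shows "norm (omega (complex_of_real r * cis t)) ^ n \<le> exp (- (real n * ((sin (t / 2))\<^sup>2 / 4)))"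
proof -
  have "norm (omega (complex_of_real r * cis t)) \<le> exp (- ((sin (t / 2))\<^sup>2 / 4))"
    using norm_omega_circle[OF assms, of t] exp_ge_add_one_self[of "- ((sin (t / 2))\<^sup>2 / 4)"] by linarith
  then have "norm (omega (complex_of_real r * cis t)) ^ n \<le> exp (- ((sin (t / 2))\<^sup>2 / 4)) ^ n"
    by (intro power_mono) auto
  then show ?thesis by (simp add: exp_of_nat_mult[symmetric])
qed

lemma integral_arctan_bound:
  assumes a: "0 < a"
  shows "(LINT t|circ. 1 / (1 + (a * t)\<^sup>2)) \<le> pi / (2 * a)"
    and "(LINT t|circ. 1 / (1 + (a * (2 * pi - t))\<^sup>2)) \<le> pi / (2 * a)"
proof -
  have pos: "1 + x\<^sup>2 \<noteq> 0" for x :: real using zero_le_power2[of x] by linarith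
  have "(LINT t|circ. 1 / (1 + (a * t)\<^sup>2)) = (LBINT t:{0..2 * pi}. 1 / (1 + (a * t)\<^sup>2))"
    by (rule set_integral_circ[symmetric])
  also have "\<dots> = arctan (a * (2 * pi)) / a - arctan (a * 0) / a"
    unfolding set_lebesgue_integral_def
  proof (rule integral_FTC_Icc)
    show "((\<lambda>t. arctan (a * t) / a) has_vector_derivative 1 / (1 + (a * t)\<^sup>2)) (at t within {0..2 * pi})" for t
    proof -
      have "((\<lambda>t. arctan (a * t) / a) has_real_derivative inverse (1 + (a * t)\<^sup>2) * (a * 1) / a) (at t within {0..2 * pi})"
        by (intro DERIV_cdivide DERIV_chain2[OF DERIV_arctan] DERIV_cmult DERIV_ident)
      then show ?thesis
        using a by (simp add: has_real_derivative_iff_has_vector_derivative inverse_eq_divide)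
    qed
  qed (auto intro!: continuous_intros simp: pos)
  also have "\<dots> \<le> (pi / 2) / a"
    using divide_right_mono[OF less_imp_le[OF arctan_ubound], of a "a * (2 * pi)"] a by simp
  finally show "(LINT t|circ. 1 / (1 + (a * t)\<^sup>2)) \<le> pi / (2 * a)" by simp
  have "(LINT t|circ. 1 / (1 + (a * (2 * pi - t))\<^sup>2)) = (LBINT t:{0..2 * pi}. 1 / (1 + (a * (2 * pi - t))\<^sup>2))"
    by (rule set_integral_circ[symmetric])
  also have "\<dots> = - arctan (a * (2 * pi - 2 * pi)) / a - (- arctan (a * (2 * pi - 0)) / a)"
    unfolding set_lebesgue_integral_def
  proof (rule integral_FTC_Icc)
    show "((\<lambda>t. - arctan (a * (2 * pi - t)) / a) has_vector_derivative 1 / (1 + (a * (2 * pi - t))\<^sup>2)) (at t within {0..2 * pi})" for t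
    proof -
      have "((\<lambda>t. - arctan (a * (2 * pi - t)) / a) has_real_derivative - (inverse (1 + (a * (2 * pi - t))\<^sup>2) * (a * (0 - 1))) / a) (at t within {0..2 * pi})"
        by (intro DERIV_cdivide DERIV_minus DERIV_chain2[OF DERIV_arctan] DERIV_cmult DERIV_ident DERIV_diff DERIV_const)
      then show ?thesis
        using a by (simp add: has_real_derivative_iff_has_vector_derivative inverse_eq_divide)
    qed
  qed (auto intro!: continuous_intros simp: pos)
  also have "\<dots> \<le> (pi / 2) / a"
    using divide_right_mono[OF less_imp_le[OF arctan_ubound], of a "a * (2 * pi)"] a by simp
  finally show "(LINT t|circ. 1 / (1 + (a * (2 * pi - t))\<^sup>2)) \<le> pi / (2 * a)" by simp
qed

lemma continuous_omega: "continuous_on UNIV omega"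
  unfolding omega_def by (intro continuous_intros) auto

text \<open>The Gaussian decay exp (- (a m)^2) is weakened to 1 / (1 + (a m)^2), which has an
  elementary primitive. There are two summands because both ends of the parameter interval lie over
  1.\<close>

lemma integral_omega_power:
  assumes r: "0 \<le> r" "r \<le> 1" and s: "0 < s"
  shows "(LINT t|circ. norm (omega (complex_of_real r * cis t)) ^ (s ^ 2)) \<le> 8 * pi / real s"
proof -
  \<comment> \<open>The square of 8 is 16 * 4: 16 from \<open>sin_sq_lower\<close> and 4 from
    \<open>norm_omega_circle\<close>.\<close>
  define a where "a = real s / 8"
  have a: "0 < a" using s by (simp add: a_def)
  have pos: "1 + x\<^sup>2 \<noteq> 0" "0 < 1 + x\<^sup>2" for x :: real using zero_le_power2[of x] by linarith+
  have le: "norm (omega (complex_of_real r * cis t)) ^ (s ^ 2)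
      \<le> 1 / (1 + (a * t)\<^sup>2) + 1 / (1 + (a * (2 * pi - t))\<^sup>2)" if t: "t \<in> {0..2 * pi}" for t
  proof -
    define m where "m = min t (2 * pi - t)"
    have "(a * m)\<^sup>2 = real (s ^ 2) * (m\<^sup>2 / 16 / 4)" by (simp add: a_def power_mult_distrib power_divide)
    also have "\<dots> \<le> real (s ^ 2) * ((sin (t / 2))\<^sup>2 / 4)"
      unfolding m_def using t by (intro mult_left_mono divide_right_mono sin_sq_lower) auto
    finally have *: "(a * m)\<^sup>2 \<le> real (s ^ 2) * ((sin (t / 2))\<^sup>2 / 4)" .
    have "norm (omega (complex_of_real r * cis t)) ^ (s ^ 2) \<le> exp (- (real (s ^ 2) * ((sin (t / 2))\<^sup>2 / 4)))"
      by (rule omega_power_exp[OF r])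
    also have "\<dots> \<le> exp (- (a * m)\<^sup>2)" using * by simp
    also have "\<dots> = 1 / exp ((a * m)\<^sup>2)" by (simp add: exp_minus inverse_eq_divide)
    also have "\<dots> \<le> 1 / (1 + (a * m)\<^sup>2)" by (intro divide_left_mono mult_pos_pos pos exp_ge_add_one_self) auto
    also have "\<dots> \<le> 1 / (1 + (a * t)\<^sup>2) + 1 / (1 + (a * (2 * pi - t))\<^sup>2)"
      using less_imp_le[OF pos(2)] by (auto simp: m_def min_def)
    finally show ?thesis .
  qed
  have i: "integrable circ (\<lambda>t. 1 / (1 + (a * t)\<^sup>2))" "integrable circ (\<lambda>t. 1 / (1 + (a * (2 * pi - t))\<^sup>2))"
    by (intro integrable_continuous_circ continuous_intros; simp add: pos)+
  have "(LINT t|circ. norm (omega (complex_of_real r * cis t)) ^ (s ^ 2))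
     \<le> (LINT t|circ. 1 / (1 + (a * t)\<^sup>2) + 1 / (1 + (a * (2 * pi - t))\<^sup>2))"
  proof (rule integral_mono)
    show "integrable circ (\<lambda>t. norm (omega (complex_of_real r * cis t)) ^ (s ^ 2))"
      by (intro integrable_continuous_circ continuous_intros continuous_on_compose2[OF continuous_omega]) auto
    show "integrable circ (\<lambda>t. 1 / (1 + (a * t)\<^sup>2) + 1 / (1 + (a * (2 * pi - t))\<^sup>2))"
      by (intro Bochner_Integration.integrable_add i)
  qed (use le in simp)
  also have "\<dots> \<le> pi / (2 * a) + pi / (2 * a)"
    using integral_arctan_bound[OF a] by (subst Bochner_Integration.integral_add[OF i]) linarith
  also have "\<dots> = 8 * pi / real s" by (simp add: a_def)
  finally show ?thesis .
qed

text \<open>The exponent 4 is chosen against the cubic growth of the Lipschitz constants of the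
  blocks; one power remains for summability.\<close>

lemma exp_minus_le: "0 < y \<Longrightarrow> exp (- y) \<le> (4 / y) ^ 4" for y :: real
proof -
  assume y: "0 < y"
  have "exp (- (y / 4)) = 1 / exp (y / 4)" by (simp add: exp_minus inverse_eq_divide)
  also have "\<dots> \<le> 1 / (y / 4)"
  proof (rule divide_left_mono)
    show "y / 4 \<le> exp (y / 4)" using exp_ge_add_one_self[of "y / 4"] by linarith
  qed (use y in auto)
  also have "\<dots> = 4 / y" by simp
  finally have "exp (- (y / 4)) ^ 4 \<le> (4 / y) ^ 4" by (intro power_mono) auto
  then show ?thesis by (simp add: exp_of_nat_mult[symmetric])
qed

lemma norm_power_diff_le:
  fixes x y :: complex
  assumes "norm x \<le> q" "norm y \<le> q"
  shows "norm (x ^ n - y ^ n) \<le> real n * q ^ (n - 1) * norm (x - y)"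
proof -
  have q: "0 \<le> q" using assms(1) norm_ge_zero order_trans by blast
  have "x ^ n - y ^ n = (x - y) * (\<Sum>i<n. y ^ (n - Suc i) * x ^ i)"
    by (rule power_diff_sumr2)
  moreover have "norm (\<Sum>i<n. y ^ (n - Suc i) * x ^ i) \<le> (\<Sum>i<n. q ^ (n - 1))"
  proof (rule sum_norm_le)
    fix i assume "i \<in> {..<n}"
    then have "n - 1 = (n - Suc i) + i" by simp
    then have eq: "q ^ (n - 1) = q ^ (n - Suc i) * q ^ i" by (simp only: power_add)
    show "norm (y ^ (n - Suc i) * x ^ i) \<le> q ^ (n - 1)"
      unfolding eq norm_mult norm_power using assms q by (intro mult_mono power_mono) auto
  qed
  ultimately show ?thesis
    using mult_left_mono[of "norm (\<Sum>i<n. y ^ (n - Suc i) * x ^ i)" "real n * q ^ (n - 1)" "norm (x - y)"]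
    by (simp add: norm_mult mult.commute)
qed

section \<open>The block series\<close>

definition peak :: "nat \<Rightarrow> real" where "peak k = real (tower k) ^ (k + 4)"

definition omega_poly :: "complex poly" where "omega_poly = [:0, 1/2, 1/2:]"

definition cut_poly :: "nat \<Rightarrow> complex poly" where
  "cut_poly k = smult (complex_of_real (peak k)) (omega_poly ^ freq k)"

definition block :: "nat \<Rightarrow> complex poly" where
  "block k = cut_poly k * (1 + monom 1 (freq k + 1)) ^ (k + 4)"

lemma poly_omega: "poly omega_poly z = omega z"
  by (simp add: omega_poly_def omega_def algebra_simps)

lemma poly_cut: "poly (cut_poly k) z = complex_of_real (peak k) * omega z ^ freq k"
  by (simp add: cut_poly_def poly_omega)

lemma poly_block: "poly (block k) z = complex_of_real (peak k) * omega z ^ freq k * (1 + z ^ (freq k + 1)) ^ (k + 4)"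
  by (simp add: block_def poly_cut poly_monom)

lemma peak_pos: "0 < peak k"
  unfolding peak_def using tower_pos[of k] by simp

lemma amp_eq: "amp k = peak k * 2 ^ (k + 4)"
  by (simp add: amp_def peak_def power_mult_distrib)

lemma freq_pos: "0 < freq k"
  using tower_pos[of k] tower_le_freq(2)[of k] by linarith

lemma freq_ge: "2 ^ k \<le> real (freq k)" "k + 4 \<le> freq k"
proof -
  have "20000000 * 16 ^ k \<le> freq k"
    using tower_ge tower_le_freq(2) by (rule order_trans)
  moreover have "(2::nat) ^ k \<le> 16 ^ k" by (intro power_mono) auto
  moreover have "k < (2::nat) ^ k" by (rule less_exp)
  moreover have "(1::nat) \<le> 16 ^ k" by simp
  ultimately have *: "2 ^ k \<le> freq k" "k + 4 \<le> freq k" by linarith+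
  show "k + 4 \<le> freq k" by (rule *)
  show "2 ^ k \<le> real (freq k)" using *(1) of_nat_le_iff[of "2 ^ k" "freq k"] by (simp del: of_nat_le_iff)
qed

lemma norm_block_le:
  assumes "norm z \<le> 1"
  shows "norm (poly (block k) z) \<le> amp k * norm (omega z) ^ freq k"
proof -
  have "norm (z ^ (freq k + 1)) \<le> 1" using assms by (simp only: norm_power) (rule power_le_one, auto)
  then have "norm (1 + z ^ (freq k + 1)) \<le> 2"
    using norm_triangle_ineq[of 1 "z ^ (freq k + 1)"] by simp
  then have "norm (1 + z ^ (freq k + 1)) ^ (k + 4) \<le> 2 ^ (k + 4)" by (intro power_mono) auto
  then have "peak k * norm (omega z) ^ freq k * norm (1 + z ^ (freq k + 1)) ^ (k + 4) \<le> peak k * norm (omega z) ^ freq k * 2 ^ (k + 4)"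
    using peak_pos[of k] by (intro mult_left_mono) auto
  then show ?thesis
    using peak_pos[of k] by (simp only: poly_block norm_mult norm_power norm_of_real amp_eq) (simp add: mult_ac)
qed

text \<open>The product rule in difference form. The bound \<open>q\<close> stays a parameter: q = 1
  gives a Lipschitz constant on the whole closed disc, q < 1 a summable one near any point other
  than 1. One power of the frequency pays for the amplitude, two for the differences of the two
  factors.\<close>

lemma block_lipschitz:
  assumes z: "norm z \<le> 1" "norm (omega z) \<le> q" and w: "norm w \<le> 1" "norm (omega w) \<le> q" and q: "q \<le> 1"
  shows "norm (poly (block k) z - poly (block k) w) \<le> 4 * real (freq k) ^ 3 * q ^ (freq k - 1) * norm (z - w)"
proof -
  define n where "n = freq k"
  define r where "r = k + 4"
  define d where "d = norm (z - w)"
  have q0: "0 \<le> q" using z(2) norm_ge_zero order_trans by blast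
  have n: "1 \<le> n" "r \<le> n" using freq_pos[of k] freq_ge(2)[of k] by (auto simp: n_def r_def)
  have bound2: "norm (1 + y ^ (n + 1)) \<le> 2" if "norm y \<le> 1" for y :: complex
  proof -
    have "norm (y ^ (n + 1)) \<le> 1" using that by (simp only: norm_power) (rule power_le_one, auto)
    then show ?thesis using norm_triangle_ineq[of 1 "y ^ (n + 1)"] by simp
  qed
  have om: "norm (omega z - omega w) \<le> 2 * d"
  proof -
    have "omega z - omega w = (z - w) * ((1 + z + w) / 2)" by (simp add: omega_def field_simps)
    moreover have "norm (1 + z + w) \<le> 1 + norm z + norm w"
      using norm_triangle_ineq[of "1 + z" w] norm_triangle_ineq[of 1 z] by simp
    then have "norm ((1 + z + w) / 2) \<le> 2" using z w by (simp add: norm_divide)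
    then have "norm (z - w) * norm ((1 + z + w) / 2) \<le> norm (z - w) * 2" by (rule mult_left_mono) simp
    ultimately have "norm (omega z - omega w) \<le> norm (z - w) * 2" by (simp only: norm_mult)
    then show ?thesis by (simp add: d_def)
  qed
  have X: "norm (omega z ^ n - omega w ^ n) \<le> real n * q ^ (n - 1) * (2 * d)"
    using norm_power_diff_le[OF z(2) w(2), of n] om q0
    by (elim order_trans) (intro mult_left_mono, auto)
  have G: "norm ((1 + z ^ (n + 1)) ^ r - (1 + w ^ (n + 1)) ^ r) \<le> real n * 2 ^ r * (real (n + 1) * d)"
  proof -
    have "norm ((1 + z ^ (n + 1)) ^ r - (1 + w ^ (n + 1)) ^ r)
       \<le> real r * 2 ^ (r - 1) * norm ((1 + z ^ (n + 1)) - (1 + w ^ (n + 1)))"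
      by (intro norm_power_diff_le bound2 z w)
    also have "norm ((1 + z ^ (n + 1)) - (1 + w ^ (n + 1))) \<le> real (n + 1) * d"
      using norm_power_diff[OF z(1) w(1), of "n + 1"] by (simp add: d_def)
    then have "real r * 2 ^ (r - 1) * norm ((1 + z ^ (n + 1)) - (1 + w ^ (n + 1))) \<le> real r * 2 ^ (r - 1) * (real (n + 1) * d)"
      by (intro mult_left_mono) auto
    also have "\<dots> \<le> real n * 2 ^ r * (real (n + 1) * d)"
      using n by (intro mult_right_mono mult_mono power_increasing) (auto simp: d_def)
    finally show ?thesis .
  qed
  have Y: "norm (omega w ^ n) \<le> q ^ (n - 1)"
  proof -
    have "norm (omega w ^ n) \<le> q ^ n" unfolding norm_power using w by (intro power_mono) auto
    also have "\<dots> \<le> q ^ (n - 1)" using q q0 by (intro power_decreasing) auto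
    finally show ?thesis .
  qed
  have G2: "norm ((1 + z ^ (n + 1)) ^ r) \<le> 2 ^ r"
    unfolding norm_power[of "1 + z ^ (n + 1)"] by (intro power_mono bound2 z) auto
  have "poly (block k) z - poly (block k) w = complex_of_real (peak k) *
      ((omega z ^ n - omega w ^ n) * (1 + z ^ (n + 1)) ^ r + omega w ^ n * ((1 + z ^ (n + 1)) ^ r - (1 + w ^ (n + 1)) ^ r))"
    unfolding poly_block n_def r_def by (simp add: algebra_simps)
  then have "norm (poly (block k) z - poly (block k) w) = peak k *
      norm ((omega z ^ n - omega w ^ n) * (1 + z ^ (n + 1)) ^ r + omega w ^ n * ((1 + z ^ (n + 1)) ^ r - (1 + w ^ (n + 1)) ^ r))"
    using peak_pos[of k] by (simp only: norm_mult[of "complex_of_real (peak k)"] norm_of_real abs_of_pos)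
  also have "\<dots> \<le> peak k * (real n * q ^ (n - 1) * (2 * d) * 2 ^ r + q ^ (n - 1) * (real n * 2 ^ r * (real (n + 1) * d)))"
  proof (rule mult_left_mono)
    show "norm ((omega z ^ n - omega w ^ n) * (1 + z ^ (n + 1)) ^ r + omega w ^ n * ((1 + z ^ (n + 1)) ^ r - (1 + w ^ (n + 1)) ^ r))
      \<le> real n * q ^ (n - 1) * (2 * d) * 2 ^ r + q ^ (n - 1) * (real n * 2 ^ r * (real (n + 1) * d))"
      by (rule norm_triangle_le, rule add_mono; unfold norm_mult[of "_ - _"] norm_mult[of "omega w ^ n"])
         (use X G Y G2 q0 in \<open>auto intro!: mult_mono simp: d_def\<close>)
  qed (use peak_pos[of k] in simp)
  also have "\<dots> = amp k * (real n * (real n + 3)) * (q ^ (n - 1) * d)"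
    by (simp add: amp_eq r_def algebra_simps)
  also have "\<dots> \<le> real n * (4 * real n ^ 2) * (q ^ (n - 1) * d)"
  proof (rule mult_right_mono, rule mult_mono)
    show "amp k \<le> real n" using amp_le_freq by (simp add: n_def)
    show "real n * (real n + 3) \<le> 4 * real n ^ 2" using n by (simp add: power2_eq_square)
  qed (use q0 in \<open>auto simp: d_def\<close>)
  also have "\<dots> = 4 * real n ^ 3 * q ^ (n - 1) * d" by (simp add: power2_eq_square power3_eq_cube)
  finally show ?thesis by (simp add: n_def d_def)
qed

lemma summable_majorant:
  assumes q: "1 / 2 \<le> q" "q < 1"
  shows "summable (\<lambda>k. 4 * real (freq k) ^ 3 * q ^ (freq k - 1))"
proof (rule summable_comparison_test)
  define K where "K = 8 * (4 / (1 - q)) ^ 4"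
  show "summable (\<lambda>k. K * (1 / 2) ^ k)" by (intro summable_mult summable_geometric) simp
  have "4 * real (freq k) ^ 3 * q ^ (freq k - 1) \<le> K * (1 / 2) ^ k" for k
  proof -
    define x where "x = real (freq k)"
    have x: "0 < x" "2 ^ k \<le> x" using freq_pos[of k] freq_ge(1)[of k] by (auto simp: x_def)
    \<comment> \<open>The hypothesis q \<ge> 1/2 converts the exponent \<open>freq k - 1\<close>
      into \<open>freq k\<close> at the cost of a factor 2.\<close>
    have "q ^ freq k = q * q ^ (freq k - 1)" using freq_pos[of k] by (simp flip: power_Suc)
    moreover have "1 / 2 * q ^ (freq k - 1) \<le> q * q ^ (freq k - 1)" using q by (intro mult_right_mono) auto
    ultimately have "q ^ (freq k - 1) \<le> 2 * q ^ freq k" by simp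
    also have "q ^ freq k \<le> exp (- (1 - q)) ^ freq k"
      using q exp_ge_add_one_self[of "- (1 - q)"] by (intro power_mono) auto
    also have "\<dots> = exp (- (x * (1 - q)))" by (simp add: x_def exp_of_nat_mult[symmetric] algebra_simps)
    also have "\<dots> \<le> (4 / (x * (1 - q))) ^ 4" using x q by (intro exp_minus_le mult_pos_pos) auto
    also have "\<dots> = (4 / (1 - q)) ^ 4 / x ^ 4" by (simp add: power_divide power_mult_distrib mult.commute)
    finally have "4 * x ^ 3 * q ^ (freq k - 1) \<le> 4 * x ^ 3 * (2 * ((4 / (1 - q)) ^ 4 / x ^ 4))"
      using x by (intro mult_left_mono) auto
    also have "\<dots> = K / x"
    proof -
      have "4 * x ^ 3 * (2 * (c / x ^ 4)) = 8 * c / x" for c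
        using x by (simp add: power_numeral_reduce field_simps)
      then show ?thesis by (simp only: K_def)
    qed
    also have "\<dots> \<le> K / 2 ^ k"
      using x q by (intro divide_left_mono) (auto simp: K_def intro!: mult_pos_pos)
    also have "\<dots> = K * (1 / 2) ^ k" by (simp add: power_divide)
    finally show ?thesis by (simp add: x_def)
  qed
  then show "\<exists>N. \<forall>k\<ge>N. norm (4 * real (freq k) ^ 3 * q ^ (freq k - 1)) \<le> K * (1 / 2) ^ k"
    using q by auto
qed

text \<open>As |omega|^n \<le> 1 and p \<ge> 1, its p-th power is at most itself, so p affects only
  the amplitude. The radius 1 is included for the sake of \<open>L1B\<close>.\<close>

lemma integral_block_powr:
  assumes r: "0 \<le> r" "r \<le> 1" and p: "1 \<le> p"
  shows "(LINT t|circ. norm (poly (block k) (complex_of_real r * cis t)) powr p)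
     \<le> amp k powr p * (8 * pi / real (sfreq k))"
proof -
  have z1: "norm (complex_of_real r * cis t) \<le> 1" for t using r by (simp add: norm_mult)
  have "(LINT t|circ. norm (poly (block k) (complex_of_real r * cis t)) powr p)
     \<le> (LINT t|circ. amp k powr p * norm (omega (complex_of_real r * cis t)) ^ freq k)"
  proof (rule integral_mono)
    show "integrable circ (\<lambda>t. norm (poly (block k) (complex_of_real r * cis t)) powr p)"
      using p by (intro integrable_continuous_circ continuous_on_powr' continuous_intros) auto
    show "integrable circ (\<lambda>t. amp k powr p * norm (omega (complex_of_real r * cis t)) ^ freq k)"
      by (intro integrable_continuous_circ continuous_intros continuous_on_compose2[OF continuous_omega]) auto
    fix t
    define x where "x = norm (omega (complex_of_real r * cis t)) ^ freq k"
    have x: "0 \<le> x" "x \<le> 1"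
      unfolding x_def using order_trans[OF norm_omega_le[OF z1] z1] by (auto intro!: power_le_one)
    have "norm (poly (block k) (complex_of_real r * cis t)) powr p \<le> (amp k * x) powr p"
      unfolding x_def using p by (intro powr_mono2 norm_block_le z1) auto
    also have "\<dots> = amp k powr p * x powr p"
      by (rule powr_mult)
    also have "x powr p \<le> x"
      using x p powr_mono'[of 1 p x] by simp
    then have "amp k powr p * x powr p \<le> amp k powr p * x" by (intro mult_left_mono) auto
    finally show "norm (poly (block k) (complex_of_real r * cis t)) powr p
        \<le> amp k powr p * norm (omega (complex_of_real r * cis t)) ^ freq k"
      by (simp add: x_def)
  qed
  also have "\<dots> = amp k powr p * (LINT t|circ. norm (omega (complex_of_real r * cis t)) ^ freq k)"
    by simp
  also have "\<dots> \<le> amp k powr p * (8 * pi / real (sfreq k))"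
    unfolding freq_eq using sfreq_ge[of k] by (intro mult_left_mono integral_omega_power r) auto
  finally show ?thesis .
qed

text \<open>Here the growing exponents matter: for every p < 2 eventually (k + 4) p \<le> 2 k + 4.
  Against \<open>sfreq k\<close>, which is x^(2k+6) with x = \<open>tower k\<close>, two powers of x
  remain, and x \<ge> 16^k outweighs both 4^(k+1) and 2^(2k+4).\<close>

lemma summable_amp_powr:
  assumes p: "1 \<le> p" "p < 2"
  shows "summable (\<lambda>k. 4 ^ (k + 1) * (amp k powr p * (8 * pi / real (sfreq k))))"
proof (rule summable_comparison_test)
  show "summable (\<lambda>k. (64 * (8 * pi)) * (1 / 16 :: real) ^ k)" by (intro summable_mult summable_geometric) simp
  \<comment> \<open>From k (2 - p) \<ge> 4 it follows that 2 k + 4 - (k + 4) p \<ge> 8 - 4 p >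
    0.\<close>
  obtain N :: nat where N: "4 / (2 - p) \<le> real N" using real_arch_simple by blast
  have "4 ^ (k + 1) * (amp k powr p * (8 * pi / real (sfreq k))) \<le> (64 * (8 * pi)) * (1 / 16) ^ k" if k: "N \<le> k" for k
  proof -
    define x where "x = real (tower k)"
    have x: "16 ^ k \<le> x" "1 \<le> x"
    proof -
      have "20000000 * 16 ^ k \<le> x" using of_nat_mono[OF tower_ge[of k], where ?'a = real] by (simp add: x_def)
      moreover have "(1::real) \<le> 16 ^ k" by simp
      ultimately show "16 ^ k \<le> x" "1 \<le> x" by linarith+
    qed
    have "4 / (2 - p) \<le> real k" using N k by linarith
    then have "4 \<le> real k * (2 - p)" using p by (simp add: field_simps)
    then have ex: "real (k + 4) * p \<le> real (2 * k + 4)" using p by (simp add: algebra_simps)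
    have "amp k powr p = ((2 * x) powr real (k + 4)) powr p"
      unfolding amp_def x_def[symmetric] using x by (subst powr_realpow) auto
    also have "\<dots> = (2 * x) powr (real (k + 4) * p)" by (rule powr_powr)
    also have "\<dots> \<le> (2 * x) powr real (2 * k + 4)" using x ex by (intro powr_mono) auto
    also have "\<dots> = (2 * x) ^ (2 * k + 4)" using x by (subst powr_realpow) auto
    finally have 1: "amp k powr p \<le> (2 * x) ^ (2 * k + 4)" .
    have "2 * k + 6 = (2 * k + 4) + 2" by simp
    then have "sfreq k = tower k ^ ((2 * k + 4) + 2)" by (simp only: sfreq_def)
    then have s: "real (sfreq k) = x ^ (2 * k + 4) * x ^ 2"
      by (simp only: x_def power_add of_nat_mult of_nat_power)
    have "amp k powr p * (8 * pi / real (sfreq k)) \<le> (2 * x) ^ (2 * k + 4) * (8 * pi / real (sfreq k))"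
      using 1 by (intro mult_right_mono) auto
    also have "\<dots> = 2 ^ (2 * k + 4) * (8 * pi) / x ^ 2" using x by (simp add: s power_mult_distrib)
    also have "\<dots> \<le> 2 ^ (2 * k + 4) * (8 * pi) / (16 ^ k) ^ 2"
      using x by (intro divide_left_mono power_mono mult_pos_pos zero_less_power) auto
    finally have "4 ^ (k + 1) * (amp k powr p * (8 * pi / real (sfreq k)))
       \<le> 4 ^ (k + 1) * (2 ^ (2 * k + 4) * (8 * pi) / (16 ^ k) ^ 2)"
      by (intro mult_left_mono) auto
    also have "\<dots> = (64 * (8 * pi)) * (1 / 16) ^ k"
    proof -
      have "(2::real) ^ (2 * k + 4) = 16 * 4 ^ k" by (simp add: power_add power_mult)
      moreover have "(16::real) ^ k = 4 ^ k * 4 ^ k" by (simp flip: power_mult_distrib)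
      ultimately show ?thesis by (simp add: power_divide power2_eq_square)
    qed
    finally show ?thesis .
  qed
  then show "\<exists>N. \<forall>k\<ge>N. norm (4 ^ (k + 1) * (amp k powr p * (8 * pi / real (sfreq k)))) \<le> (64 * (8 * pi)) * (1 / 16) ^ k"
    by (intro exI[of _ N] allI impI) (simp only: real_norm_def, subst abs_of_nonneg, auto)
qed

interpretation blocks: block_series "\<lambda>k. poly (block k)"
proof
  show "poly (block k) holomorphic_on UNIV" for k by (intro holomorphic_intros)
  show "\<exists>\<Lambda>. \<forall>z w. norm z \<le> 1 \<longrightarrow> norm w \<le> 1 \<longrightarrow> norm (poly (block k) z - poly (block k) w) \<le> \<Lambda> * norm (z - w)" for k
  proof (intro exI allI impI)
    fix z w :: complex assume "norm z \<le> 1" "norm w \<le> 1"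
    then show "norm (poly (block k) z - poly (block k) w) \<le> 4 * real (freq k) ^ 3 * 1 ^ (freq k - 1) * norm (z - w)"
      by (intro block_lipschitz order_trans[OF norm_omega_le]) auto
  qed
  fix \<zeta> :: complex assume \<zeta>: "norm \<zeta> \<le> 1" "\<zeta> \<noteq> 1"
  \<comment> \<open>The midpoint between |omega \<zeta>| and 1 leaves room for a ball around
    \<zeta>; the lower bound 1/2 is what \<open>summable_majorant\<close> asks for.\<close>
  define q where "q = max (1 / 2) ((1 + norm (omega \<zeta>)) / 2)"
  have q: "1 / 2 \<le> q" "q < 1" "norm (omega \<zeta>) < q"
    using norm_omega_less[OF \<zeta>] by (auto simp: q_def)
  have "open {z. norm (omega z) < q}"
    by (intro open_Collect_less continuous_on_norm continuous_omega continuous_on_const)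
  then obtain d where d: "0 < d" "ball \<zeta> d \<subseteq> {z. norm (omega z) < q}"
    using q(3) by (elim openE) auto
  show "\<exists>\<delta> M. 0 < \<delta> \<and> summable M \<and>
       (\<forall>k z w. norm z \<le> 1 \<longrightarrow> norm w \<le> 1 \<longrightarrow> norm (z - \<zeta>) < \<delta> \<longrightarrow> norm (w - \<zeta>) < \<delta> \<longrightarrow>
          norm (poly (block k) z) \<le> M k \<and> norm (poly (block k) z - poly (block k) w) \<le> M k * norm (z - w))"
  proof (intro exI conjI allI impI)
    show "0 < d" by (rule d)
    show "summable (\<lambda>k. 4 * real (freq k) ^ 3 * q ^ (freq k - 1))" by (rule summable_majorant[OF q(1,2)])
    fix k :: nat and z w :: complex
    assume zw: "norm z \<le> 1" "norm w \<le> 1" "norm (z - \<zeta>) < d" "norm (w - \<zeta>) < d"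
    then have oq: "norm (omega z) \<le> q" "norm (omega w) \<le> q" using d(2) by (auto simp: dist_norm norm_minus_commute subset_eq intro!: less_imp_le)
    show "norm (poly (block k) z - poly (block k) w) \<le> 4 * real (freq k) ^ 3 * q ^ (freq k - 1) * norm (z - w)"
      using zw oq q by (intro block_lipschitz) auto
    have x: "1 \<le> real (freq k)" using freq_pos[of k] by simp
    have "norm (poly (block k) z) \<le> amp k * norm (omega z) ^ freq k" by (rule norm_block_le[OF zw(1)])
    also have "\<dots> \<le> (4 * real (freq k) ^ 3) * q ^ (freq k - 1)"
    proof (rule mult_mono)
      have "real (freq k) \<le> real (freq k) ^ 3" using x by (intro self_le_power) auto
      then show "amp k \<le> 4 * real (freq k) ^ 3" using amp_le_freq[of k] x by linarith
      have "norm (omega z) ^ freq k \<le> q ^ freq k" using oq by (intro power_mono) auto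
      also have "\<dots> \<le> q ^ (freq k - 1)" using q by (intro power_decreasing) auto
      finally show "norm (omega z) ^ freq k \<le> q ^ (freq k - 1)" .
    qed (use q in auto)
    finally show "norm (poly (block k) z) \<le> 4 * real (freq k) ^ 3 * q ^ (freq k - 1)" by simp
  qed
next
  show "summable (\<lambda>k. (LINT t|circ. norm (poly (block k) (cis t))))"
  proof (rule summable_comparison_test[OF _ summable_amp_powr[of 1]])
    have "(LINT t|circ. norm (poly (block k) (cis t))) \<le> 4 ^ (k + 1) * (amp k powr 1 * (8 * pi / real (sfreq k)))" for k
    proof -
      have "(LINT t|circ. norm (poly (block k) (cis t))) \<le> 1 * (amp k powr 1 * (8 * pi / real (sfreq k)))"
        using integral_block_powr[of 1 1 k] by simp
      also have "\<dots> \<le> 4 ^ (k + 1) * (amp k powr 1 * (8 * pi / real (sfreq k)))"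
        by (intro mult_right_mono) (auto simp: one_le_power simp del: power_Suc)
      finally show ?thesis .
    qed
    then show "\<exists>N. \<forall>n\<ge>N. norm ((LINT t|circ. norm (poly (block n) (cis t))))
        \<le> 4 ^ (n + 1) * (amp n powr 1 * (8 * pi / real (sfreq n)))"
      by (intro exI[of _ 0] allI impI) (subst real_norm_def, subst abs_of_nonneg, auto)
  qed auto
qed

lemma phi_in_hardy: "0 < p \<Longrightarrow> p < 2 \<Longrightarrow> blocks.\<phi> \<in> hardy_space p"
proof -
  assume p: "0 < p" "p < 2"
  \<comment> \<open>The block estimates hold for exponents at least 1; smaller p are reached through
    the exponent q of \<open>phi_hardy\<close>.\<close>
  define p' where "p' = max 1 p"
  have p': "1 \<le> p'" "p' < 2" "p \<le> p'" using p by (auto simp: p'_def)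
  show ?thesis
  proof (rule blocks.phi_hardy[where p = p' and m = "\<lambda>k. 4 ^ (k + 1) * (amp k powr p' * (8 * pi / real (sfreq k)))"])
    show "summable (\<lambda>k. 4 ^ (k + 1) * (amp k powr p' * (8 * pi / real (sfreq k))))"
      by (rule summable_amp_powr) (use p' in auto)
    show "4 ^ (k + 1) * (LINT t|circ. norm (poly (block k) (complex_of_real r * cis t)) powr p')
        \<le> 4 ^ (k + 1) * (amp k powr p' * (8 * pi / real (sfreq k)))" if "0 \<le> r" "r < 1" for k r
      using that p' by (intro mult_left_mono integral_block_powr) auto
  qed (use p p' in auto)
qed

section \<open>Spectra of the blocks and truncation of the series\<close>

lemma taylor_coeff_poly: "taylor_coeff (poly p) = coeff p"
proof (rule taylor_coeff_unique(1))
  fix z :: complex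
  show "(\<lambda>n. coeff p n * z ^ n) sums poly p z"
    unfolding poly_altdef by (rule sums_finite) (auto simp: coeff_eq_0)
qed

text \<open>On the circle |z| = 1/2 also |omega z| \<le> 1/2, so \<open>summable_majorant\<close>
  dominates the blocks and the integral for the i-th coefficient can be taken block by
  block.\<close>

lemma coeff_phi_sums: "(\<lambda>k. coeff (block k) i) sums taylor_coeff blocks.\<phi> i"
proof -
  define z where "z = (\<lambda>t. complex_of_real (1 / 2) * cis t)"
  have nz: "norm (z t) = 1 / 2" for t unfolding z_def by (simp add: norm_mult)
  define f where "f = (\<lambda>k t. poly (block k) (z t) * cis (- (of_nat i * t)))"
  have fi: "integrable circ (f k)" for k
    unfolding f_def z_def by (intro integrable_continuous_circ continuous_intros)
  have fb: "norm (f k t) \<le> 4 * real (freq k) ^ 3 * (1 / 2) ^ (freq k - 1)" for k t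
  proof -
    have x: "1 \<le> real (freq k)" using freq_pos[of k] by simp
    have "norm (f k t) \<le> amp k * norm (omega (z t)) ^ freq k"
      unfolding f_def norm_mult using norm_block_le[of "z t" k] by (simp add: nz)
    also have "\<dots> \<le> (4 * real (freq k) ^ 3) * (1 / 2) ^ (freq k - 1)"
    proof (rule mult_mono)
      have "real (freq k) \<le> real (freq k) ^ 3" using x by (intro self_le_power) auto
      then show "amp k \<le> 4 * real (freq k) ^ 3" using amp_le_freq[of k] x by linarith
      have "norm (omega (z t)) ^ freq k \<le> (1 / 2) ^ freq k"
        using norm_omega_le[of "z t"] by (intro power_mono) (auto simp: nz)
      also have "\<dots> \<le> (1 / 2) ^ (freq k - 1)" by (intro power_decreasing) auto
      finally show "norm (omega (z t)) ^ freq k \<le> (1 / 2) ^ (freq k - 1)" .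
    qed auto
    finally show ?thesis .
  qed
  have sM: "summable (\<lambda>k. 4 * real (freq k) ^ 3 * (1 / 2 :: real) ^ (freq k - 1))"
    by (rule summable_majorant) auto
  have sf: "summable (\<lambda>k. norm (f k t))" for t
    by (rule summable_comparison_test[OF _ sM]) (use fb in auto)
  have "summable (\<lambda>k. 2 * pi * (4 * real (freq k) ^ 3 * (1 / 2 :: real) ^ (freq k - 1)))"
    by (rule summable_mult[OF sM])
  then have si: "summable (\<lambda>k. (LINT t|circ. norm (f k t)))"
  proof (rule summable_comparison_test[rotated])
    have "(LINT t|circ. norm (f k t)) \<le> integral\<^sup>L circ (\<lambda>_. 4 * real (freq k) ^ 3 * (1 / 2) ^ (freq k - 1))" for k
      using fi by (intro integral_mono fb) auto
    then show "\<exists>N. \<forall>k\<ge>N. norm ((LINT t|circ. norm (f k t))) \<le> 2 * pi * (4 * real (freq k) ^ 3 * (1 / 2 :: real) ^ (freq k - 1))"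
      by (intro exI[of _ 0] allI impI) (simp add: measure_circ mult.assoc)
  qed
  have "(\<lambda>k. integral\<^sup>L circ (f k)) sums integral\<^sup>L circ (\<lambda>t. \<Sum>k. f k t)"
    by (rule sums_integral[OF fi _ si]) (simp add: sf)
  moreover have "integral\<^sup>L circ (f k) = 2 * pi * (coeff (block k) i * complex_of_real (1 / 2) ^ i)" for k
    unfolding f_def z_def
    by (subst power_series_fourier) (auto simp: taylor_coeff_poly intro!: holomorphic_intros)
  moreover have "integral\<^sup>L circ (\<lambda>t. \<Sum>k. f k t) = 2 * pi * (taylor_coeff blocks.\<phi> i * complex_of_real (1 / 2) ^ i)"
  proof -
    have "(\<Sum>k. f k t) = blocks.\<phi> (z t) * cis (- (of_nat i * t))" for t
    proof -
      have "norm (z t) \<le> 1" "z t \<noteq> 1" using nz[of t] by auto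
      then show ?thesis
        unfolding f_def using blocks.B_sums[of "z t"] by (simp add: sums_iff suminf_mult2[symmetric])
    qed
    then show ?thesis
      unfolding z_def by (subst power_series_fourier[symmetric]) (auto intro: blocks.holomorphic_phi)
  qed
  ultimately have "(\<lambda>k. 2 * pi * (coeff (block k) i * complex_of_real (1 / 2) ^ i)) sums
      (2 * pi * (taylor_coeff blocks.\<phi> i * complex_of_real (1 / 2) ^ i))"
    by (simp only:)
  then have "(\<lambda>k. 2 * pi * complex_of_real (1 / 2) ^ i * coeff (block k) i) sums
      (2 * pi * complex_of_real (1 / 2) ^ i * taylor_coeff blocks.\<phi> i)"
    by (simp only: mult_ac)
  then show ?thesis by (subst (asm) sums_mult_iff) auto
qed

text \<open>The factor z of \<open>omega\<close> moves the spectrum of its n-th power into the range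
  from n to 2 n, which is how blocks with very different frequencies come to be separated.\<close>

lemma omega_poly_power: "omega_poly ^ n = monom 1 n * [:1/2, 1/2:] ^ n"
proof -
  have "omega_poly = monom 1 1 * [:1/2, 1/2:]"
    by (simp add: omega_poly_def monom_altdef)
  then have "omega_poly ^ n = (monom 1 1 * [:1/2, 1/2:]) ^ n" by (rule arg_cong)
  then show ?thesis by (simp add: power_mult_distrib monom_power del: mult_pCons_right)
qed

lemma coeff_block_low: "i < freq k \<Longrightarrow> coeff (block k) i = 0"
  unfolding block_def cut_poly_def omega_poly_power
  by (simp add: mult.assoc coeff_monom_mult)

text \<open>The difference (1 + Y)^(k+4) - 1 is divisible by Y = z^(n+1), and the cut polynomial by
  z^n, where n = \<open>freq k\<close>. So everything else in the block starts at 2 n + 1, just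
  above the degree of the cut; this is why the exponent is n + 1 and not n.\<close>

lemma coeff_block_cut:
  assumes "i \<le> 2 * freq k"
  shows "coeff (block k) i = coeff (cut_poly k) i"
proof -
  define Y :: "complex poly" where "Y = monom 1 (freq k + 1)"
  define S where "S = (\<Sum>j<k + 4. (1 + Y) ^ j)"
  have "(1 + Y) ^ (k + 4) - 1 = Y * S"
    using power_diff_1_eq[of "1 + Y" "k + 4"] by (simp add: S_def)
  then have "block k - cut_poly k = cut_poly k * (Y * S)"
    unfolding block_def Y_def[symmetric] by (metis mult.right_neutral right_diff_distrib)
  also have "\<dots> = monom 1 (2 * freq k + 1) * (smult (complex_of_real (peak k)) ([:1/2, 1/2:] ^ freq k * S))"
  proof -
    have "monom 1 (2 * freq k + 1) = monom 1 (freq k) * (monom 1 (freq k + 1) :: complex poly)"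
      by (simp add: mult_monom mult_2)
    then show ?thesis
      unfolding cut_poly_def omega_poly_power Y_def by (simp add: mult_ac)
  qed
  finally have "coeff (block k - cut_poly k) i = 0"
    using assms by (simp add: coeff_monom_mult)
  then show ?thesis by simp
qed

definition partial_poly :: "nat \<Rightarrow> complex poly" where
  "partial_poly k = (\<Sum>j<k. block j) + cut_poly k"

lemma degree_cut: "degree (cut_poly k) \<le> 2 * freq k"
proof -
  have "degree (omega_poly ^ freq k) \<le> 2 * freq k"
    by (rule order_trans[OF degree_power_le]) (simp add: omega_poly_def)
  then show ?thesis unfolding cut_poly_def by (rule order_trans[OF degree_smult_le])
qed

lemma degree_block: "j < k \<Longrightarrow> degree (block j) \<le> 2 * freq k"
proof -
  assume "j < k"
  define n where "n = freq j"
  have "degree (1 + monom 1 (n + 1) :: complex poly) \<le> n + 1"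
    by (intro degree_add_le) (auto simp: degree_monom_le)
  then have "degree ((1 + monom 1 (n + 1) :: complex poly) ^ (j + 4)) \<le> (n + 1) * (j + 4)"
    by (intro order_trans[OF degree_power_le]) (rule mult_right_mono, auto)
  then have "degree (block j) \<le> 2 * n + (n + 1) * (j + 4)"
    unfolding block_def n_def[symmetric]
    by (intro order_trans[OF degree_mult_le] add_mono) (auto simp: n_def degree_cut)
  also have "\<dots> \<le> 2 * n + (n + 1) * n" using freq_ge(2)[of j] by (intro add_left_mono mult_left_mono) (auto simp: n_def)
  also have "\<dots> \<le> n ^ 2 * 4"
    using freq_pos[of j] by (simp add: n_def power2_eq_square)
  also have "\<dots> \<le> tower k ^ 2"
  proof -
    have "2 * n \<le> tower k" using freq_le_tower[OF \<open>j < k\<close>] by (simp add: n_def)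
    then have "(2 * n) ^ 2 \<le> tower k ^ 2" by (intro power_mono) auto
    then show ?thesis by (simp add: power_mult_distrib mult.commute)
  qed
  also have "\<dots> \<le> tower k ^ 12" using tower_pos[of k] by (intro power_increasing) auto
  also have "\<dots> \<le> 2 * freq k" using tower_le_freq(1)[of k] by simp
  finally show ?thesis .
qed

text \<open>The degree 2 * \<open>freq k\<close> falls into a gap: earlier blocks end before it,
  later blocks begin after it, and the current block is cut exactly there. Hence
  \<open>partial_poly k\<close> is a Taylor polynomial of the full sum.\<close>

lemma coeff_partial:
  "coeff (partial_poly k) i = (if i \<le> 2 * freq k then taylor_coeff blocks.\<phi> i else 0)"
proof (cases "i \<le> 2 * freq k")
  case True
  have "coeff (block j) i = 0" if "Suc k \<le> j" for j
  proof (rule coeff_block_low)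
    have "20000000 * freq k \<le> tower j" using that by (intro freq_le_tower) simp
    then show "i < freq j" using True freq_pos[of k] tower_le_freq(2)[of j] by linarith
  qed
  then have "(\<lambda>j. coeff (block j) i) sums (\<Sum>j<Suc k. coeff (block j) i)"
    by (intro sums_finite) auto
  then have "taylor_coeff blocks.\<phi> i = (\<Sum>j<Suc k. coeff (block j) i)"
    using coeff_phi_sums by (rule sums_unique2[symmetric])
  then show ?thesis
    using True by (simp add: partial_poly_def coeff_sum coeff_block_cut)
next
  case False
  have "coeff (block j) i = 0" if "j < k" for j
    using degree_block[OF that] False by (intro coeff_eq_0) simp
  moreover have "coeff (cut_poly k) i = 0"
    using degree_cut[of k] False by (intro coeff_eq_0) simp
  ultimately show ?thesis using False by (simp add: partial_poly_def coeff_sum)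
qed

section \<open>Lower bounds for the weighted norms of the Taylor polynomials\<close>

lemma norm_cis_diff: "norm (cis x - cis y) \<le> \<bar>x - y\<bar>"
proof -
  have "norm (cis x - cis y) ^ 2 = 2 - 2 * cos (x - y)"
    unfolding cmod_power2 using sin_cos_squared_add[of x] sin_cos_squared_add[of y]
    by (simp add: cos_diff power2_eq_square algebra_simps)
  also have "\<dots> = (2 * sin ((x - y) / 2)) ^ 2"
  proof -
    have "cos (x - y) = 1 - 2 * (sin ((x - y) / 2))\<^sup>2"
      using cos_double_sin[of "(x - y) / 2"] by (simp only: nonzero_mult_div_cancel_left times_divide_eq_right)
    then show ?thesis by (simp add: power_mult_distrib)
  qed
  also have "\<dots> \<le> \<bar>x - y\<bar> ^ 2"
    using abs_sin_x_le_abs_x[of "(x - y) / 2"] by (intro power2_le_iff_abs_le[THEN iffD2]) (auto simp: abs_mult)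
  finally show ?thesis by (rule power2_le_imp_le) simp
qed

lemma sfreq_pos: "0 < sfreq k"
  using sfreq_ge[of k] by simp

lemma prev_sum_bound: "20000000 * 16 ^ k * ((\<Sum>j<k. real (freq j)) + 3) ^ 2 \<le> real (tower k)"
  using of_nat_mono[OF tower_ge_sum[of k], where ?'a = real] by simp

text \<open>Block j lives on an arc of width about 1 / \<open>sfreq j\<close> around 1, and t is far
  outside it: t is at least 1 / (2 \<open>sfreq k\<close>), while \<open>tower j\<close> dominates
  \<open>sfreq k ^ 2\<close>. The bound freq j \<ge> tower j ^ 12 leaves enough decay to beat the
  amplitude.\<close>

lemma block_tail:
  assumes t: "1 / (2 * real (sfreq k)) \<le> t" "t \<le> 1 / real (sfreq k)" and j: "k < j"
  shows "norm (poly (block j) (cis t)) \<le> (1 / 2) ^ j"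
proof -
  define s where "s = real (sfreq k)"
  define x where "x = real (tower j)"
  have s: "1 \<le> s" using sfreq_pos[of k] by (simp add: s_def)
  have t01: "0 < t" "t \<le> 1"
    using t s order_trans[of t "1 / s" 1] less_le_trans[of 0 "1 / (2 * s)" t] by (auto simp: s_def)
  then have tpi: "t \<in> {0..2 * pi}" "min t (2 * pi - t) = t"
    using pi_gt3 by (auto simp: min_def)
  have "(1 / (2 * s)) ^ 2 \<le> t ^ 2" using t s by (intro power_mono) (auto simp: s_def)
  then have sg: "1 / (64 * s ^ 2) \<le> (sin (t / 2))\<^sup>2"
    using sin_sq_lower[of t] tpi by (simp add: power_divide power_mult_distrib)
  have x2: "20000000 * s ^ 2 \<le> x" "2 ^ j \<le> x" "1 \<le> x"
  proof -
    show "20000000 * s ^ 2 \<le> x"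
      using of_nat_mono[OF freq_le_tower[OF j], where ?'a = real] by (simp add: x_def s_def freq_eq)
    have "20000000 * 16 ^ j \<le> x" using of_nat_mono[OF tower_ge[of j], where ?'a = real] by (simp add: x_def)
    moreover have "(2::real) ^ j \<le> 16 ^ j" by (intro power_mono) auto
    moreover have "(1::real) \<le> 16 ^ j" by simp
    ultimately show "2 ^ j \<le> x" "1 \<le> x" by linarith+
  qed
  define n where "n = real (freq j)"
  have n: "x ^ 12 \<le> n" "0 < n" "amp j \<le> n"
    using of_nat_mono[OF tower_le_freq(1)[of j], where ?'a = real] freq_pos[of j] amp_le_freq[of j]
    by (auto simp: x_def n_def)
  have y: "n / (256 * s ^ 2) \<le> n * ((sin (t / 2))\<^sup>2 / 4)"
    using mult_left_mono[OF sg, of "n / 4"] n by simp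
  have "norm (poly (block j) (cis t)) \<le> amp j * norm (omega (cis t)) ^ freq j"
    by (rule norm_block_le) simp
  also have "norm (omega (cis t)) ^ freq j \<le> exp (- (n * ((sin (t / 2))\<^sup>2 / 4)))"
    using omega_power_exp[of 1 t "freq j"] by (simp add: n_def)
  also have "\<dots> \<le> exp (- (n / (256 * s ^ 2)))" using y by simp
  also have "\<dots> \<le> (4 / (n / (256 * s ^ 2))) ^ 4" using n s by (intro exp_minus_le) simp
  also have "4 / (n / (256 * s ^ 2)) = 1024 * s ^ 2 / n" by simp
  also have "(1024 * s ^ 2 / n) ^ 4 \<le> (x / n) ^ 4"
    using x2 n by (intro power_mono divide_right_mono) auto
  finally have "norm (poly (block j) (cis t)) \<le> amp j * (x / n) ^ 4"
    using one_le_amp[of j] by (simp add: mult_left_mono)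
  also have "\<dots> \<le> n * (x / n) ^ 4" using n by (intro mult_right_mono) auto
  also have "\<dots> = x ^ 4 / n ^ 3" using n by (simp add: field_simps power_numeral_reduce)
  also have "\<dots> \<le> 1 / x"
  proof -
    have "x ^ 5 \<le> x ^ 12" using x2 by (intro power_increasing) auto
    also have "x ^ 12 \<le> n ^ 1" using n by simp
    also have "n ^ 1 \<le> n ^ 3"
      using n(1) one_le_power[OF x2(3), of 12] by (intro power_increasing) auto
    finally have "x ^ 4 * x \<le> n ^ 3" by (simp add: power_numeral_reduce mult_ac)
    then show ?thesis using x2 n by (simp add: field_simps)
  qed
  also have "\<dots> \<le> 1 / 2 ^ j" using x2 by (intro divide_left_mono) auto
  finally show ?thesis by (simp add: power_one_over)
qed

text \<open>For t \<le> 1 / \<open>sfreq k\<close> Bernoulli's inequality keeps |omega|^n above 3/4,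
  so the cut is almost at full height. In the denominator, |\<phi>| is at most D from the earlier
  blocks, 1 from block k by \<open>near\<close>, and 1 from the later blocks; finally 1 + (D + 2)^2
  \<le> (D + 3)^2.\<close>

lemma good_point:
  assumes t: "1 / (2 * real (sfreq k)) \<le> t" "t \<le> 1 / real (sfreq k)"
    and near: "norm (1 + cis (real (freq k + 1) * t)) \<le> 1 / real (tower k)"
  shows "(peak k / 2) ^ 2 / ((\<Sum>j<k. real (freq j)) + 3) ^ 2
    \<le> (norm (poly (partial_poly k) (cis t)))\<^sup>2 / (1 + (norm (blocks.\<phi> (cis t)))\<^sup>2)"
proof -
  define s where "s = real (sfreq k)"
  define D where "D = (\<Sum>j<k. real (freq j))"
  define x where "x = real (tower k)"
  have D0: "0 \<le> D" by (simp add: D_def sum_nonneg)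
  have s: "1 \<le> s" using sfreq_pos[of k] by (simp add: s_def)
  have t01: "0 < t" "t \<le> 1"
    using t s order_trans[of t "1 / s" 1] less_le_trans[of 0 "1 / (2 * s)" t] by (auto simp: s_def)
  have "cis t \<noteq> 1"
  proof
    assume "cis t = 1"
    then have "sin t = 0" by (simp add: complex_eq_iff)
    moreover have "0 < sin t" using t01 pi_gt3 by (intro sin_gt_zero) auto
    ultimately show False by simp
  qed
  \<comment> \<open>As x is at most \<open>peak k\<close>, the earlier blocks cost at most a quarter
    of the peak, and 3/4 - 1/4 leaves the half claimed below.\<close>
  have D_le: "4 * (D + 3) \<le> x"
  proof -
    have "4 * (D + 3) \<le> 20000000 * 16 ^ k * (D + 3) ^ 2"
    proof (rule mult_mono)
      show "(4::real) \<le> 20000000 * 16 ^ k" using one_le_power[of "16::real" k] by linarith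
      show "D + 3 \<le> (D + 3) ^ 2" using D0 by (intro self_le_power) auto
    qed (use D0 in auto)
    also have "\<dots> \<le> x" using prev_sum_bound[of k] by (simp add: D_def x_def)
    finally show ?thesis .
  qed
  have x1: "1 \<le> x" using tower_pos[of k] by (simp add: x_def)
  have peak_x: "x \<le> peak k" unfolding peak_def x_def[symmetric] using x1 by (intro self_le_power) auto
  have prev: "(\<Sum>j<k. norm (poly (block j) (cis t))) \<le> D"
    unfolding D_def
  proof (rule sum_mono)
    fix j
    have "norm (omega (cis t)) ^ freq j \<le> 1"
      using norm_omega_le[of "cis t"] by (intro power_le_one) auto
    then have "amp j * norm (omega (cis t)) ^ freq j \<le> amp j"
      using one_le_amp[of j] by (intro mult_left_le) auto
    then show "norm (poly (block j) (cis t)) \<le> real (freq j)"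
      using norm_block_le[of "cis t" j] amp_le_freq[of j] by simp
  qed
  have "3 / 4 * peak k \<le> norm (poly (cut_poly k) (cis t))"
  proof -
    have "1 - t ^ 2 / 4 \<le> norm (omega (cis t))"
    proof -
      have "(sin (t / 2))\<^sup>2 \<le> (t / 2) ^ 2"
        using abs_sin_x_le_abs_x[of "t / 2"] by (simp only: abs_le_square_iff)
      then have "1 - t ^ 2 / 4 \<le> (1 + cos t) / 2"
        using cos_double_sin[of "t / 2"] by (simp add: power_divide)
      also have "\<dots> \<le> norm (1 + cis t) / 2"
        using complex_Re_le_cmod[of "1 + cis t"] by simp
      finally show ?thesis by (simp add: omega_def norm_mult norm_divide)
    qed
    moreover have t2: "t ^ 2 \<le> 1" using t01 by (simp add: power_le_one)
    ultimately have "(1 + - (t ^ 2 / 4)) ^ freq k \<le> norm (omega (cis t)) ^ freq k"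
      by (intro power_mono) auto
    moreover have "1 + real (freq k) * - (t ^ 2 / 4) \<le> (1 + - (t ^ 2 / 4)) ^ freq k"
      using t2 by (intro Bernoulli_inequality) simp
    moreover have "real (freq k) * t ^ 2 \<le> 1"
    proof -
      have "t ^ 2 \<le> (1 / s) ^ 2" using t t01 by (intro power_mono) (auto simp: s_def)
      then have "s ^ 2 * t ^ 2 \<le> s ^ 2 * (1 / s) ^ 2" by (intro mult_left_mono) auto
      also have "\<dots> = 1" using s by (simp add: power_divide)
      finally show ?thesis by (simp add: s_def freq_eq)
    qed
    ultimately have "3 / 4 \<le> norm (omega (cis t)) ^ freq k" by simp
    then have "3 / 4 * peak k \<le> norm (omega (cis t)) ^ freq k * peak k"
      using peak_pos[of k] by (intro mult_right_mono) auto
    then show ?thesis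
      using peak_pos[of k] by (simp add: poly_cut norm_mult norm_power mult.commute)
  qed
  moreover have "norm (\<Sum>j<k. poly (block j) (cis t)) \<le> D"
    by (rule order_trans[OF norm_sum prev])
  ultimately have "peak k / 2 \<le> norm (poly (partial_poly k) (cis t))"
    using norm_diff_ineq[of "poly (cut_poly k) (cis t)" "\<Sum>j<k. poly (block j) (cis t)"] D_le peak_x D0
    by (simp add: partial_poly_def poly_sum add.commute)
  then have num: "(peak k / 2) ^ 2 \<le> (norm (poly (partial_poly k) (cis t)))\<^sup>2"
    using peak_pos[of k] by (intro power_mono) auto
  have "norm (blocks.\<phi> (cis t)) \<le> D + 2"
  proof -
    define B where "B = (\<lambda>j. norm (poly (block j) (cis t)))"
    have sB: "summable B" unfolding B_def using \<open>cis t \<noteq> 1\<close> by (intro blocks.summable_norm_B) auto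
    have "norm (blocks.\<phi> (cis t)) \<le> suminf B"
      unfolding blocks.\<phi>_def B_def using sB by (intro summable_norm) (simp add: B_def)
    also have "suminf B = (\<Sum>j. B (j + Suc k)) + (\<Sum>j<Suc k. B j)"
      by (rule suminf_split_initial_segment[OF sB])
    also have "(\<Sum>j. B (j + Suc k)) \<le> (\<Sum>j. (1 / 2) ^ Suc j)"
    proof (rule suminf_le)
      show "B (j + Suc k) \<le> (1 / 2) ^ Suc j" for j
      proof -
        have "B (j + Suc k) \<le> (1 / 2) ^ (j + Suc k)"
          unfolding B_def using t by (intro block_tail) auto
        also have "\<dots> \<le> (1 / 2) ^ Suc j" by (intro power_decreasing) auto
        finally show ?thesis .
      qed
      show "summable (\<lambda>j. B (j + Suc k))" by (rule summable_ignore_initial_segment[OF sB])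
      show "summable (\<lambda>j. (1 / 2 :: real) ^ Suc j)" using power_half_series by (rule sums_summable)
    qed
    also have "(\<Sum>j. (1 / 2 :: real) ^ Suc j) = 1" using power_half_series by (simp add: sums_iff)
    also have "(\<Sum>j<Suc k. B j) \<le> D + 1"
    proof -
      have "B k \<le> 1"
      proof -
        \<comment> \<open>The last factor is at most (1 / x)^(k+4), which cancels the peak x^(k+4)
          exactly.\<close>
        have "B k = peak k * norm (omega (cis t)) ^ freq k * norm (1 + cis (real (freq k + 1) * t)) ^ (k + 4)"
          using peak_pos[of k] by (simp only: B_def poly_block norm_mult norm_power norm_of_real Complex.DeMoivre abs_of_pos)
        also have "\<dots> \<le> peak k * 1 * (1 / x) ^ (k + 4)"
          using near peak_pos[of k] norm_omega_le[of "cis t"]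
          by (intro mult_mono power_mono power_le_one) (auto simp: x_def)
        also have "\<dots> = 1" using x1 by (simp add: peak_def x_def power_divide)
        finally show ?thesis .
      qed
      then show ?thesis using prev by (simp add: B_def)
    qed
    finally show ?thesis by simp
  qed
  then have "(norm (blocks.\<phi> (cis t)))\<^sup>2 \<le> (D + 2) ^ 2" by (intro power_mono) auto
  then have den: "1 + (norm (blocks.\<phi> (cis t)))\<^sup>2 \<le> (D + 3) ^ 2"
    using D0 by (simp add: power2_eq_square algebra_simps)
  have "(peak k / 2) ^ 2 / (D + 3) ^ 2 \<le> (norm (poly (partial_poly k) (cis t)))\<^sup>2 / (1 + (norm (blocks.\<phi> (cis t)))\<^sup>2)"
    by (intro frac_le num den) (auto simp: add_pos_nonneg)
  then show ?thesis by (simp add: D_def)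
qed

text \<open>With M = \<open>freq k + 1\<close>, cis (M t) = -1 at the odd multiples of pi / M, and
  each of them has a good interval of length 2 / (x M) around it. Since M is about s^2, about s such
  points fall between 1 / (2 s) and 1 / s, giving a total measure of order 1 / (s x).\<close>

lemma good_set:
  fixes k :: nat
  defines "E \<equiv> {t. 1 / (2 * real (sfreq k)) \<le> t \<and> t \<le> 1 / real (sfreq k) \<and>
     norm (1 + cis (real (freq k + 1) * t)) \<le> 1 / real (tower k)}"
  shows "\<exists>A. A \<subseteq> E \<and> A \<in> sets borel \<and> A \<subseteq> {0..2 * pi} \<and>
     1 / (112 * real (sfreq k) * real (tower k)) \<le> measure lborel A"
proof -
  define s where "s = real (sfreq k)"
  define x where "x = real (tower k)"
  define M where "M = real (freq k + 1)"
  define m where "m = sfreq k div 56"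
  \<comment> \<open>With m close to s / 56, these indices put 2 l + 1 between s / 4 + 3 and 2 s / 7.
    Multiplication by pi, estimated by 3 and 16/5, keeps \<open>c l\<close> between s / 2 + 2 and s
    - 1; the margins absorb the radius 1 / x \<le> 1 and the difference between M and s^2. At least
    m - 8 indices remain, hence at least s / 112.\<close>
  define I where "I = {7 * m + 8..<8 * m}"
  define c where "c = (\<lambda>l::nat. (2 * real l + 1) * pi)"
  define J where "J = (\<lambda>l. {(c l - 1 / x) / M .. (c l + 1 / x) / M})"
  have s: "20000000 \<le> s" using of_nat_mono[OF sfreq_ge[of k], where ?'a = real] by (simp add: s_def)
  have x: "1 \<le> x" using tower_pos[of k] by (simp add: x_def)
  have M: "M = s ^ 2 + 1" by (simp add: M_def s_def freq_eq)
  have M0: "0 < M" by (simp add: M_def)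
  have x1: "0 < 1 / x" "1 / x \<le> 1" using x by auto
  have m: "s - 56 \<le> 56 * real m" "56 * real m \<le> s"
  proof -
    have "sfreq k = 56 * m + sfreq k mod 56" by (simp add: m_def)
    moreover have "sfreq k mod 56 < 56" by simp
    ultimately have "sfreq k \<le> 56 * m + 56" "56 * m \<le> sfreq k" by linarith+
    then have "real (sfreq k) \<le> real (56 * m + 56)" "real (56 * m) \<le> real (sfreq k)"
      by (simp_all only: of_nat_le_iff)
    then show "s - 56 \<le> 56 * real m" "56 * real m \<le> s" by (simp_all add: s_def)
  qed
  have c_bounds: "s / 2 + 2 \<le> c l" "c l \<le> s - 1" if "l \<in> I" for l
  proof -
    from that have "7 * m + 8 \<le> l" "l + 1 \<le> 8 * m" by (auto simp: I_def)
    then have "real (7 * m + 8) \<le> real l" "real (l + 1) \<le> real (8 * m)" by (simp_all only: of_nat_le_iff)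
    then have l: "s / 4 + 3 \<le> 2 * real l + 1" "2 * real l + 1 \<le> 2 * s / 7" using m by simp_all
    have "(s / 4 + 3) * 3 \<le> c l" unfolding c_def using l s pi_gt3 by (intro mult_mono) auto
    then show "s / 2 + 2 \<le> c l" using s by simp
    have "pi \<le> 16 / 5" using pi_approx(2) by simp
    then have "c l \<le> (2 * s / 7) * (16 / 5)" unfolding c_def using l s by (intro mult_mono) auto
    then show "c l \<le> s - 1" using s by simp
  qed
  have J_sub: "1 / (2 * s) \<le> t" "t \<le> 1 / s" "\<bar>M * t - c l\<bar> \<le> 1 / x" if "l \<in> I" "t \<in> J l" for l t
  proof -
    have t: "c l - 1 / x \<le> M * t" "M * t \<le> c l + 1 / x"
      using that(2) M0 by (auto simp: J_def field_simps)
    then show "\<bar>M * t - c l\<bar> \<le> 1 / x" by linarith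
    have "s / 2 + 1 \<le> M * t" "M * t \<le> s" using t c_bounds[OF that(1)] x1 by linarith+
    moreover have "M * (1 / (2 * s)) \<le> s / 2 + 1" using s by (simp add: M power2_eq_square field_simps)
    moreover have "s \<le> M * (1 / s)" using s by (simp add: M power2_eq_square field_simps)
    ultimately have "M * (1 / (2 * s)) \<le> M * t" "M * t \<le> M * (1 / s)" by linarith+
    then show "1 / (2 * s) \<le> t" "t \<le> 1 / s" using M0 by (simp_all only: mult_le_cancel_left_pos)
  qed
  define A where "A = (\<Union>l\<in>I. J l)"
  have "A \<subseteq> E"
  proof
    fix t assume "t \<in> A"
    then obtain l where l: "l \<in> I" "t \<in> J l" by (auto simp: A_def)
    have "cis (c l) = -1"
    proof -
      have "c l = 2 * pi * real l + pi" by (simp add: c_def algebra_simps)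
      then have "cis (c l) = cis (2 * pi * real l) * cis pi" by (simp only: cis_mult)
      then show ?thesis by simp
    qed
    then have "norm (1 + cis (M * t)) = norm (cis (M * t) - cis (c l))" by (simp add: add.commute)
    also have "\<dots> \<le> \<bar>M * t - c l\<bar>" by (rule norm_cis_diff)
    also have "\<dots> \<le> 1 / x" by (rule J_sub(3)[OF l])
    finally show "t \<in> E" unfolding E_def using J_sub(1,2)[OF l] by (simp add: s_def x_def M_def)
  qed
  moreover have "A \<in> sets borel"
    unfolding A_def J_def by (intro sets.finite_UN) (auto simp: I_def)
  moreover have "A \<subseteq> {0..2 * pi}"
  proof
    fix t assume "t \<in> A"
    then obtain l where l: "l \<in> I" "t \<in> J l" by (auto simp: A_def)
    have "0 \<le> 1 / (2 * s)" "1 / s \<le> 1" using s by auto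
    then show "t \<in> {0..2 * pi}" using J_sub(1,2)[OF l] pi_gt3 by auto
  qed
  moreover have "1 / (112 * s * x) \<le> measure lborel A"
  proof -
    have disj: "disjoint_family_on J I"
      unfolding disjoint_family_on_def
    proof (intro ballI impI)
      fix i j assume ij: "i \<in> I" "j \<in> I" "i \<noteq> j"
      show "J i \<inter> J j = {}"
      proof (rule ccontr)
        assume "J i \<inter> J j \<noteq> {}"
        then obtain t where t: "t \<in> J i" "t \<in> J j" by blast
        have "\<bar>c i - c j\<bar> \<le> 2"
          using J_sub(3)[OF ij(1) t(1)] J_sub(3)[OF ij(2) t(2)] x1 by linarith
        moreover have "\<bar>c i - c j\<bar> = 2 * pi * \<bar>real i - real j\<bar>"
        proof -
          have "c i - c j = 2 * pi * (real i - real j)" by (simp add: c_def algebra_simps)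
          then show ?thesis by (simp add: abs_mult)
        qed
        moreover have "1 \<le> \<bar>real i - real j\<bar>" using ij(3) by linarith
        then have "2 * pi * 1 \<le> 2 * pi * \<bar>real i - real j\<bar>" by (intro mult_left_mono) auto
        ultimately show False using pi_gt3 by linarith
      qed
    qed
    have len: "measure lborel (J l) = 2 / (x * M)" for l
    proof -
      have "(c l - 1 / x) / M \<le> (c l + 1 / x) / M" using M0 x1 by (intro divide_right_mono) auto
      then show ?thesis using M0 x by (simp add: J_def field_simps)
    qed
    have "measure lborel A = (\<Sum>l\<in>I. measure lborel (J l))"
      unfolding A_def by (rule measure_finite_Union) (use disj in \<open>auto simp: I_def J_def emeasure_lborel_Icc_eq\<close>)
    also have "\<dots> = real (card I) * (2 / (x * M))" by (simp add: len)
    also have "\<dots> \<ge> (s / 112) * (2 / (x * (2 * s ^ 2)))"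
    proof (rule mult_mono)
      have "real (card I) \<ge> real m - 8" by (simp add: I_def)
      then show "s / 112 \<le> real (card I)" using m s by linarith
      have "M \<le> 2 * s ^ 2" using s one_le_power[of s 2] by (simp add: M)
      then show "2 / (x * (2 * s ^ 2)) \<le> 2 / (x * M)" using M0 x s by (intro divide_left_mono mult_left_mono mult_pos_pos) auto
    qed (use x s in auto)
    moreover have "(s / 112) * (2 / (x * (2 * s ^ 2))) = 1 / (112 * s * x)"
      using s x by (simp add: power2_eq_square)
    ultimately show ?thesis by linarith
  qed
  ultimately show ?thesis by (auto simp: s_def x_def)
qed

text \<open>The height from \<open>good_point\<close> times the measure from \<open>good_set\<close>
  gives x / (448 (D + 3)^2) with x = \<open>tower k\<close>, where 448 = 4 * 112. This is linear in
  x, and x was chosen after D, so it can exceed any prescribed growth.\<close>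

lemma weighted_norm_large:
  "16 ^ k \<le> (LINT t|circ. (norm (poly (partial_poly k) (cis t)))\<^sup>2 / (1 + (norm (blocks.\<phi> (cis t)))\<^sup>2)) / (2 * pi)"
proof -
  define g where "g = (\<lambda>t. (norm (poly (partial_poly k) (cis t)))\<^sup>2 / (1 + (norm (blocks.\<phi> (cis t)))\<^sup>2))"
  define s where "s = real (sfreq k)"
  define x where "x = real (tower k)"
  define D where "D = (\<Sum>j<k. real (freq j))"
  define \<kappa> where "\<kappa> = (peak k / 2) ^ 2 / (D + 3) ^ 2"
  have D0: "0 \<le> D" by (simp add: D_def sum_nonneg)
  have s: "0 < s" using sfreq_pos[of k] by (simp add: s_def)
  have x: "0 < x" using tower_pos[of k] by (simp add: x_def)
  obtain A where A: "A \<subseteq> {t. 1 / (2 * s) \<le> t \<and> t \<le> 1 / s \<and> norm (1 + cis (real (freq k + 1) * t)) \<le> 1 / x}"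
    "A \<in> sets borel" "A \<subseteq> {0..2 * pi}" "1 / (112 * s * x) \<le> measure lborel A"
    using good_set[of k] unfolding s_def x_def by blast
  have cont: "continuous_on UNIV (\<lambda>t. poly (partial_poly k) (cis t))" by (intro continuous_intros)
  have g0: "0 \<le> g t" for t by (simp add: g_def)
  have gi: "integrable circ g"
  proof (rule Bochner_Integration.integrable_bound)
    show "integrable circ (\<lambda>t. (norm (poly (partial_poly k) (cis t)))\<^sup>2)"
      by (intro integrable_continuous_circ continuous_intros)
    have "(\<lambda>t. poly (partial_poly k) (cis t)) \<in> borel_measurable circ"
      by (intro borel_measurable_circ borel_measurable_continuous_onI cont)
    then show "g \<in> borel_measurable circ"
      unfolding g_def using blocks.phi_cis_measurable by measurable
    have "norm (g t) \<le> norm ((norm (poly (partial_poly k) (cis t)))\<^sup>2)" for t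
    proof -
      have "g t \<le> (norm (poly (partial_poly k) (cis t)))\<^sup>2 / 1"
        unfolding g_def by (intro divide_left_mono) (auto simp: add_pos_nonneg)
      then show ?thesis using g0[of t] by simp
    qed
    then show "AE t in circ. norm (g t) \<le> norm ((norm (poly (partial_poly k) (cis t)))\<^sup>2)" by simp
  qed
  have As: "A \<in> sets circ" using A(2,3) unfolding circ_def by (subst sets_restrict_space_iff) auto
  have Am: "measure circ A = measure lborel A"
    unfolding circ_def using A(2,3) by (intro measure_restrict_space) auto
  have "\<kappa> * measure circ A = (LINT t|circ. \<kappa> * indicator A t)"
    using As A(3) by (simp add: Int_absorb2)
  also have "\<dots> \<le> integral\<^sup>L circ g"
  proof (rule integral_mono[OF _ gi])
    show "integrable circ (\<lambda>t. \<kappa> * indicator A t)"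
    proof (rule integrable_mult_right, rule integrable_real_indicator[OF As])
      show "emeasure circ A < \<infinity>"
        using circ.emeasure_finite[of A] by (simp only: infinity_ennreal_def less_top)
    qed
    fix t
    show "\<kappa> * indicator A t \<le> g t"
    proof (cases "t \<in> A")
      case True
      then show ?thesis
        using A(1) good_point[of k t] by (auto simp: \<kappa>_def D_def s_def x_def g_def)
    qed (simp add: g0)
  qed
  finally have le: "\<kappa> * measure lborel A \<le> integral\<^sup>L circ g" by (simp add: Am)
  have "\<kappa> * (1 / (112 * s * x)) \<le> \<kappa> * measure lborel A"
    using A(4) by (intro mult_left_mono) (auto simp: \<kappa>_def)
  moreover have "\<kappa> * (1 / (112 * s * x)) = x / (448 * (D + 3) ^ 2)"
  proof -
    \<comment> \<open>The choice of exponents pays off here: 2 (k + 4) = (2 k + 6) + 2, so the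
      squared peak contains one factor \<open>sfreq k\<close> and two factors x. The measure of the
      good set removes \<open>sfreq k\<close> and one x.\<close>
    have "peak k ^ 2 = x ^ (2 * (k + 4))"
      unfolding peak_def x_def by (simp only: power_mult[symmetric] mult.commute)
    also have "2 * (k + 4) = (2 * k + 6) + 1 + 1" by simp
    also have "x ^ ((2 * k + 6) + 1 + 1) = s * x * x"
      by (simp only: power_add power_one_right s_def x_def sfreq_def of_nat_power of_nat_mult)
    finally have "(peak k / 2) ^ 2 = s * x * x / 4" by (simp add: power_divide)
    then have "\<kappa> * (1 / (112 * s * x)) = (s * x * x / 4) / (D + 3) ^ 2 * (1 / (112 * s * x))"
      by (simp only: \<kappa>_def)
    also have "\<dots> = x / (448 * (D + 3) ^ 2)" using s x by simp
    finally show ?thesis .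
  qed
  moreover have "20000000 * 16 ^ k / 448 \<le> x / (448 * (D + 3) ^ 2)"
  proof -
    have "20000000 * 16 ^ k * (D + 3) ^ 2 \<le> x" using prev_sum_bound[of k] by (simp add: D_def x_def)
    then have "20000000 * 16 ^ k \<le> x / (D + 3) ^ 2" using D0 by (simp add: pos_le_divide_eq)
    then show ?thesis by simp
  qed
  moreover have "16 ^ k * (2 * pi) \<le> 20000000 * 16 ^ k / 448"
  proof -
    have "16 ^ k * (2 * pi) \<le> 16 ^ k * (20000000 / 448)"
      using pi_less_4 by (intro mult_left_mono) auto
    then show ?thesis by simp
  qed
  ultimately have "16 ^ k * (2 * pi) \<le> integral\<^sup>L circ g" using le by linarith
  then show ?thesis by (simp add: g_def pos_le_divide_eq)
qed

theorem corollary6p2: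
  "\<exists>b a f. pythagorean_pair b a \<and> f \<in> de_Branges_Rovnyak b \<and>
     (\<lambda>z. b z / a z) \<in> (\<Inter>p\<in>{0<..<2}. hardy_space p) \<and>
     \<not> summable (\<lambda>n. cnj (taylor_coeff (\<lambda>z. b z / a z) n) * taylor_coeff f n)"
proof -
  define Q where "Q = (\<lambda>k. Abs_ell2 (coeff (partial_poly k)))"
  have coeff_Q: "coeff_seq (Q k) = coeff (partial_poly k)" for k
    unfolding Q_def
    by (rule coeff_seq_Abs, rule summable_finite[of "{..degree (partial_poly k)}"]) (auto simp: coeff_eq_0)
  have ev_Q: "ev (Q k) z = poly (partial_poly k) z" if "norm z < 1" for k z
  proof -
    have "(\<lambda>n. coeff (partial_poly k) n * z ^ n) sums poly (partial_poly k) z"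
      unfolding poly_altdef by (rule sums_finite) (auto simp: coeff_eq_0)
    then show ?thesis by (simp add: ev_def coeff_Q sums_iff)
  qed
  \<comment> \<open>The growth rate 4^k is the one consumed by
    \<open>uniform_boundedness_glide\<close>; squared, it is the 16^k of
    \<open>weighted_norm_large\<close>.\<close>
  have "4 ^ k \<le> norm (mult_op blocks.a (Q k))" for k
  proof (rule power2_le_imp_le)
    have "(norm (mult_op blocks.a (Q k)))\<^sup>2 = (LINT t|circ. (norm (poly (partial_poly k) (cis t)))\<^sup>2 / (1 + (norm (blocks.\<phi> (cis t)))\<^sup>2)) / (2 * pi)"
      by (rule blocks.norm_mult_op_boundary) (auto simp: ev_Q intro: holomorphic_intros)
    moreover have "(4 ^ k)\<^sup>2 = (16 ^ k :: real)" by (simp add: power2_eq_square flip: power_mult_distrib)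
    ultimately show "(4 ^ k)\<^sup>2 \<le> (norm (mult_op blocks.a (Q k)))\<^sup>2" using weighted_norm_large[of k] by simp
  qed simp
  then obtain f where "f \<in> de_Branges_Rovnyak blocks.b"
    "\<not> summable (\<lambda>n. cnj (taylor_coeff blocks.\<phi> n) * taylor_coeff f n)"
    using blocks.divergent_pairing[of Q "\<lambda>k. 2 * freq k" "taylor_coeff blocks.\<phi>"]
    by (auto simp: coeff_Q coeff_partial)
  moreover have "(\<lambda>z. blocks.b z / blocks.a z) = blocks.\<phi>" by (rule ext) (rule blocks.quotient)
  ultimately show ?thesis
    using blocks.pythagorean phi_in_hardy
    by (intro exI[of _ blocks.b] exI[of _ blocks.a] exI[of _ f]) auto
qed

end
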